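(* Let $k$ be a positive integer, $p>1$, $\eta>-1$, and let $(\alpha_0,\ldots,\alpha_k)\in\mathbb R^{k+1}$ satisfy $\alpha_k-kp+1=0$ and $\alpha_i\ge\alpha_k-(k-i)p$ for all $i=1,\ldots,k$. Let $\gamma=(2p-1+(p-1)\eta)/p$ and let $\theta\in\mathbb R$ satisfy $\theta+2>\gamma$ and $\theta>\lfloor\frac k2\rfloor(\theta+2-\gamma)-1$. Set $\nu=\alpha_k+\lfloor\frac k2\rfloor(\theta-\gamma)p$, and let $\beta_{0,k}$ be the constant given in the context. Then for any $0\le\beta<\beta_{0,k}$ there exists $C_\beta=C(\beta,k,p,\eta)>0$ such that for all $u\in X^{k,p}_\infty(\alpha_0,\ldots,\alpha_k)$ satisfying $\|\nabla_L^ku\|_{L^p_\nu}\le1$, $$\int_0^\infty\exp_p\left(\beta|u|^{\frac p{p-1}}\right)r^\eta\,dr\le C_\beta\|u\|^p_{L^p_\eta}.$$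
   Context: For $p\ge1$ and $\alpha\in\mathbb R$, $\|u\|_{L^p_\alpha}=\left(\int_0^\infty|u|^pr^\alpha\,dr\right)^{1/p}$, and $L^p_\alpha$ is the space of measurable $u:(0,\infty)\to\mathbb R$ with finite such norm. $X^{k,p}_\infty(\alpha_0,\ldots,\alpha_k)$ is the space of functions $u:(0,\infty)\to\mathbb R$ whose weak derivatives satisfy $u^{(j)}\in L^p_{\alpha_j}$ for $j=0,\ldots,k$ (so $u^{(k-1)}$ is locally absolutely continuous on $(0,\infty)$). $L_{\theta,\gamma}u=-r^{-\theta}(r^\gamma u')'$; $\nabla^k_Lu=L_{\theta,\gamma}^{k/2}u$ if $k$ is even and $\nabla_L^ku=(L_{\theta,\gamma}^{(k-1)/2}u)'$ if $k$ is odd. For real $p>1$ and $t\ge0$, $\exp_p(t):=\sum_{j=0}^\infty\frac{t^{p-1+j}}{\Gamma(p+j)}$. The constant $\beta_{0,k}$ is $$\beta_{0,k}=\begin{cases}(\eta+1)\left[(\gamma-1)(\theta+2-\gamma)^{k-2}\dfrac{\Gamma\left(\frac k2\right)\Gamma\left(\frac{\gamma-1}{\theta+2-\gamma}\right)}{\Gamma\left(\frac{\gamma-1}{\theta+2-\gamma}-\frac{k-2}2\right)}\right]^{\frac p{p-1}}&\text{if }k\text{ is even},\\[4mm](\eta+1)\left[(\gamma-1)(\theta+2-\gamma)^{k-2}\dfrac{\Gamma\left(\frac{k+1}2\right)\Gamma\left(\frac{\gamma-1}{\theta+2-\gamma}\right)}{\Gamma\left(\frac{\gamma-1}{\theta+2-\gamma}-\frac{k-3}2\right)}\right]^{\frac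 p{p-1}}&\text{if }k\text{ is odd}.\end{cases}$$
   Formalization: The constant C_β may depend on the value of β_{0,k} besides β, k, p, η (so on θ only through β_{0,k}); a constant uniform over all θ with β<β_{0,k} is impossible for k≥3, since it would give the inequality at the critical exponent, where it fails. *)

theory Defs
  imports "HOL-Analysis.Analysis"
begin

text \<open>
  Functions on the half-line \<open>(0,\<infinity>)\<close> are represented by total functions on the reals of which
  only the values on \<open>{0<..}\<close> are ever used. ``Measurable'' means Lebesgue measurable.
\<close>

text \<open>The power \<open>x\<^sup>a\<close> on \<open>[0,\<infinity>]\<close>, only used with exponents \<open>a > 0\<close> (hence \<open>\<infinity>\<^sup>a = \<infinity>\<close>).\<close>

definition ennpowr :: "ennreal \<Rightarrow> real \<Rightarrow> ennreal" where
  "ennpowr x a = (if x = top then top else ennreal (enn2real x powr a))"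

definition wLp_norm :: "real \<Rightarrow> real \<Rightarrow> (real \<Rightarrow> real) \<Rightarrow> ennreal" where
  "wLp_norm p a u =
     ennpowr (\<integral>\<^sup>+r\<in>{0<..}. ennreal (\<bar>u r\<bar> powr p * r powr a) \<partial>lebesgue) (1 / p)"

definition wLp :: "real \<Rightarrow> real \<Rightarrow> (real \<Rightarrow> real) set" where
  "wLp p a = {u. set_borel_measurable lebesgue {0<..} u \<and> wLp_norm p a u < top}"

definition test_function :: "(real \<Rightarrow> real) \<Rightarrow> bool" where
  "test_function \<phi> \<longleftrightarrow>
     (\<forall>j x. ((deriv ^^ j) \<phi>) differentiable (at x)) \<and>
     compact (closure {x. \<phi> x \<noteq> 0}) \<and> closure {x. \<phi> x \<noteq> 0} \<subseteq> {0<..}"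

definition locally_integrable :: "(real \<Rightarrow> real) \<Rightarrow> bool" where
  "locally_integrable u \<longleftrightarrow> (\<forall>K. compact K \<and> K \<subseteq> {0<..} \<longrightarrow> set_integrable lebesgue K u)"

definition has_weak_deriv :: "nat \<Rightarrow> (real \<Rightarrow> real) \<Rightarrow> (real \<Rightarrow> real) \<Rightarrow> bool" where
  "has_weak_deriv j u v \<longleftrightarrow>
     locally_integrable u \<and> locally_integrable v \<and>
     (\<forall>\<phi>. test_function \<phi> \<longrightarrow>
        (LINT r:{0<..}|lebesgue. u r * (deriv ^^ j) \<phi> r)
          = (- 1) ^ j * (LINT r:{0<..}|lebesgue. v r * \<phi> r))"

definition X_infty :: "nat \<Rightarrow> real \<Rightarrow> (nat \<Rightarrow> real) \<Rightarrow> (real \<Rightarrow> real) set" where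
  "X_infty k p \<alpha> = {u. \<forall>j\<le>k. \<exists>v\<in>wLp p (\<alpha> j). has_weak_deriv j u v}"

text \<open>
  A representative of the weak derivative, which is unique up to null sets. The value is arbitrary
  if there is no weak derivative; this does not occur in \<open>nabla_L \<theta> \<gamma> k u\<close> for \<open>u\<close> in
  \<open>X_infty k p \<alpha>\<close>, since \<open>r\<^sup>\<gamma>\<close> and \<open>r\<^sup>-\<^sup>\<theta>\<close> are smooth on \<open>(0,\<infinity>)\<close>.
\<close>

definition weak_deriv :: "(real \<Rightarrow> real) \<Rightarrow> real \<Rightarrow> real" where
  "weak_deriv u = (SOME v. has_weak_deriv 1 u v)"

definition op_L :: "real \<Rightarrow> real \<Rightarrow> (real \<Rightarrow> real) \<Rightarrow> real \<Rightarrow> real" where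
  "op_L \<theta> \<gamma> u = (\<lambda>r. - (r powr (- \<theta>)) * weak_deriv (\<lambda>s. s powr \<gamma> * weak_deriv u s) r)"

definition nabla_L :: "real \<Rightarrow> real \<Rightarrow> nat \<Rightarrow> (real \<Rightarrow> real) \<Rightarrow> real \<Rightarrow> real" where
  "nabla_L \<theta> \<gamma> k u =
     (if even k then (op_L \<theta> \<gamma> ^^ (k div 2)) u
      else weak_deriv ((op_L \<theta> \<gamma> ^^ ((k - 1) div 2)) u))"

definition exp_p :: "real \<Rightarrow> real \<Rightarrow> real" where
  "exp_p p t = (\<Sum>j. t powr (p - 1 + real j) / Gamma (p + real j))"

text \<open>The exponent \<open>k - 2\<close> is an integer power, as it equals \<open>-1\<close> for \<open>k = 1\<close>.\<close>

definition beta0 :: "nat \<Rightarrow> real \<Rightarrow> real \<Rightarrow> real \<Rightarrow> real \<Rightarrow> real" where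
  "beta0 k p \<eta> \<gamma> \<theta> =
     (let x = (\<gamma> - 1) / (\<theta> + 2 - \<gamma>);
          c = (\<gamma> - 1) * (\<theta> + 2 - \<gamma>) powi (int k - 2)
      in if even k
         then (\<eta> + 1) *
              (c * (Gamma (real k / 2) * Gamma x / Gamma (x - (real k - 2) / 2))) powr (p / (p - 1))
         else (\<eta> + 1) *
              (c * (Gamma ((real k + 1) / 2) * Gamma x / Gamma (x - (real k - 3) / 2))) powr (p / (p - 1)))"

end

theory Submission
  imports Defs
begin

text \<open>
  Write \<open>D = r d/dr\<close>, \<open>\<delta> = \<theta> + 2 - \<gamma>\<close>, \<open>q = p / (p - 1)\<close> and \<open>m = k div 2\<close>. Conjugation by powers of \<open>r\<close>
  gives the operator \<open>L\<close> constant coefficients: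
  \<open>L (r\<^sup>-\<^sup>b f) = - r\<^sup>-\<^sup>b\<^sup>-\<^sup>\<delta> (D + \<gamma> - 1 - b) (D - b) f\<close>. By iteration, \<open>\<nabla>\<^sub>L\<^sup>k u\<close> is, up to sign and a power
  of \<open>r\<close>, the function obtained from \<open>D u\<close> by applying the operators \<open>D + (\<gamma> - 1 - i \<delta>)\<close> for \<open>0 \<le> i < m\<close>
  and \<open>D - i \<delta>\<close> for \<open>1 \<le> i < k - m\<close>; this is \<open>nabla_L_chain\<close>. The exponent \<open>\<nu>\<close> is the one for which
  the norm of \<open>\<nabla>\<^sub>L\<^sup>k u\<close> in \<open>L\<^sup>p\<^sub>\<nu>\<close> is the norm of that function in \<open>L\<^sup>p(dr/r)\<close>, and the lower bound on \<open>\<theta>\<close>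
  says that all the numbers \<open>\<gamma> - 1 - i \<delta>\<close> are positive.

  On \<open>L\<^sup>p(dr/r)\<close> the operator \<open>D + a\<close> with \<open>a \<noteq> 0\<close> is inverted by convolution, on the multiplicative
  group \<open>(0,\<infinity>)\<close>, with a kernel of constant sign and total mass \<open>1 / \<bar>a\<bar>\<close>. Hence \<open>\<bar>a\<bar> \<parallel>f\<parallel> \<le> \<parallel>D f + a f\<parallel>\<close>, which
  is \<open>hardy_inequality\<close>. Applying it once for each factor bounds \<open>\<parallel>D u\<parallel>\<close> by \<open>1 / H\<close>, where \<open>H\<close> is the
  product of the absolute values of the constants above (\<open>log_energy_gradient_le\<close>). A computation
  with Gamma functions shows \<open>\<beta>\<^sub>0\<^sub>,\<^sub>k = (\<eta> + 1) H\<^sup>q\<close> (\<open>beta0_eq_hardy_product\<close>). So the inequality of order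
  \<open>k\<close>, with its sharp threshold, follows from an inequality of order one in which \<open>\<theta>\<close> no longer
  occurs, and the constant depends on \<open>\<theta>\<close> through the value of \<open>\<beta>\<^sub>0\<^sub>,\<^sub>k\<close> alone.

  For order one (\<open>subcritical_inequality\<close>), let \<open>\<parallel>D u\<parallel> \<le> M\<close> with \<open>\<beta> M\<^sup>q < \<eta> + 1\<close>. Hoelder's inequality
  gives \<open>\<bar>u(y) - u(x)\<bar> \<le> M (ln (y/x))\<^sup>1\<^sup>/\<^sup>q\<close>. Choose \<open>R\<close> with \<open>R\<^sup>\<eta>\<^sup>+\<^sup>1\<close> slightly above the \<open>p\<close>-th power of the
  norm of \<open>u\<close> in \<open>L\<^sup>p\<^sub>\<eta>\<close>. Each interval \<open>[m, e m]\<close> with \<open>m \<ge> R\<close> then contains a point at which \<open>\<bar>u\<bar> < 2\<close>.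
  Beyond \<open>R\<close> this makes \<open>u\<close> bounded, so that the integrand is at most a multiple of \<open>\<bar>u\<bar>\<^sup>p\<close>. Below \<open>R\<close> it
  gives \<open>\<bar>u(r)\<bar> \<le> 2 + M (1 + ln (R/r))\<^sup>1\<^sup>/\<^sup>q\<close>, so that \<open>exp\<^sub>p (\<beta> \<bar>u\<bar>\<^sup>q)\<close> is at most a multiple of \<open>(R/r)\<^sup>\<mu>\<close> for
  some \<open>\<mu> < \<eta> + 1\<close>, whose integral over \<open>(0,R)\<close> against \<open>r\<^sup>\<eta> dr\<close> is a multiple of \<open>R\<^sup>\<eta>\<^sup>+\<^sup>1\<close>.

  Weak derivatives enter through two facts. Products with powers of \<open>r\<close> obey Leibniz' rule
  (\<open>has_weak_deriv_mult_smooth\<close>), which suffices for all the algebra, and outside a null set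
  \<open>\<bar>u(y) - u(x)\<bar>\<close> is at most the integral of \<open>\<bar>u'\<bar>\<close> from \<open>x\<close> to \<open>y\<close> (\<open>weak_deriv_increment\<close>), which suffices
  for all the estimates.
\<close>

section \<open>Functions with derivatives of all orders\<close>

definition smooth_on :: "real set \<Rightarrow> (real \<Rightarrow> real) \<Rightarrow> bool" where
  "smooth_on S f \<longleftrightarrow> (\<forall>n. \<forall>x\<in>S. (deriv ^^ n) f differentiable at x)"

text \<open>
  A set of functions whose derivatives are linear combinations of members of the set consists of
  functions with derivatives of all orders. Leibniz' rule, powers and the flat exponentials below
  are instances, with different generating sets.
\<close>

inductive_set lincombs :: "(real \<Rightarrow> real) set \<Rightarrow> (real \<Rightarrow> real) set" for G where
  base: "g \<in> G \<Longrightarrow> g \<in> lincombs G"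
| add: "f \<in> lincombs G \<Longrightarrow> g \<in> lincombs G \<Longrightarrow> (\<lambda>x. f x + g x) \<in> lincombs G"
| scale: "f \<in> lincombs G \<Longrightarrow> (\<lambda>x. c * f x) \<in> lincombs G"

lemma has_real_derivative_transform_open:
  fixes f g :: "real \<Rightarrow> real"
  assumes "open S" "x \<in> S" "\<And>y. y \<in> S \<Longrightarrow> g y = f y" "(f has_real_derivative d) (at x)"
  shows "(g has_real_derivative d) (at x)"
proof -
  have "eventually (\<lambda>y. g y = f y) (nhds x)"
    using assms(1-3) by (auto simp: eventually_nhds)
  then show ?thesis using assms(4) DERIV_cong_ev[of x x g f d d] by simp
qed

lemma lincombs_derivative:
  assumes "f \<in> lincombs G"
    and "\<And>g. g \<in> G \<Longrightarrow> \<exists>h\<in>lincombs G. \<forall>x\<in>S. (g has_real_derivative h x) (at x)"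
  shows "\<exists>h\<in>lincombs G. \<forall>x\<in>S. (f has_real_derivative h x) (at x)"
  using assms(1)
proof induction
  case (base g)
  then show ?case using assms(2) by blast
next
  case (add f g)
  then obtain h k where "h \<in> lincombs G" "k \<in> lincombs G"
      "\<forall>x\<in>S. (f has_real_derivative h x) (at x)" "\<forall>x\<in>S. (g has_real_derivative k x) (at x)"
    by blast
  then show ?case
    by (intro bexI[of _ "\<lambda>x. h x + k x"] lincombs.add) (auto intro!: derivative_intros)
next
  case (scale f c)
  then obtain h where "h \<in> lincombs G" "\<forall>x\<in>S. (f has_real_derivative h x) (at x)"
    by blast
  then show ?case
    by (intro bexI[of _ "\<lambda>x. c * h x"] lincombs.scale) (auto intro!: DERIV_cmult)
qed

lemma smooth_on_lincombsI:
  assumes S: "open S" and f: "f \<in> lincombs G"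
    and G: "\<And>g. g \<in> G \<Longrightarrow> \<exists>h\<in>lincombs G. \<forall>x\<in>S. (g has_real_derivative h x) (at x)"
  shows "smooth_on S f"
proof -
  note D = has_real_derivative_transform_open[OF S]
  have *: "\<exists>h\<in>lincombs G. \<forall>x\<in>S. (deriv ^^ n) f x = h x" for n
  proof (induction n)
    case 0
    then show ?case using f by auto
  next
    case (Suc n)
    then obtain h where h: "h \<in> lincombs G" "\<forall>x\<in>S. (deriv ^^ n) f x = h x" by blast
    obtain k where k: "k \<in> lincombs G" "\<forall>x\<in>S. (h has_real_derivative k x) (at x)"
      using lincombs_derivative[OF h(1) G] by blast
    have "deriv ((deriv ^^ n) f) x = k x" if "x \<in> S" for x
      by (rule DERIV_imp_deriv[OF D[OF that, of _ h]]) (use h(2) k(2) that in auto)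
    then show ?case using k(1) by auto
  qed
  show ?thesis unfolding smooth_on_def
  proof (intro allI ballI)
    fix n x assume x: "x \<in> S"
    obtain h where h: "h \<in> lincombs G" "\<forall>x\<in>S. (deriv ^^ n) f x = h x" using * by blast
    obtain k where k: "k \<in> lincombs G" "\<forall>x\<in>S. (h has_real_derivative k x) (at x)"
      using lincombs_derivative[OF h(1) G] by blast
    show "(deriv ^^ n) f differentiable at x"
      unfolding real_differentiable_def
      by (rule exI, rule D[OF x, of _ h]) (use h(2) k(2) x in auto)
  qed
qed

lemma smooth_on_DERIV:
  "smooth_on S f \<Longrightarrow> x \<in> S \<Longrightarrow> (f has_real_derivative deriv f x) (at x)"
  unfolding smooth_on_def by (metis DERIV_deriv_iff_real_differentiable funpow_0)

lemma smooth_on_deriv: "smooth_on S f \<Longrightarrow> smooth_on S (deriv f)"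
  unfolding smooth_on_def by (metis comp_apply funpow_Suc_right)

lemma smooth_on_mult:
  assumes S: "open S" and fg: "smooth_on S f" "smooth_on S g"
  shows "smooth_on S (\<lambda>x. f x * g x)"
proof -
  define G where "G = {\<lambda>x. f x * g x |f g. smooth_on S f \<and> smooth_on S g}"
  show ?thesis
  proof (rule smooth_on_lincombsI[OF S, where G = G])
    show "(\<lambda>x. f x * g x) \<in> lincombs G" using fg by (intro lincombs.base) (auto simp: G_def)
    fix h assume "h \<in> G"
    then obtain f g where h: "h = (\<lambda>x. f x * g x)" and fg: "smooth_on S f" "smooth_on S g"
      by (auto simp: G_def)
    have "(\<lambda>x. deriv f x * g x) \<in> G" "(\<lambda>x. f x * deriv g x) \<in> G"
      using fg smooth_on_deriv by (auto simp: G_def)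
    then have "(\<lambda>x. deriv f x * g x + f x * deriv g x) \<in> lincombs G" by (intro lincombs.add lincombs.base)
    moreover have "(h has_real_derivative deriv f x * g x + f x * deriv g x) (at x)" if "x \<in> S" for x
      unfolding h using DERIV_mult[OF smooth_on_DERIV[OF fg(1) that] smooth_on_DERIV[OF fg(2) that]]
      by (simp add: algebra_simps)
    ultimately show "\<exists>h'\<in>lincombs G. \<forall>x\<in>S. (h has_real_derivative h' x) (at x)"
      by (intro bexI[of _ "\<lambda>x. deriv f x * g x + f x * deriv g x"]) auto
  qed
qed

lemma smooth_on_lincombs_smooth:
  assumes S: "open S" and f: "f \<in> lincombs {f. smooth_on S f}"
  shows "smooth_on S f"
proof (rule smooth_on_lincombsI[OF S f])
  fix g assume "g \<in> {f. smooth_on S f}"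
  then have g: "smooth_on S g" by simp
  show "\<exists>h\<in>lincombs {f. smooth_on S f}. \<forall>x\<in>S. (g has_real_derivative h x) (at x)"
    by (rule bexI[of _ "deriv g"]) (auto intro: smooth_on_DERIV[OF g] lincombs.base smooth_on_deriv[OF g])
qed

lemma smooth_on_add:
  "open S \<Longrightarrow> smooth_on S f \<Longrightarrow> smooth_on S g \<Longrightarrow> smooth_on S (\<lambda>x. f x + g x)"
  by (rule smooth_on_lincombs_smooth) (auto intro: lincombs.add lincombs.base)

lemma smooth_on_cmult: "open S \<Longrightarrow> smooth_on S f \<Longrightarrow> smooth_on S (\<lambda>x. c * f x)"
  by (rule smooth_on_lincombs_smooth) (auto intro: lincombs.scale lincombs.base)

lemma smooth_on_affine:
  assumes f: "smooth_on UNIV f"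
  shows "smooth_on UNIV (\<lambda>x. f (a * x + b))"
proof (rule smooth_on_lincombsI[where G = "{\<lambda>x. f (a * x + b) |f. smooth_on UNIV f}"])
  show "(\<lambda>x. f (a * x + b)) \<in> lincombs {\<lambda>x. f (a * x + b) |f. smooth_on UNIV f}"
    using f by (intro lincombs.base) auto
  fix g assume "g \<in> {\<lambda>x. f (a * x + b) |f. smooth_on UNIV f}"
  then obtain f where f: "smooth_on UNIV f" and g: "g = (\<lambda>x. f (a * x + b))" by auto
  have "(g has_real_derivative a * deriv f (a * x + b)) (at x)" for x
  proof -
    have "((\<lambda>x. f (a * x + b)) has_real_derivative deriv f (a * x + b) * a) (at x)"
      by (rule DERIV_chain2[OF smooth_on_DERIV[OF f]]) (auto intro!: derivative_eq_intros)
    then show ?thesis by (simp add: g mult.commute)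
  qed
  moreover have "(\<lambda>x. a * deriv f (a * x + b)) \<in> lincombs {\<lambda>x. f (a * x + b) |f. smooth_on UNIV f}"
    using smooth_on_deriv[OF f] by (intro lincombs.scale lincombs.base) auto
  ultimately show "\<exists>h\<in>lincombs {\<lambda>x. f (a * x + b) |f. smooth_on UNIV f}.
      \<forall>x\<in>UNIV. (g has_real_derivative h x) (at x)"
    by (intro bexI[of _ "\<lambda>x. a * deriv f (a * x + b)"]) auto
qed auto

text \<open>
  A function that is smooth on the half-line and vanishes outside a compact subset of it is smooth
  on the whole line, by covering the line with two open sets.
\<close>

lemma smooth_on_Un: "smooth_on S f \<Longrightarrow> smooth_on T f \<Longrightarrow> smooth_on (S \<union> T) f"
  unfolding smooth_on_def by blast

lemma smooth_on_cong:
  assumes S: "open S" and f: "smooth_on S f" and eq: "\<And>x. x \<in> S \<Longrightarrow> g x = f x"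
  shows "smooth_on S g"
proof -
  define G where "G = {g. \<exists>f. smooth_on S f \<and> (\<forall>x\<in>S. g x = f x)}"
  show ?thesis
  proof (rule smooth_on_lincombsI[OF S, where G = G])
    show "g \<in> lincombs G" using f eq by (intro lincombs.base) (auto simp: G_def)
    fix h assume "h \<in> G"
    then obtain f where f: "smooth_on S f" "\<forall>x\<in>S. h x = f x" by (auto simp: G_def)
    have "\<forall>x\<in>S. (h has_real_derivative deriv f x) (at x)"
      using has_real_derivative_transform_open[OF S] f smooth_on_DERIV by metis
    moreover have "deriv f \<in> lincombs G" 
      using smooth_on_deriv[OF f(1)] by (intro lincombs.base) (auto simp: G_def)
    ultimately show "\<exists>h'\<in>lincombs G. \<forall>x\<in>S. (h has_real_derivative h' x) (at x)" by blast
  qed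
qed

lemma smooth_on_zero: "smooth_on S (\<lambda>x. 0)"
proof -
  have "(deriv ^^ n) (\<lambda>x. 0 :: real) = (\<lambda>x. 0)" for n
    by (induction n) auto
  then show ?thesis by (auto simp: smooth_on_def)
qed

lemma smooth_on_powr: "smooth_on {0<..} (\<lambda>x. x powr a)"
proof (rule smooth_on_lincombsI[where G = "range (\<lambda>a x. x powr a)"])
  show "(\<lambda>x. x powr a) \<in> lincombs (range (\<lambda>a x. x powr a))" by (intro lincombs.base) auto
  fix g :: "real \<Rightarrow> real" assume "g \<in> range (\<lambda>a x. x powr a)"
  then obtain a where g: "g = (\<lambda>x. x powr a)" by auto
  have "(\<lambda>x. a * x powr (a - 1)) \<in> lincombs (range (\<lambda>a x. x powr a))" by (intro lincombs.scale lincombs.base) auto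
  then show "\<exists>h\<in>lincombs (range (\<lambda>a x. x powr a)). \<forall>x\<in>{0<..}. (g has_real_derivative h x) (at x)"
    unfolding g by (intro bexI) (auto intro!: has_real_derivative_powr)
qed auto

text \<open>
  These are the functions that occur as derivatives of \<open>exp (- 1/x)\<close>, continued by \<open>0\<close> to \<open>x \<le> 0\<close>; the
  derivative of each is a combination of the next two.
\<close>

definition flat_exp :: "nat \<Rightarrow> real \<Rightarrow> real" where
  "flat_exp n x = (if x > 0 then (1 / x) ^ n * exp (- (1 / x)) else 0)"

lemma flat_exp_tendsto_0: "(flat_exp n \<longlongrightarrow> 0) (at 0)"
proof -
  have "((\<lambda>y::real. y ^ n / exp y) \<longlongrightarrow> 0) at_top" by (rule tendsto_power_div_exp_0)
  then have "((\<lambda>x::real. inverse x ^ n / exp (inverse x)) \<longlongrightarrow> 0) (at_right 0)"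
    by (rule filterlim_compose[OF _ filterlim_inverse_at_top_right])
  then have "(flat_exp n \<longlongrightarrow> 0) (at_right 0)"
    by (rule Lim_transform_eventually)
       (auto simp: eventually_at_filter flat_exp_def exp_minus field_simps)
  moreover have "(flat_exp n \<longlongrightarrow> 0) (at_left 0)"
    by (rule tendsto_eventually) (auto simp: eventually_at_filter flat_exp_def)
  ultimately show ?thesis by (rule filterlim_split_at_real[rotated])
qed

lemma flat_exp_DERIV:
  "(flat_exp n has_real_derivative (- real n) * flat_exp (Suc n) x + flat_exp (Suc (Suc n)) x) (at x)"
proof (cases x "0 :: real" rule: linorder_cases)
  case less
  then show ?thesis
    by (intro has_real_derivative_transform_open[of "{..<0}" x "flat_exp n" "\<lambda>x. 0"]) (auto simp: flat_exp_def)
next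
  case equal
  have "((\<lambda>h. (flat_exp n (0 + h) - flat_exp n 0) / h) \<longlongrightarrow> 0) (at 0)"
    by (rule Lim_transform_eventually[OF flat_exp_tendsto_0[of "Suc n"]])
       (auto simp: flat_exp_def eventually_at_filter)
  then show ?thesis unfolding equal by (simp add: DERIV_def flat_exp_def)
next
  case greater
  have "((\<lambda>x. (1 / x) ^ n * exp (- (1 / x))) has_real_derivative
     (- real n) * flat_exp (Suc n) x + flat_exp (Suc (Suc n)) x) (at x)"
  proof -
    have d: "((\<lambda>x. 1 / x) has_real_derivative - ((1 / x) * (1 / x))) (at x)"
      using greater by (auto intro!: derivative_eq_intros simp: field_simps)
    show ?thesis
      by (rule DERIV_cong[OF DERIV_mult[OF DERIV_power[OF d, of n]
            DERIV_chain2[OF DERIV_exp DERIV_minus[OF d]]]])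
         (use greater in \<open>cases n; simp add: flat_exp_def algebra_simps flip: add_divide_distrib\<close>)
  qed
  with greater show ?thesis
    by (intro has_real_derivative_transform_open[of "{0<..}" x "flat_exp n"]) (auto simp: flat_exp_def)
qed

lemma smooth_on_flat_exp: "smooth_on UNIV (flat_exp n)"
proof (rule smooth_on_lincombsI[where G = "range flat_exp"])
  show "flat_exp n \<in> lincombs (range flat_exp)" by (intro lincombs.base) auto
  fix g assume "g \<in> range flat_exp"
  then obtain n where g: "g = flat_exp n" by auto
  have "(\<lambda>x. (- real n) * flat_exp (Suc n) x + flat_exp (Suc (Suc n)) x) \<in> lincombs (range flat_exp)"
    by (intro lincombs.add lincombs.scale lincombs.base) auto
  then show "\<exists>h\<in>lincombs (range flat_exp). \<forall>x\<in>UNIV. (g has_real_derivative h x) (at x)"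
    unfolding g using flat_exp_DERIV[of n] by (intro bexI[of _ "\<lambda>x. (- real n) * flat_exp (Suc n) x + flat_exp (Suc (Suc n)) x"]) auto
qed auto

section \<open>Test functions and the fundamental lemma of the calculus of variations\<close>

text \<open>
  The test functions with support in a fixed interval form a vector space on which the arguments
  below are carried out; for \<open>0 < a\<close> they are test functions in the sense of \<open>test_function\<close>.
\<close>

definition test_on :: "real \<Rightarrow> real \<Rightarrow> (real \<Rightarrow> real) \<Rightarrow> bool" where
  "test_on a b \<phi> \<longleftrightarrow> smooth_on UNIV \<phi> \<and> (\<forall>x. x \<notin> {a..b} \<longrightarrow> \<phi> x = 0)"

lemma test_on_imp_test_function:
  assumes "0 < a" "test_on a b \<phi>"
  shows "test_function \<phi>"
proof -
  have sub: "closure {x. \<phi> x \<noteq> 0} \<subseteq> {a..b}"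
    using assms(2) by (intro closure_minimal) (auto simp: test_on_def)
  then have "compact (closure {x. \<phi> x \<noteq> 0})"
    by (meson bounded_closed_interval bounded_subset closed_closure compact_eq_bounded_closed)
  then show ?thesis using sub assms
    by (auto simp: test_function_def test_on_def smooth_on_def)
qed

lemma compact_positive_subset_interval:
  fixes K :: "real set"
  assumes K: "compact K" "K \<subseteq> {0<..}"
  shows "\<exists>a b. 0 < a \<and> a < b \<and> K \<subseteq> {a..b}"
proof (cases "K = {}")
  case True
  then show ?thesis by (intro exI[of _ 1] exI[of _ 2]) auto
next
  case False
  obtain a where a: "a \<in> K" "\<And>t. t \<in> K \<Longrightarrow> a \<le> t"
    using compact_attains_inf[OF K(1) False] by blast
  obtain b where b: "\<And>t. t \<in> K \<Longrightarrow> t \<le> b"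
    using compact_attains_sup[OF K(1) False] by blast
  show ?thesis
    using a b K(2) by (intro exI[of _ a] exI[of _ "b + 1"]) force
qed

lemma test_functionE:
  assumes "test_function \<phi>"
  obtains a b where "0 < a" "a < b" "test_on a b \<phi>"
proof -
  let ?K = "closure {x. \<phi> x \<noteq> 0}"
  have K: "compact ?K" "?K \<subseteq> {0<..}" and s: "smooth_on UNIV \<phi>"
    using assms by (auto simp: test_function_def smooth_on_def)
  obtain a b where ab: "0 < a" "a < b" "?K \<subseteq> {a..b}"
    using compact_positive_subset_interval[OF K] by blast
  have "\<phi> x = 0" if "x \<notin> {a..b}" for x
    using that ab(3) closure_subset[of "{x. \<phi> x \<noteq> 0}"] by auto
  then have "test_on a b \<phi>" using s by (auto simp: test_on_def)
  with ab show thesis by (intro that)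
qed

lemma test_on_add: "test_on a b \<phi> \<Longrightarrow> test_on a b \<psi> \<Longrightarrow> test_on a b (\<lambda>x. \<phi> x + \<psi> x)"
  by (auto simp: test_on_def intro: smooth_on_add)

lemma test_on_cmult: "test_on a b \<phi> \<Longrightarrow> test_on a b (\<lambda>x. c * \<phi> x)"
  by (auto simp: test_on_def intro: smooth_on_cmult)

lemma test_on_DERIV: "test_on a b \<phi> \<Longrightarrow> (\<phi> has_real_derivative deriv \<phi> x) (at x)"
  by (auto simp: test_on_def intro: smooth_on_DERIV)

lemma test_on_deriv:
  assumes "test_on a b \<phi>"
  shows "test_on a b (deriv \<phi>)"
  unfolding test_on_def
proof (intro conjI allI impI)
  show "smooth_on UNIV (deriv \<phi>)" using assms by (auto simp: test_on_def intro: smooth_on_deriv)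
  fix x assume x: "x \<notin> {a..b}"
  have "(\<phi> has_real_derivative 0) (at x)"
    by (rule has_real_derivative_transform_open[where S = "- {a..b}" and f = "\<lambda>x. 0"])
       (use x assms in \<open>auto simp: test_on_def\<close>)
  then show "deriv \<phi> x = 0" by (rule DERIV_imp_deriv)
qed

lemma test_on_continuous: "test_on a b \<phi> \<Longrightarrow> continuous_on S \<phi>"
  by (meson DERIV_continuous_on continuous_on_subset subset_UNIV test_on_DERIV has_field_derivative_at_within)

lemma test_on_measurable: "test_on a b \<phi> \<Longrightarrow> \<phi> \<in> borel_measurable borel"
  by (intro borel_measurable_continuous_onI test_on_continuous)

lemma test_on_bounded:
  assumes "test_on a b \<phi>"
  obtains C where "\<And>x. \<bar>\<phi> x\<bar> \<le> C" "0 \<le> C"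
proof -
  have "bounded (\<phi> ` {a..b})"
    by (intro compact_imp_bounded compact_continuous_image test_on_continuous[OF assms]) auto
  then obtain C where C: "\<And>x. x \<in> {a..b} \<Longrightarrow> \<bar>\<phi> x\<bar> \<le> C"
    unfolding bounded_iff by (auto simp del: atLeastAtMost_iff)
  have "\<bar>\<phi> x\<bar> \<le> \<bar>C\<bar>" for x
    using C[of x] assms by (cases "x \<in> {a..b}") (auto simp: test_on_def)
  then show thesis by (rule that) auto
qed

lemma test_on_integrable_mult:
  assumes "test_on a b \<phi>" "integrable lborel f"
  shows "integrable lborel (\<lambda>x. f x * \<phi> x)"
proof -
  obtain C where C: "\<And>x. \<bar>\<phi> x\<bar> \<le> C" using test_on_bounded[OF assms(1)] by blast
  have m: "\<phi> \<in> borel_measurable lborel" using test_on_measurable[OF assms(1)] by simp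
  show ?thesis
    by (rule Bochner_Integration.integrable_bound[where f = "\<lambda>x. C * f x"])
       (use assms(2) m in \<open>auto simp: abs_mult mult.commute[of "\<bar>f _\<bar>"]
          intro!: mult_right_mono order_trans[OF C abs_ge_self]\<close>)
qed

lemma test_on_integrable:
  assumes "test_on a b \<phi>"
  shows "integrable lborel \<phi>"
proof -
  have "set_integrable lborel {a..b} \<phi>"
    by (intro borel_integrable_atLeastAtMost' test_on_continuous[OF assms])
  moreover have "(\<lambda>x. indicator {a..b} x *\<^sub>R \<phi> x) = \<phi>"
    using assms by (intro ext) (auto simp: test_on_def indicator_def)
  ultimately show ?thesis by (simp add: set_integrable_def)
qed

text \<open>
  A test function is the derivative of a test function with the same support exactly if its
  integral vanishes; here the primitive taken from the left of the support is zero to its right.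
\<close>

lemma test_on_antiderivative:
  assumes g: "test_on a b g" and int0: "(LINT x|lborel. g x) = 0" and ab: "a < b"
  shows "\<exists>\<phi>. test_on a b \<phi> \<and> deriv \<phi> = g"
proof -
  define \<phi> where "\<phi> x = integral {a - 1..x} g" for x
  have left: "\<phi> x = 0" if "x < a" for x
  proof -
    have "integral {a - 1..x} g = integral {a - 1..x} (\<lambda>_. 0)"
      using g that by (intro integral_cong) (auto simp: test_on_def)
    then show ?thesis by (simp add: \<phi>_def)
  qed
  have right: "\<phi> x = 0" if "x > b" for x
  proof -
    have "set_integrable lborel {a - 1..x} g"
      by (intro borel_integrable_atLeastAtMost' test_on_continuous[OF g])
    then have "\<phi> x = (LINT t:{a - 1..x}|lborel. g t)"
      by (simp add: set_borel_integral_eq_integral \<phi>_def)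
    also have "\<dots> = (LINT t|lborel. g t)"
      unfolding set_lebesgue_integral_def
    proof (rule Bochner_Integration.integral_cong)
      fix t
      have "t \<in> {a..b} \<Longrightarrow> t \<in> {a - 1..x}" using that by auto
      then show "indicator {a - 1..x} t *\<^sub>R g t = g t"
        using g by (cases "t \<in> {a..b}") (auto simp: test_on_def simp del: atLeastAtMost_iff)
    qed simp
    finally show ?thesis using int0 by simp
  qed
  have D: "(\<phi> has_real_derivative g x) (at x)" for x
  proof (cases "x < a")
    case True
    have "(\<phi> has_real_derivative 0) (at x)"
      by (rule has_real_derivative_transform_open[where S = "{..<a}" and f = "\<lambda>x. 0"])
         (use True left in auto)
    then show ?thesis using True g by (auto simp: test_on_def)
  next
    case False
    have "(\<phi> has_real_derivative g x) (at x within {a - 1..x + 1})"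
      unfolding \<phi>_def
      by (rule integral_has_real_derivative) (use False test_on_continuous[OF g] in auto)
    then show ?thesis using False by (simp add: at_within_Icc_at)
  qed
  have d: "deriv \<phi> = g" using D DERIV_imp_deriv by blast
  have "smooth_on UNIV \<phi>"
    unfolding smooth_on_def
  proof (intro allI ballI)
    fix n x
    show "(deriv ^^ n) \<phi> differentiable at x"
    proof (cases n)
      case 0
      then show ?thesis using D by (auto simp: real_differentiable_def)
    next
      case (Suc m)
      then have "(deriv ^^ n) \<phi> = (deriv ^^ m) g" using d by (simp add: funpow_swap1)
      then show ?thesis using g by (auto simp: test_on_def smooth_on_def)
    qed
  qed
  then show ?thesis using left right d by (intro exI[of _ \<phi>]) (auto simp: test_on_def not_le)
qed

text \<open>
  As \<open>n\<close> grows these test functions increase to the indicator function of \<open>(c,d)\<close>. For \<open>d \<le> c\<close> both vanish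
  identically, so no case distinction is needed when an interval degenerates.
\<close>

definition bump :: "real \<Rightarrow> real \<Rightarrow> real \<Rightarrow> real \<Rightarrow> real" where
  "bump c d n x = flat_exp 0 (n * (x - c)) * flat_exp 0 (n * (d - x))"

lemma bump_test_on:
  assumes "n > 0" "a \<le> c" "d \<le> b"
  shows "test_on a b (bump c d n)"
proof -
  have "smooth_on UNIV (\<lambda>x. flat_exp 0 (n * x + (- n * c)))" "smooth_on UNIV (\<lambda>x. flat_exp 0 ((- n) * x + n * d))"
    by (intro smooth_on_affine smooth_on_flat_exp)+
  then have "smooth_on UNIV (\<lambda>x. flat_exp 0 (n * x + (- n * c)) * flat_exp 0 ((- n) * x + n * d))"
    by (rule smooth_on_mult[OF open_UNIV])
  moreover have "(\<lambda>x. flat_exp 0 (n * x + (- n * c)) * flat_exp 0 ((- n) * x + n * d)) = bump c d n"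
    by (auto simp: bump_def algebra_simps)
  ultimately show ?thesis
    using assms by (auto simp: test_on_def bump_def flat_exp_def zero_less_mult_iff)
qed

lemma bump_bounds: "0 \<le> bump c d n x" "bump c d n x \<le> 1"
proof -
  have "0 \<le> flat_exp 0 y" "flat_exp 0 y \<le> 1" for y by (auto simp: flat_exp_def)
  then show "0 \<le> bump c d n x" "bump c d n x \<le> 1"
    by (auto simp: bump_def intro: mult_le_one)
qed

lemma bump_tendsto: "(\<lambda>n. bump c d (real (Suc n)) x) \<longlonglongrightarrow> indicator {c<..<d} x"
proof (cases "x \<in> {c<..<d}")
  case True
  have 1: "(\<lambda>n. flat_exp 0 (real (Suc n) * y)) \<longlonglongrightarrow> 1" if "y > 0" for y
  proof -
    have "(\<lambda>n. exp (- ((1 / y) * inverse (real (Suc n))))) \<longlonglongrightarrow> exp (- ((1 / y) * 0))"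
      by (intro tendsto_intros LIMSEQ_inverse_real_of_nat)
    moreover have "exp (- ((1 / y) * inverse (real (Suc n)))) = flat_exp 0 (real (Suc n) * y)" for n
      using that by (simp add: flat_exp_def divide_simps del: of_nat_Suc)
    ultimately show ?thesis by simp
  qed
  have "(\<lambda>n. bump c d (real (Suc n)) x) \<longlonglongrightarrow> 1 * 1"
    unfolding bump_def using True by (intro tendsto_mult 1) auto
  then show ?thesis using True by simp
next
  case False
  then have "bump c d (real (Suc n)) x = 0" for n
    by (auto simp: bump_def flat_exp_def zero_less_mult_iff not_less)
  then show ?thesis using False by simp
qed

text \<open>
  The positive and the negative part of \<open>f\<close> are densities of finite measures that agree on the
  half-lines, a generator of the Borel sets closed under intersections, so the measures agree.
\<close>

lemma AE_eq_0_if_tail_integrals_0: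
  fixes f :: "real \<Rightarrow> real"
  assumes f: "integrable lborel f" and 0: "\<And>x. (LINT t|lborel. f t * indicator {x<..} t) = 0"
  shows "AE x in lborel. f x = 0"
proof -
  have fm[measurable]: "f \<in> borel_measurable borel" using f by auto
  have fin: "(\<integral>\<^sup>+t. ennreal (f t) * indicator {x<..} t \<partial>lborel) < \<infinity>"
    if f: "integrable lborel f" for x and f :: "real \<Rightarrow> real"
  proof -
    have "(\<integral>\<^sup>+t. ennreal (f t) * indicator {x<..} t \<partial>lborel) \<le> (\<integral>\<^sup>+t. ennreal (norm (f t)) \<partial>lborel)"
      by (intro nn_integral_mono) (auto simp: indicator_def intro: ennreal_leI)
    also have "\<dots> < \<infinity>" using f by (auto simp: integrable_iff_bounded)
    finally show ?thesis .
  qed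
  have "density lborel (\<lambda>t. ennreal (f t)) = density lborel (\<lambda>t. ennreal (- f t))"
  proof (rule measure_eqI_lessThan)
    fix x :: real
    show "emeasure (density lborel (\<lambda>t. ennreal (f t))) {x<..} < \<infinity>"
      using fin[OF f] by (simp add: emeasure_density)
    have int: "integrable lborel (\<lambda>t. f t * indicator {x<..} t)"
      using integrable_mult_indicator[OF _ f, of "{x<..}"] by (simp add: mult.commute)
    have e: "ennreal (f t * indicator {x<..} t) = ennreal (f t) * indicator {x<..} t"
       "ennreal (- (f t * indicator {x<..} t)) = ennreal (- f t) * indicator {x<..} t" for t
      by (auto simp: indicator_def)
    have "enn2real (\<integral>\<^sup>+t. ennreal (f t) * indicator {x<..} t \<partial>lborel)
        = enn2real (\<integral>\<^sup>+t. ennreal (- f t) * indicator {x<..} t \<partial>lborel)"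
      using real_lebesgue_integral_def[OF int] 0[of x] by (simp add: e)
    then have "(\<integral>\<^sup>+t. ennreal (f t) * indicator {x<..} t \<partial>lborel)
        = (\<integral>\<^sup>+t. ennreal (- f t) * indicator {x<..} t \<partial>lborel)"
      using fin[OF f, of x] fin[OF integrable_minus[OF f], of x]
      by (metis ennreal_enn2real infinity_ennreal_def)
    then show "emeasure (density lborel (\<lambda>t. ennreal (f t))) {x<..}
        = emeasure (density lborel (\<lambda>t. ennreal (- f t))) {x<..}"
      by (simp add: emeasure_density)
  qed auto
  then have "AE x in lborel. ennreal (f x) = ennreal (- f x)"
    by (intro sigma_finite_measure.density_unique[OF sigma_finite_lborel]) auto
  then show ?thesis
  proof eventually_elim
    case (elim x)
    then show ?case by (cases "f x \<ge> 0") (auto simp: ennreal_neg ennreal_eq_0_iff not_le)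
  qed
qed

text \<open>
  Approximating indicator functions of intervals boundedly by bumps reduces the claim to the
  previous lemma.
\<close>

lemma AE_eq_0_if_test_integrals_0:
  fixes f :: "real \<Rightarrow> real"
  assumes f: "integrable lborel f" and supp: "\<And>x. x \<notin> {a..b} \<Longrightarrow> f x = 0"
    and 0: "\<And>\<phi>. test_on a b \<phi> \<Longrightarrow> (LINT x|lborel. f x * \<phi> x) = 0"
  shows "AE x in lborel. f x = 0"
proof (rule AE_eq_0_if_tail_integrals_0[OF f])
  fix x :: real
  define p where "p n = bump (max a x) b (real (Suc n))" for n
  have t: "test_on a b (p n)" for n unfolding p_def by (intro bump_test_on) auto
  have [measurable]: "f \<in> borel_measurable borel" "p n \<in> borel_measurable borel" for n
    using f t[THEN test_on_measurable] by auto
  have "(\<lambda>n. LINT t|lborel. f t * p n t) \<longlonglongrightarrow> (LINT t|lborel. f t * indicator {max a x<..<b} t)"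
  proof (rule integral_dominated_convergence[where w = "\<lambda>t. \<bar>f t\<bar>"])
    show "AE t in lborel. (\<lambda>n. f t * p n t) \<longlonglongrightarrow> f t * indicator {max a x<..<b} t"
      unfolding p_def by (intro AE_I2 tendsto_mult_left bump_tendsto)
    show "AE t in lborel. norm (f t * p n t) \<le> \<bar>f t\<bar>" for n
      unfolding p_def using bump_bounds[of "max a x" b "real (Suc n)"]
      by (intro AE_I2) (auto simp: abs_mult intro!: mult_left_le)
  qed (use f in auto)
  then have "(LINT t|lborel. f t * indicator {max a x<..<b} t) = 0"
    using 0[OF t] LIMSEQ_unique[OF _ tendsto_const] by simp
  moreover have "(LINT t|lborel. f t * indicator {max a x<..<b} t) = (LINT t|lborel. f t * indicator {x<..} t)"
  proof (rule integral_cong_AE)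
    show "AE t in lborel. f t * indicator {max a x<..<b} t = f t * indicator {x<..} t"
      using AE_lborel_singleton[of a] AE_lborel_singleton[of b]
    proof eventually_elim
      case (elim t)
      then show ?case using supp[of t] by (cases "t \<in> {a..b}") (auto simp: indicator_def less_le)
    qed
  qed auto
  ultimately show "(LINT t|lborel. f t * indicator {x<..} t) = 0" by simp
qed

section \<open>Primitives of integrable functions and the lemma of du Bois-Reymond\<close>

text \<open>
  Functions on an interval are continued by zero, so integration may start at \<open>- \<infinity>\<close>; additive
  constants in primitives are irrelevant in what follows.
\<close>

definition primitive :: "(real \<Rightarrow> real) \<Rightarrow> real \<Rightarrow> real" where
  "primitive v x = (LINT t|lborel. v t * indicator {..<x} t)"

lemma integrable_mult_ind:
  fixes v :: "real \<Rightarrow> real"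
  shows "integrable lborel v \<Longrightarrow> A \<in> sets borel \<Longrightarrow> integrable lborel (\<lambda>t. v t * indicator A t)"
  using integrable_mult_indicator[of A lborel v] by (simp add: mult.commute)

lemma primitive_measurable [measurable]:
  assumes "integrable lborel v"
  shows "primitive v \<in> borel_measurable borel"
proof -
  have [measurable]: "v \<in> borel_measurable borel" using assms by auto
  have "(\<lambda>x. LINT t|lborel. v t * (if t < x then 1 else 0)) \<in> borel_measurable borel"
    by measurable
  moreover have "(\<lambda>x. LINT t|lborel. v t * (if t < x then 1 else 0)) = primitive v"
    unfolding primitive_def fun_eq_iff
    by (intro allI Bochner_Integration.integral_cong) (auto simp: indicator_def)
  ultimately show ?thesis by simp
qed

lemma primitive_bound:
  assumes "integrable lborel v"
  shows "\<bar>primitive v x\<bar> \<le> (LINT t|lborel. \<bar>v t\<bar>)"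
proof -
  have "\<bar>primitive v x\<bar> \<le> (LINT t|lborel. \<bar>v t * indicator {..<x} t\<bar>)"
    unfolding primitive_def by (rule integral_abs_bound)
  also have "\<dots> \<le> (LINT t|lborel. \<bar>v t\<bar>)"
    by (intro integral_mono integrable_abs integrable_mult_ind assms) (auto simp: indicator_def)
  finally show ?thesis .
qed

lemma primitive_diff:
  assumes v: "integrable lborel v" and "x \<le> y"
  shows "ennreal \<bar>primitive v y - primitive v x\<bar> \<le> (\<integral>\<^sup>+t\<in>{x..y}. ennreal \<bar>v t\<bar> \<partial>lborel)"
proof -
  have "primitive v y - primitive v x = (LINT t|lborel. v t * indicator {..<y} t - v t * indicator {..<x} t)"
    unfolding primitive_def
    by (rule Bochner_Integration.integral_diff[symmetric]) (intro integrable_mult_ind v; simp)+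
  also have "\<dots> = (LINT t|lborel. v t * indicator {x..<y} t)"
    using \<open>x \<le> y\<close> by (intro Bochner_Integration.integral_cong) (auto simp: indicator_def)
  finally have "ennreal \<bar>primitive v y - primitive v x\<bar> = ennreal (norm (LINT t|lborel. v t * indicator {x..<y} t))"
    by simp
  also have "\<dots> \<le> (\<integral>\<^sup>+t. ennreal (norm (v t * indicator {x..<y} t)) \<partial>lborel)"
    by (intro integral_norm_bound_ennreal integrable_mult_ind v) simp
  also have "\<dots> \<le> (\<integral>\<^sup>+t\<in>{x..y}. ennreal \<bar>v t\<bar> \<partial>lborel)"
    by (intro nn_integral_mono) (auto simp: indicator_def)
  finally show ?thesis .
qed

lemma test_on_tail_integral:
  assumes "test_on a b \<phi>"
  shows "(LINT x|lborel. indicator {t<..} x * deriv \<phi> x) = - \<phi> t"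
proof -
  define d where "d = max t b + 1"
  have td: "t \<le> d" "b < d" by (auto simp: d_def)
  have "(LINT x|lborel. indicator {t<..} x * deriv \<phi> x) = (LINT x|lborel. indicator {t..d} x *\<^sub>R deriv \<phi> x)"
  proof (rule integral_cong_AE)
    have [measurable]: "deriv \<phi> \<in> borel_measurable borel"
      using test_on_measurable[OF test_on_deriv[OF assms]] .
    show "(\<lambda>x. indicator {t<..} x * deriv \<phi> x) \<in> borel_measurable lborel"
        "(\<lambda>x. indicator {t..d} x *\<^sub>R deriv \<phi> x) \<in> borel_measurable lborel" by measurable
    show "AE x in lborel. indicator {t<..} x * deriv \<phi> x = indicator {t..d} x *\<^sub>R deriv \<phi> x"
      using AE_lborel_singleton[of t]
    proof eventually_elim
      case (elim x)
      have "deriv \<phi> x = 0" if "x > d"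
        using test_on_deriv[OF assms] td that by (simp add: test_on_def)
      with elim show ?case by (auto simp: indicator_def)
    qed
  qed
  also have "\<dots> = \<phi> d - \<phi> t"
  proof (rule integral_FTC_atLeastAtMost)
    show "continuous_on {t..d} (deriv \<phi>)" by (rule test_on_continuous[OF test_on_deriv[OF assms]])
    show "(\<phi> has_vector_derivative deriv \<phi> x) (at x within {t..d})" for x
      using test_on_DERIV[OF assms, of x]
      by (simp add: has_real_derivative_iff_has_vector_derivative has_vector_derivative_at_within)
  qed (use td in auto)
  also have "\<phi> d = 0" using assms td by (auto simp: test_on_def)
  finally show ?thesis by simp
qed

text \<open>
  Write \<open>\<phi> t\<close> as minus the integral of \<open>deriv \<phi>\<close> over \<open>{t<..}\<close> and exchange the order of integration. In
  this way integration by parts needs no differentiability of the primitive.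
\<close>

lemma primitive_by_parts:
  assumes v: "integrable lborel v" and \<phi>: "test_on a b \<phi>"
  shows "(LINT t|lborel. v t * \<phi> t) = - (LINT x|lborel. primitive v x * deriv \<phi> x)"
proof -
  let ?H = "\<lambda>t x. v t * ((if t < x then 1 else 0) * deriv \<phi> x)"
  have i': "integrable lborel (deriv \<phi>)" by (rule test_on_integrable[OF test_on_deriv[OF \<phi>]])
  have [measurable]: "v \<in> borel_measurable borel" "deriv \<phi> \<in> borel_measurable borel" using v i' by auto
  have ix: "integrable lborel (\<lambda>x. ?H t x)" for t
    using integrable_mult_ind[OF i', of "{t<..}"]
    by (intro integrable_mult_right) (auto simp: indicator_def mult.commute of_bool_def)
  have "integrable (lborel \<Otimes>\<^sub>M lborel) (case_prod ?H)"
  proof (rule lborel_pair.Fubini_integrable)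
    let ?C = "LINT x|lborel. \<bar>deriv \<phi> x\<bar>"
    show "integrable lborel (\<lambda>t. LINT x|lborel. norm (case_prod ?H (t, x)))"
    proof (rule Bochner_Integration.integrable_bound[where f = "\<lambda>t. ?C * v t"])
      show "AE t in lborel. norm (LINT x|lborel. norm (case_prod ?H (t, x))) \<le> norm (?C * v t)"
      proof (rule AE_I2)
        fix t
        have "(LINT x|lborel. norm (case_prod ?H (t, x))) \<le> (LINT x|lborel. \<bar>v t\<bar> * \<bar>deriv \<phi> x\<bar>)"
        proof (rule integral_mono)
          show "integrable lborel (\<lambda>x. norm (case_prod ?H (t, x)))"
            using integrable_norm[OF ix[of t]] by simp
          show "integrable lborel (\<lambda>x. \<bar>v t\<bar> * \<bar>deriv \<phi> x\<bar>)"
            using integrable_abs[OF i'] by simp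
        qed (auto simp: abs_mult)
        then show "norm (LINT x|lborel. norm (case_prod ?H (t, x))) \<le> norm (?C * v t)"
          by (simp add: abs_mult mult.commute)
      qed
    qed (use v in auto)
    show "AE t in lborel. integrable lborel (\<lambda>x. case_prod ?H (t, x))" using ix by auto
  qed measurable
  from lborel_pair.Fubini_integral[OF this]
  have "(LINT x|lborel. LINT t|lborel. ?H t x) = (LINT t|lborel. LINT x|lborel. ?H t x)" .
  moreover have "(LINT x|lborel. ?H t x) = - (v t * \<phi> t)" for t
  proof -
    have "(LINT x|lborel. ?H t x) = v t * (LINT x|lborel. indicator {t<..} x * deriv \<phi> x)"
      by (simp add: indicator_def of_bool_def)
    then show ?thesis using test_on_tail_integral[OF \<phi>] by simp
  qed
  moreover have "(LINT t|lborel. ?H t x) = primitive v x * deriv \<phi> x" for x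
  proof -
    have "(LINT t|lborel. ?H t x) = (LINT t|lborel. (v t * indicator {..<x} t) * deriv \<phi> x)"
      by (intro Bochner_Integration.integral_cong) (auto simp: indicator_def)
    also have "\<dots> = primitive v x * deriv \<phi> x"
      unfolding primitive_def by (rule integral_mult_left_zero)
    finally show ?thesis .
  qed
  ultimately show ?thesis by simp
qed

lemma unit_test_function:
  assumes "a < b"
  obtains \<rho> where "test_on a b \<rho>" "(LINT x|lborel. \<rho> x) = 1"
proof -
  let ?\<rho> = "bump a b 1"
  have t: "test_on a b ?\<rho>" by (rule bump_test_on) auto
  have "(LINT x|lborel. ?\<rho> x) \<noteq> 0"
  proof
    assume 0: "(LINT x|lborel. ?\<rho> x) = 0"
    have "AE x in lborel. ?\<rho> x = 0"
      using 0 integral_nonneg_eq_0_iff_AE[OF test_on_integrable[OF t]] bump_bounds by auto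
    then have "{a<..<b} \<in> null_sets lborel"
      using assms by (subst AE_iff_null_sets) (auto elim!: eventually_mono simp: bump_def flat_exp_def)
    then show False using assms by (auto simp: null_sets_def)
  qed
  then show thesis
    by (intro that[OF test_on_cmult[OF t, of "1 / (LINT x|lborel. ?\<rho> x)"]]) simp
qed

text \<open>
  The difference \<open>w\<close> of \<open>u\<close> and the primitive of \<open>v\<close> is annihilated by all derivatives of test functions.
  Every test function \<open>\<psi>\<close> differs from such a derivative by a multiple of a fixed test function of
  integral \<open>1\<close>, so \<open>w\<close> acts on test functions like a constant.
\<close>

lemma eq_const_plus_primitive:
  assumes ab: "a < b" and u: "integrable lborel u" and v: "integrable lborel v"
    and supp: "\<And>x. x \<notin> {a..b} \<Longrightarrow> u x = 0"
    and weak: "\<And>\<phi>. test_on a b \<phi> \<Longrightarrow> (LINT x|lborel. u x * deriv \<phi> x) = - (LINT x|lborel. v x * \<phi> x)"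
  shows "\<exists>c. AE x in lborel. x \<in> {a..b} \<longrightarrow> u x = c + primitive v x"
proof -
  define w where "w x = u x - primitive v x * indicator {a..b} x" for x
  have ind: "integrable lborel (\<lambda>x. c * indicator {a..b} x)" for c :: real
    by (intro integrable_mult_right integrable_real_indicator) (auto simp: emeasure_lborel_Icc_eq)
  have "integrable lborel (\<lambda>x. primitive v x * indicator {a..b} x)"
    by (rule Bochner_Integration.integrable_bound[OF ind[of "LINT t|lborel. \<bar>v t\<bar>"]])
       (use primitive_measurable[OF v] in \<open>auto simp: indicator_def intro: order_trans[OF primitive_bound[OF v]]\<close>)
  then have w: "integrable lborel w" unfolding w_def using u by (intro Bochner_Integration.integrable_diff)
  have w_deriv: "(LINT x|lborel. w x * deriv \<phi> x) = 0" if \<phi>: "test_on a b \<phi>" for \<phi>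
  proof -
    have i: "integrable lborel (\<lambda>x. primitive v x * indicator {a..b} x * deriv \<phi> x)"
      by (intro test_on_integrable_mult[OF test_on_deriv[OF \<phi>]]) fact
    have "w x * deriv \<phi> x = u x * deriv \<phi> x - primitive v x * indicator {a..b} x * deriv \<phi> x" for x
      by (simp add: w_def algebra_simps)
    then have "(LINT x|lborel. w x * deriv \<phi> x) = (LINT x|lborel. u x * deriv \<phi> x)
        - (LINT x|lborel. primitive v x * indicator {a..b} x * deriv \<phi> x)"
      using Bochner_Integration.integral_diff[OF test_on_integrable_mult[OF test_on_deriv[OF \<phi>] u] i] by simp
    also have "(LINT x|lborel. primitive v x * indicator {a..b} x * deriv \<phi> x)
        = (LINT x|lborel. primitive v x * deriv \<phi> x)"
      using test_on_deriv[OF \<phi>]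
      by (intro Bochner_Integration.integral_cong) (auto simp: test_on_def indicator_def)
    finally show ?thesis using weak[OF \<phi>] primitive_by_parts[OF v \<phi>] by simp
  qed
  obtain \<rho> where \<rho>: "test_on a b \<rho>" "(LINT x|lborel. \<rho> x) = 1" using unit_test_function[OF ab] .
  define c where "c = (LINT x|lborel. w x * \<rho> x)"
  have "AE x in lborel. w x - c * indicator {a..b} x = 0"
  proof (rule AE_eq_0_if_test_integrals_0)
    show "integrable lborel (\<lambda>x. w x - c * indicator {a..b} x)" using w ind by auto
    show "w x - c * indicator {a..b} x = 0" if "x \<notin> {a..b}" for x using supp that by (simp add: w_def)
    fix \<psi> assume \<psi>: "test_on a b \<psi>"
    define I where "I = (LINT x|lborel. \<psi> x)"
    define g where "g x = \<psi> x + (- I) * \<rho> x" for x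
    have g: "test_on a b g" unfolding g_def by (intro test_on_add test_on_cmult \<psi> \<rho>)
    have "(LINT x|lborel. g x) = 0"
      unfolding g_def
      by (subst Bochner_Integration.integral_add)
         (auto intro!: integrable_mult_right test_on_integrable[OF \<psi>] test_on_integrable[OF \<rho>(1)] simp: \<rho>(2) I_def)
    then obtain \<phi> where \<phi>: "test_on a b \<phi>" "deriv \<phi> = g" using test_on_antiderivative[OF g _ ab] by blast
    note iw = test_on_integrable_mult[OF \<psi> w] test_on_integrable_mult[OF \<rho>(1) w]
    have "0 = (LINT x|lborel. w x * g x)" using w_deriv[OF \<phi>(1)] \<phi>(2) by simp
    also have "\<dots> = (LINT x|lborel. w x * \<psi> x - I * (w x * \<rho> x))"
      by (intro Bochner_Integration.integral_cong) (auto simp: g_def algebra_simps)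
    also have "\<dots> = (LINT x|lborel. w x * \<psi> x) - I * c"
      using iw by (simp add: c_def)
    finally have *: "(LINT x|lborel. w x * \<psi> x) = I * c" by simp
    have "(LINT x|lborel. (w x - c * indicator {a..b} x) * \<psi> x) = (LINT x|lborel. w x * \<psi> x - c * \<psi> x)"
      using \<psi> by (intro Bochner_Integration.integral_cong) (auto simp: test_on_def indicator_def algebra_simps)
    also have "\<dots> = 0" using iw test_on_integrable[OF \<psi>] * by (simp add: I_def)
    finally show "(LINT x|lborel. (w x - c * indicator {a..b} x) * \<psi> x) = 0" .
  qed
  then have "AE x in lborel. x \<in> {a..b} \<longrightarrow> u x = c + primitive v x"
    by eventually_elim (auto simp: w_def)
  then show ?thesis by blast
qed

lemma lebesgue_borel_representative:
  fixes f :: "real \<Rightarrow> real"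
  assumes "set_borel_measurable lebesgue A f" "A \<in> sets borel"
  obtains f0 where "f0 \<in> borel_measurable borel" "\<And>x. x \<notin> A \<Longrightarrow> f0 x = 0"
    "AE x in lborel. x \<in> A \<longrightarrow> f x = f0 x"
proof -
  obtain g where g: "g \<in> borel_measurable lborel" "AE x in lborel. indicator A x *\<^sub>R f x = g x"
    using completion_ex_borel_measurable_real assms(1) unfolding set_borel_measurable_def by blast
  show thesis
  proof (rule that[of "\<lambda>x. indicator A x * g x"])
    show "(\<lambda>x. indicator A x * g x) \<in> borel_measurable borel" using g(1) assms(2) by simp
    show "AE x in lborel. x \<in> A \<longrightarrow> f x = indicator A x * g x"
      using g(2) by eventually_elim auto
  qed auto
qed

lemma borel_measurable_lebesgue_AE:
  fixes f f0 :: "real \<Rightarrow> real"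
  assumes f0: "f0 \<in> borel_measurable borel" and eq: "AE x in lborel. f x = f0 x"
  shows "f \<in> borel_measurable lebesgue"
proof (rule borel_measurable_AE)
  show "f0 \<in> borel_measurable lebesgue" using f0 by (intro measurable_completion) simp
  show "AE x in lebesgue. f0 x = f x" using eq by (intro AE_completion) (auto elim: eventually_mono)
qed

text \<open>
  Fubini's theorem and the uniqueness of densities are applied to Borel functions and \<open>lborel\<close>, while
  weak derivatives are defined with Lebesgue measurable functions; this lemma passes between them.
\<close>

lemma lebesgue_borel_integral:
  fixes f f0 :: "real \<Rightarrow> real"
  assumes f0: "f0 \<in> borel_measurable borel" and eq: "AE x in lborel. f x = f0 x"
  shows "integrable lebesgue f \<longleftrightarrow> integrable lborel f0" "(LINT x|lebesgue. f x) = (LINT x|lborel. f0 x)"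
proof -
  note fm = borel_measurable_lebesgue_AE[OF f0 eq]
  have f0m: "f0 \<in> borel_measurable lebesgue" using f0 by (intro measurable_completion) simp
  have "integrable lebesgue f \<longleftrightarrow> integrable lebesgue f0"
    using eq by (intro integrable_cong_AE fm f0m AE_completion)
  then show "integrable lebesgue f \<longleftrightarrow> integrable lborel f0"
    using integrable_completion[of f0 lborel] f0 by simp
  have "(LINT x|lebesgue. f x) = (LINT x|lebesgue. f0 x)"
    using eq by (intro integral_cong_AE fm f0m AE_completion)
  then show "(LINT x|lebesgue. f x) = (LINT x|lborel. f0 x)"
    using integral_completion[of f0 lborel] f0 by simp
qed

section \<open>Calculus of weak derivatives on the half-line\<close>

lemma locally_integrable_iff:
  "locally_integrable u \<longleftrightarrow> (\<forall>a b. 0 < a \<longrightarrow> a < b \<longrightarrow> set_integrable lebesgue {a..b} u)"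
proof (intro iffI allI impI)
  fix a b :: real assume "locally_integrable u" "0 < a" "a < b"
  then show "set_integrable lebesgue {a..b} u"
    unfolding locally_integrable_def by (auto simp: subset_eq)
next
  assume *: "\<forall>a b. 0 < a \<longrightarrow> a < b \<longrightarrow> set_integrable lebesgue {a..b} u"
  show "locally_integrable u"
    unfolding locally_integrable_def
  proof (intro allI impI, elim conjE)
    fix K :: "real set" assume K: "compact K" "K \<subseteq> {0<..}"
    then obtain a b where "0 < a" "a < b" "K \<subseteq> {a..b}"
      using compact_positive_subset_interval by blast
    then show "set_integrable lebesgue K u"
      using * lmeasurable_compact[OF K(1)]
      by (intro set_integrable_subset[of lebesgue "{a..b}" u K]) (auto simp: fmeasurable_def)
  qed
qed

lemma locally_integrable_representative:
  assumes "locally_integrable u" "0 < a" "a < b"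
  shows "\<exists>u0. integrable lborel u0 \<and> (\<forall>x. x \<notin> {a..b} \<longrightarrow> u0 x = 0) \<and>
    (AE x in lborel. x \<in> {a..b} \<longrightarrow> u x = u0 x)"
proof -
  have i: "integrable lebesgue (\<lambda>x. indicator {a..b} x *\<^sub>R u x)"
    using assms by (auto simp: locally_integrable_iff set_integrable_def)
  then have "set_borel_measurable lebesgue {a..b} u" by (auto simp: set_borel_measurable_def)
  then obtain u0 where u0: "u0 \<in> borel_measurable borel" "\<And>x. x \<notin> {a..b} \<Longrightarrow> u0 x = 0"
    "AE x in lborel. x \<in> {a..b} \<longrightarrow> u x = u0 x"
    by (rule lebesgue_borel_representative) auto
  have "AE x in lborel. indicator {a..b} x *\<^sub>R u x = u0 x"
    using u0(3)
  proof eventually_elim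
    case (elim x)
    then show ?case using u0(2)[of x] by (cases "x \<in> {a..b}") auto
  qed
  with i have "integrable lborel u0" using lebesgue_borel_integral(1)[OF u0(1)] by simp
  then show ?thesis using u0(2,3) by (intro exI[of _ u0] conjI allI impI)
qed

lemma test_integral_representative:
  assumes u0: "integrable lborel u0" "AE x in lborel. x \<in> {a..b} \<longrightarrow> u x = u0 x"
    and \<phi>: "test_on a b \<phi>" and a: "0 < a"
  shows "set_integrable lebesgue {0<..} (\<lambda>r. u r * \<phi> r)"
    and "(LINT r:{0<..}|lebesgue. u r * \<phi> r) = (LINT r|lborel. u0 r * \<phi> r)"
proof -
  have m: "(\<lambda>r. u0 r * \<phi> r) \<in> borel_measurable borel"
    using u0(1) test_on_measurable[OF \<phi>] by (intro borel_measurable_times) auto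
  have "AE x in lborel. indicator {0<..} x *\<^sub>R (u x * \<phi> x) = u0 x * \<phi> x"
    using u0(2)
  proof eventually_elim
    case (elim x)
    then show ?case using \<phi> a by (cases "x \<in> {a..b}") (auto simp: test_on_def)
  qed
  note * = lebesgue_borel_integral[OF m this]
  show "set_integrable lebesgue {0<..} (\<lambda>r. u r * \<phi> r)"
    using *(1) test_on_integrable_mult[OF \<phi> u0(1)] by (simp add: set_integrable_def)
  show "(LINT r:{0<..}|lebesgue. u r * \<phi> r) = (LINT r|lborel. u0 r * \<phi> r)"
    using *(2) by (simp add: set_lebesgue_integral_def)
qed

lemma test_integrable:
  assumes "locally_integrable u" "test_function \<phi>"
  shows "set_integrable lebesgue {0<..} (\<lambda>r. u r * \<phi> r)"
proof -
  obtain a b where ab: "0 < a" "a < b" and \<phi>: "test_on a b \<phi>" using test_functionE[OF assms(2)] .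
  obtain u0 where u0: "integrable lborel u0" "\<And>x. x \<notin> {a..b} \<Longrightarrow> u0 x = 0"
    "AE x in lborel. x \<in> {a..b} \<longrightarrow> u x = u0 x"
    using locally_integrable_representative[OF assms(1) ab] by blast
  show ?thesis by (rule test_integral_representative(1)[OF u0(1,3) \<phi> ab(1)])
qed

lemma locally_integrable_cong:
  assumes u: "locally_integrable u" and eq: "AE r in lborel. 0 < r \<longrightarrow> u r = u' r"
  shows "locally_integrable u'"
  unfolding locally_integrable_iff
proof (intro allI impI)
  fix a b :: real assume ab: "0 < a" "a < b"
  obtain u0 where u0: "integrable lborel u0" "\<And>x. x \<notin> {a..b} \<Longrightarrow> u0 x = 0"
    "AE x in lborel. x \<in> {a..b} \<longrightarrow> u x = u0 x"
    using locally_integrable_representative[OF u ab] by blast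
  have "AE x in lborel. indicator {a..b} x *\<^sub>R u' x = u0 x"
    using u0(3) eq
  proof eventually_elim
    case (elim x)
    then show ?case using u0(2)[of x] ab by (cases "x \<in> {a..b}") auto
  qed
  then show "set_integrable lebesgue {a..b} u'"
    using lebesgue_borel_integral(1)[of u0] u0(1) unfolding set_integrable_def by auto
qed

lemma test_integral_cong:
  assumes u: "locally_integrable u" and eq: "AE r in lborel. 0 < r \<longrightarrow> u r = u' r" and \<phi>: "test_function \<phi>"
  shows "(LINT r:{0<..}|lebesgue. u r * \<phi> r) = (LINT r:{0<..}|lebesgue. u' r * \<phi> r)"
proof -
  obtain a b where ab: "0 < a" "a < b" and \<phi>: "test_on a b \<phi>" using test_functionE[OF \<phi>] .
  obtain u0 where u0: "integrable lborel u0" "\<And>x. x \<notin> {a..b} \<Longrightarrow> u0 x = 0"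
    "AE x in lborel. x \<in> {a..b} \<longrightarrow> u x = u0 x"
    using locally_integrable_representative[OF u ab] by blast
  have "AE x in lborel. x \<in> {a..b} \<longrightarrow> u' x = u0 x"
    using u0(3) eq by eventually_elim (use ab in auto)
  then show ?thesis using test_integral_representative(2)[OF u0(1) _ \<phi> ab(1)] u0(3) by simp
qed

lemma test_function_deriv: "test_function \<phi> \<Longrightarrow> test_function (deriv \<phi>)"
  by (erule test_functionE) (rule test_on_imp_test_function[OF _ test_on_deriv])

lemma has_weak_deriv_cong:
  assumes uv: "has_weak_deriv 1 u v"
    and "AE r in lborel. 0 < r \<longrightarrow> u r = u' r" "AE r in lborel. 0 < r \<longrightarrow> v r = v' r"
  shows "has_weak_deriv 1 u' v'"
proof -
  have li: "locally_integrable u" "locally_integrable v" using uv by (auto simp: has_weak_deriv_def)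
  then have "locally_integrable u'" "locally_integrable v'" using locally_integrable_cong[OF _ assms(2)] locally_integrable_cong[OF _ assms(3)] by auto
  then show ?thesis
    using uv test_integral_cong[OF li(1) assms(2)] test_integral_cong[OF li(2) assms(3)]
    by (simp add: has_weak_deriv_def test_function_deriv)
qed

lemma AE_positive_if_AE_intervals:
  fixes P :: "real \<Rightarrow> bool"
  assumes "\<And>a b. 0 < a \<Longrightarrow> a < b \<Longrightarrow> AE x in lborel. x \<in> {a..b} \<longrightarrow> P x"
  shows "AE x in lborel. 0 < x \<longrightarrow> P x"
proof -
  have "AE x in lborel. \<forall>n::nat. x \<in> {1 / real (n + 2)..real (n + 2)} \<longrightarrow> P x"
    unfolding AE_all_countable by (intro allI assms) (auto intro: less_trans[of _ 1])
  then show ?thesis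
  proof eventually_elim
    case (elim x)
    show ?case
    proof
      assume x: "0 < x"
      obtain n :: nat where n: "max x (1 / x) < real n" using reals_Archimedean2 by blast
      have "x \<in> {1 / real (n + 2)..real (n + 2)}" using n x by (auto simp: field_simps)
      then show "P x" using elim by blast
    qed
  qed
qed

lemma has_weak_deriv_unique:
  assumes v: "has_weak_deriv 1 u v" and w: "has_weak_deriv 1 u w"
  shows "AE r in lborel. 0 < r \<longrightarrow> v r = w r"
proof (rule AE_positive_if_AE_intervals)
  fix a b :: real assume ab: "0 < a" "a < b"
  have li: "locally_integrable v" "locally_integrable w" using v w by (auto simp: has_weak_deriv_def)
  obtain v0 where v0: "integrable lborel v0" "\<And>x. x \<notin> {a..b} \<Longrightarrow> v0 x = 0"
    "AE x in lborel. x \<in> {a..b} \<longrightarrow> v x = v0 x"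
    using locally_integrable_representative[OF li(1) ab] by blast
  obtain w0 where w0: "integrable lborel w0" "\<And>x. x \<notin> {a..b} \<Longrightarrow> w0 x = 0"
    "AE x in lborel. x \<in> {a..b} \<longrightarrow> w x = w0 x"
    using locally_integrable_representative[OF li(2) ab] by blast
  have "AE x in lborel. v0 x - w0 x = 0"
  proof (rule AE_eq_0_if_test_integrals_0)
    fix \<phi> assume \<phi>: "test_on a b \<phi>"
    have t: "test_function \<phi>" using test_on_imp_test_function[OF ab(1) \<phi>] .
    have "(LINT r:{0<..}|lebesgue. v r * \<phi> r) = (LINT r:{0<..}|lebesgue. w r * \<phi> r)"
      using v w t by (simp add: has_weak_deriv_def)
    then have "(LINT x|lborel. v0 x * \<phi> x) = (LINT x|lborel. w0 x * \<phi> x)"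
      using test_integral_representative(2)[OF v0(1,3) \<phi> ab(1)]
        test_integral_representative(2)[OF w0(1,3) \<phi> ab(1)] by simp
    then show "(LINT x|lborel. (v0 x - w0 x) * \<phi> x) = 0"
      using test_on_integrable_mult[OF \<phi> v0(1)] test_on_integrable_mult[OF \<phi> w0(1)]
      by (simp add: left_diff_distrib)
  qed (use v0 w0 in auto)
  then show "AE x in lborel. x \<in> {a..b} \<longrightarrow> v x = w x"
    using v0(3) w0(3) by eventually_elim auto
qed

lemma weak_deriv_AE:
  assumes "has_weak_deriv 1 u v"
  shows "AE r in lborel. 0 < r \<longrightarrow> weak_deriv u r = v r"
  unfolding weak_deriv_def
  by (rule has_weak_deriv_unique[OF someI[where P = "has_weak_deriv 1 u", OF assms] assms])

text \<open>
  The weak derivatives of all orders of \<open>u\<close> are defined independently of each other. They form a chain of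
  first order derivatives because the derivative of a test function is a test function.
\<close>

lemma has_weak_deriv_next:
  assumes "has_weak_deriv j u v" "has_weak_deriv (Suc j) u w"
  shows "has_weak_deriv 1 v w"
  unfolding has_weak_deriv_def
proof (intro conjI allI impI)
  show "locally_integrable v" "locally_integrable w" using assms by (auto simp: has_weak_deriv_def)
  fix \<phi> assume \<phi>: "test_function \<phi>"
  have "(-1) ^ j * (LINT r:{0<..}|lebesgue. v r * deriv \<phi> r) = (-1) ^ Suc j * (LINT r:{0<..}|lebesgue. w r * \<phi> r)"
  proof -
    have "(LINT r:{0<..}|lebesgue. u r * (deriv ^^ j) (deriv \<phi>) r)
        = (-1) ^ j * (LINT r:{0<..}|lebesgue. v r * deriv \<phi> r)"
      using assms(1) test_function_deriv[OF \<phi>] unfolding has_weak_deriv_def by blast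
    moreover have "(LINT r:{0<..}|lebesgue. u r * (deriv ^^ Suc j) \<phi> r)
        = (-1) ^ Suc j * (LINT r:{0<..}|lebesgue. w r * \<phi> r)"
      using assms(2) \<phi> unfolding has_weak_deriv_def by blast
    ultimately show ?thesis by (simp add: funpow_swap1)
  qed
  then have "(-1) ^ j * ((-1) ^ j * (LINT r:{0<..}|lebesgue. v r * deriv \<phi> r))
    = (-1) ^ j * ((-1) ^ j * ((-1) * (LINT r:{0<..}|lebesgue. w r * \<phi> r)))" by simp
  then show "(LINT r:{0<..}|lebesgue. v r * (deriv ^^ 1) \<phi> r) = (-1) ^ 1 * (LINT r:{0<..}|lebesgue. w r * \<phi> r)"
    by (simp add: mult.assoc[symmetric] power_mult_distrib[symmetric])
qed

lemma locally_integrable_mult: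
  assumes u: "locally_integrable u" and w: "continuous_on {0<..} w"
  shows "locally_integrable (\<lambda>r. w r * u r)"
  unfolding locally_integrable_iff
proof (intro allI impI)
  fix a b :: real assume ab: "0 < a" "a < b"
  have c: "continuous_on {a..b} w" using ab by (intro continuous_on_subset[OF w]) auto
  show "set_integrable lebesgue {a..b} (\<lambda>r. w r * u r)"
  proof (rule absolutely_integrable_bounded_measurable_product_real)
    show "w \<in> borel_measurable (lebesgue_on {a..b})"
      by (intro continuous_imp_measurable_on_sets_lebesgue c) auto
    show "bounded (w ` {a..b})" by (intro compact_imp_bounded compact_continuous_image c) auto
    show "set_integrable lebesgue {a..b} u" using u ab by (auto simp: locally_integrable_iff)
  qed auto
qed

lemma smooth_on_continuous: "smooth_on S f \<Longrightarrow> continuous_on S f"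
  by (meson DERIV_continuous_on has_field_derivative_at_within smooth_on_DERIV)

lemma locally_integrable_add:
  "locally_integrable u \<Longrightarrow> locally_integrable v \<Longrightarrow> locally_integrable (\<lambda>r. u r + v r)"
  by (auto simp: locally_integrable_def)

lemma test_function_mult:
  assumes \<phi>: "test_function \<phi>" and w: "smooth_on {0<..} w"
  shows "test_function (\<lambda>x. w x * \<phi> x)"
proof -
  obtain a b where ab: "0 < a" "a < b" and \<phi>: "test_on a b \<phi>" using test_functionE[OF \<phi>] .
  have "smooth_on {0<..} \<phi>" using \<phi> by (auto simp: test_on_def smooth_on_def)
  then have "smooth_on {0<..} (\<lambda>x. w x * \<phi> x)" by (intro smooth_on_mult w) auto
  moreover have "smooth_on (- {a..b}) (\<lambda>x. w x * \<phi> x)"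
    by (rule smooth_on_cong[OF _ smooth_on_zero]) (use \<phi> in \<open>auto simp: test_on_def\<close>)
  ultimately have "smooth_on ({0<..} \<union> - {a..b}) (\<lambda>x. w x * \<phi> x)" by (rule smooth_on_Un)
  moreover have "{0<..} \<union> - {a..b} = UNIV" using ab by auto
  ultimately have "test_on a b (\<lambda>x. w x * \<phi> x)" using \<phi> by (auto simp: test_on_def)
  then show ?thesis by (rule test_on_imp_test_function[OF ab(1)])
qed

text \<open>
  Leibniz' rule for test functions: \<open>w \<phi>\<close> is a test function with \<open>u (w \<phi>)' = u w' \<phi> + w u \<phi>'\<close>.
\<close>

lemma has_weak_deriv_mult_smooth:
  assumes uv: "has_weak_deriv 1 u v" and w: "smooth_on {0<..} w"
  shows "has_weak_deriv 1 (\<lambda>r. w r * u r) (\<lambda>r. deriv w r * u r + w r * v r)"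
proof -
  have li: "locally_integrable u" "locally_integrable v" using uv by (auto simp: has_weak_deriv_def)
  have w': "smooth_on {0<..} (deriv w)" using smooth_on_deriv[OF w] .
  have li2: "locally_integrable (\<lambda>r. w r * u r)" "locally_integrable (\<lambda>r. deriv w r * u r)"
    "locally_integrable (\<lambda>r. w r * v r)"
    by (intro locally_integrable_mult li smooth_on_continuous w w')+
  show ?thesis
    unfolding has_weak_deriv_def
  proof (intro conjI allI impI)
    show "locally_integrable (\<lambda>r. w r * u r)"
      "locally_integrable (\<lambda>r. deriv w r * u r + w r * v r)"
      by (intro locally_integrable_add li2)+
    fix \<phi> assume \<phi>: "test_function \<phi>"
    have d: "deriv (\<lambda>x. w x * \<phi> x) r = deriv w r * \<phi> r + w r * deriv \<phi> r" if "0 < r" for r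
    proof (rule DERIV_imp_deriv)
      have "(\<phi> has_real_derivative deriv \<phi> r) (at r)"
        by (rule test_functionE[OF \<phi>]) (rule test_on_DERIV)
      moreover have "(w has_real_derivative deriv w r) (at r)" using smooth_on_DERIV[OF w] that by auto
      ultimately show "((\<lambda>x. w x * \<phi> x) has_real_derivative deriv w r * \<phi> r + w r * deriv \<phi> r) (at r)"
        by (auto intro!: derivative_eq_intros)
    qed
    have "u r * deriv (\<lambda>x. w x * \<phi> x) r = deriv w r * u r * \<phi> r + w r * u r * deriv \<phi> r"
      if "0 < r" for r unfolding d[OF that] by (simp add: algebra_simps)
    then have "(LINT r:{0<..}|lebesgue. u r * deriv (\<lambda>x. w x * \<phi> x) r)
        = (LINT r:{0<..}|lebesgue. deriv w r * u r * \<phi> r + w r * u r * deriv \<phi> r)"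
      by (intro set_lebesgue_integral_cong) auto
    also have "\<dots> = (LINT r:{0<..}|lebesgue. deriv w r * u r * \<phi> r) + (LINT r:{0<..}|lebesgue. w r * u r * deriv \<phi> r)"
      by (intro set_integral_add test_integrable li2 test_function_deriv \<phi>)
    finally have *: "(LINT r:{0<..}|lebesgue. u r * deriv (\<lambda>x. w x * \<phi> x) r) =
      (LINT r:{0<..}|lebesgue. deriv w r * u r * \<phi> r) + (LINT r:{0<..}|lebesgue. w r * u r * deriv \<phi> r)" .
    have "(LINT r:{0<..}|lebesgue. u r * deriv (\<lambda>x. w x * \<phi> x) r) = - (LINT r:{0<..}|lebesgue. v r * (w r * \<phi> r))"
      using uv test_function_mult[OF \<phi> w] by (simp add: has_weak_deriv_def)
    also have "(LINT r:{0<..}|lebesgue. v r * (w r * \<phi> r)) = (LINT r:{0<..}|lebesgue. w r * v r * \<phi> r)"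
      by (rule set_lebesgue_integral_cong) (auto simp: algebra_simps)
    finally have **: "(LINT r:{0<..}|lebesgue. w r * u r * deriv \<phi> r)
       = - ((LINT r:{0<..}|lebesgue. deriv w r * u r * \<phi> r) + (LINT r:{0<..}|lebesgue. w r * v r * \<phi> r))"
      using * by simp
    have "(LINT r:{0<..}|lebesgue. (deriv w r * u r + w r * v r) * \<phi> r)
       = (LINT r:{0<..}|lebesgue. deriv w r * u r * \<phi> r + w r * v r * \<phi> r)"
      by (simp add: algebra_simps)
    also have "\<dots> = (LINT r:{0<..}|lebesgue. deriv w r * u r * \<phi> r) + (LINT r:{0<..}|lebesgue. w r * v r * \<phi> r)"
      by (intro set_integral_add test_integrable li2 \<phi>)
    finally show "(LINT r:{0<..}|lebesgue. w r * u r * (deriv ^^ 1) \<phi> r)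
        = (-1) ^ 1 * (LINT r:{0<..}|lebesgue. (deriv w r * u r + w r * v r) * \<phi> r)"
      using ** by simp
  qed
qed

text \<open>
  On each compact interval the function agrees almost everywhere with a primitive of its weak
  derivative, up to a constant depending on the interval. The constant cancels in differences, so
  the exceptional sets for an exhausting sequence of intervals can be united.
\<close>

lemma weak_deriv_increment:
  assumes uv: "has_weak_deriv 1 u v"
  shows "\<exists>N\<in>null_sets lborel. \<forall>x y. x \<notin> N \<longrightarrow> y \<notin> N \<longrightarrow> 0 < x \<longrightarrow> x \<le> y \<longrightarrow>
    ennreal \<bar>u y - u x\<bar> \<le> (\<integral>\<^sup>+t\<in>{x..y}. ennreal \<bar>v t\<bar> \<partial>lborel)"
proof -
  have li: "locally_integrable u" "locally_integrable v" using uv by (auto simp: has_weak_deriv_def)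
  have *: "\<exists>N\<in>null_sets lborel. \<forall>x\<in>{a..b} - N. \<forall>y\<in>{a..b} - N. x \<le> y \<longrightarrow>
      ennreal \<bar>u y - u x\<bar> \<le> (\<integral>\<^sup>+t\<in>{x..y}. ennreal \<bar>v t\<bar> \<partial>lborel)" if ab: "0 < a" "a < b" for a b
  proof -
    obtain u0 where u0: "integrable lborel u0" "\<And>x. x \<notin> {a..b} \<Longrightarrow> u0 x = 0"
      "AE x in lborel. x \<in> {a..b} \<longrightarrow> u x = u0 x"
      using locally_integrable_representative[OF li(1) ab] by blast
    obtain v0 where v0: "integrable lborel v0" "\<And>x. x \<notin> {a..b} \<Longrightarrow> v0 x = 0"
      "AE x in lborel. x \<in> {a..b} \<longrightarrow> v x = v0 x"
      using locally_integrable_representative[OF li(2) ab] by blast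
    obtain c where c: "AE x in lborel. x \<in> {a..b} \<longrightarrow> u0 x = c + primitive v0 x"
    proof -
      have "(LINT x|lborel. u0 x * deriv \<phi> x) = - (LINT x|lborel. v0 x * \<phi> x)" if \<phi>: "test_on a b \<phi>" for \<phi>
        using uv test_on_imp_test_function[OF ab(1) \<phi>]
          test_integral_representative(2)[OF u0(1,3) test_on_deriv[OF \<phi>] ab(1)]
          test_integral_representative(2)[OF v0(1,3) \<phi> ab(1)]
        by (simp add: has_weak_deriv_def)
      then show thesis using eq_const_plus_primitive[OF ab(2) u0(1) v0(1) u0(2)] that by blast
    qed
    have "AE x in lborel. x \<in> {a..b} \<longrightarrow> u x = c + primitive v0 x"
      using c u0(3) by eventually_elim auto
    then obtain N where N: "N \<in> null_sets lborel" "{x \<in> space lborel. \<not> (x \<in> {a..b} \<longrightarrow> u x = c + primitive v0 x)} \<subseteq> N"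
      unfolding eventually_ae_filter by blast
    have "ennreal \<bar>u y - u x\<bar> \<le> (\<integral>\<^sup>+t\<in>{x..y}. ennreal \<bar>v t\<bar> \<partial>lborel)"
      if "x \<in> {a..b} - N" "y \<in> {a..b} - N" "x \<le> y" for x y
    proof -
      have "u x = c + primitive v0 x" "u y = c + primitive v0 y" using N(2) that(1,2) by auto
      then have "ennreal \<bar>u y - u x\<bar> \<le> (\<integral>\<^sup>+t\<in>{x..y}. ennreal \<bar>v0 t\<bar> \<partial>lborel)"
        using primitive_diff[OF v0(1) that(3)] by simp
      also have "\<dots> = (\<integral>\<^sup>+t\<in>{x..y}. ennreal \<bar>v t\<bar> \<partial>lborel)"
      proof (rule nn_integral_cong_AE)
        show "AE t in lborel. ennreal \<bar>v0 t\<bar> * indicator {x..y} t = ennreal \<bar>v t\<bar> * indicator {x..y} t"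
          using v0(3) by eventually_elim (use that in \<open>auto simp: indicator_def\<close>)
      qed
      finally show ?thesis .
    qed
    then show ?thesis using N(1) by blast
  qed
  define good where "good n N \<longleftrightarrow> (\<forall>x\<in>{1 / real (n + 2)..real (n + 2)} - N.
      \<forall>y\<in>{1 / real (n + 2)..real (n + 2)} - N. x \<le> y \<longrightarrow>
      ennreal \<bar>u y - u x\<bar> \<le> (\<integral>\<^sup>+t\<in>{x..y}. ennreal \<bar>v t\<bar> \<partial>lborel))" for n N
  have "\<forall>n::nat. \<exists>N\<in>null_sets lborel. good n N"
    unfolding good_def by (intro allI *) (auto intro: less_trans[of _ 1])
  then obtain N where N: "\<And>n. N n \<in> null_sets lborel" "\<And>n. good n (N n)" by metis
  show ?thesis
  proof (intro bexI[of _ "\<Union>n. N n"] allI impI)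
    show "(\<Union>n. N n) \<in> null_sets lborel" using N(1) by (intro null_sets_UN) auto
    fix x y assume *: "x \<notin> (\<Union>n. N n)" "y \<notin> (\<Union>n. N n)" "0 < x" "x \<le> y"
    obtain n :: nat where n: "max y (1 / x) < real n" using reals_Archimedean2 by blast
    have "x \<in> {1 / real (n + 2)..real (n + 2)}" "y \<in> {1 / real (n + 2)..real (n + 2)}"
    proof -
      have "1 / real (n + 2) \<le> x" using n *(3) by (simp add: field_simps)
      moreover have "y \<le> real (n + 2)" using n by simp
      ultimately show "x \<in> {1 / real (n + 2)..real (n + 2)}" "y \<in> {1 / real (n + 2)..real (n + 2)}"
        using *(4) by auto
    qed
    then show "ennreal \<bar>u y - u x\<bar> \<le> (\<integral>\<^sup>+t\<in>{x..y}. ennreal \<bar>v t\<bar> \<partial>lborel)"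
      using N(2)[of n] * unfolding good_def by blast
  qed
qed

section \<open>Kernels that are homogeneous of degree zero with respect to \<open>dr / r\<close>\<close>

text \<open>
  The convex function \<open>h powr p\<close> lies above its tangent at \<open>m\<close>.
\<close>

lemma powr_tangent_bound:
  fixes h m p :: real
  assumes p: "1 < p" and h: "0 \<le> h" and m: "0 < m"
  shows "p * m powr (p - 1) * h \<le> h powr p + (p - 1) * m powr p"
proof -
  have "h * m powr (p - 1) \<le> h powr p / p + (m powr (p - 1)) powr (p / (p - 1)) / (p / (p - 1))"
    using p h m by (intro Youngs_inequality) (auto simp: field_simps)
  also have "(m powr (p - 1)) powr (p / (p - 1)) = m powr p" using p by (simp add: powr_powr)
  also have "h powr p / p + m powr p / (p / (p - 1)) = (h powr p + (p - 1) * m powr p) / p"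
    using p by (simp add: field_simps)
  finally have "h * m powr (p - 1) * p \<le> h powr p + (p - 1) * m powr p"
    using p by (simp add: pos_le_divide_eq)
  then show ?thesis by (simp add: mult_ac)
qed

lemma powr_minus_1_mult: "0 < x \<Longrightarrow> x powr (p - 1) * x = x powr p" for x p :: real
  using powr_add[of x "p - 1" 1] by simp

text \<open>
  This is Jensen's inequality for the convex function \<open>x\<^sup>p\<close> and the measure with density \<open>k\<close>, obtained
  by integrating the tangent bound at \<open>m = y / A\<close>. Only a lower bound \<open>y\<close> for the integral occurs, so
  the integral itself may be infinite.
\<close>

lemma kernel_integral_power_bound:
  fixes k :: "real \<Rightarrow> ennreal" and h :: "real \<Rightarrow> real"
  assumes p: "1 < p" and [measurable]: "k \<in> borel_measurable borel" "h \<in> borel_measurable borel"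
    and h: "\<And>t. 0 \<le> h t" and A: "0 < A" "(\<integral>\<^sup>+t. k t \<partial>lborel) \<le> ennreal A"
    and y: "0 \<le> y" "ennreal y \<le> (\<integral>\<^sup>+t. k t * ennreal (h t) \<partial>lborel)"
  shows "ennreal (y powr p) \<le> ennreal (A powr (p - 1)) * (\<integral>\<^sup>+t. k t * ennreal (h t powr p) \<partial>lborel)"
proof (cases "y = 0")
  case False
  \<comment> \<open>The tangent at \<open>y / A\<close> gives \<open>p Z \<le> J + (p - 1) Z\<close>, where \<open>Z\<close> is finite and can be subtracted.\<close>
  define m where "m = y / A"
  have m: "0 < m" using False y A by (simp add: m_def)
  let ?J = "\<integral>\<^sup>+t. k t * ennreal (h t powr p) \<partial>lborel"
  define Z where "Z = m powr (p - 1) * y"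
  have Z: "0 \<le> Z" using y(1) by (simp add: Z_def)
  have Z2: "m powr p * A = Z"
  proof -
    have "m powr p * A = m powr (p - 1) * (m * A)"
      unfolding powr_minus_1_mult[OF m, of p, symmetric] by (simp only: mult.assoc)
    also have "m * A = y" using A by (simp add: m_def)
    finally show ?thesis by (simp only: Z_def)
  qed
  have "ennreal (p * Z) = ennreal (p * m powr (p - 1)) * ennreal y"
    using p y(1) by (subst ennreal_mult[symmetric]) (auto simp: Z_def mult.assoc)
  also have "\<dots> \<le> ennreal (p * m powr (p - 1)) * (\<integral>\<^sup>+t. k t * ennreal (h t) \<partial>lborel)"
    by (intro mult_left_mono y) simp
  also have "\<dots> = (\<integral>\<^sup>+t. k t * ennreal (p * m powr (p - 1) * h t) \<partial>lborel)"
    using p h by (subst nn_integral_cmult[symmetric]) (auto intro!: nn_integral_cong simp: ennreal_mult' mult_ac)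
  also have "\<dots> \<le> (\<integral>\<^sup>+t. k t * ennreal (h t powr p) + ennreal ((p - 1) * m powr p) * k t \<partial>lborel)"
  proof (rule nn_integral_mono)
    fix t
    have "ennreal (p * m powr (p - 1) * h t) \<le> ennreal (h t powr p + (p - 1) * m powr p)"
      using powr_tangent_bound[OF p h m] by (rule ennreal_leI)
    also have "\<dots> = ennreal (h t powr p) + ennreal ((p - 1) * m powr p)"
      using p by (intro ennreal_plus) auto
    finally have "k t * ennreal (p * m powr (p - 1) * h t)
        \<le> k t * (ennreal (h t powr p) + ennreal ((p - 1) * m powr p))" by (rule mult_left_mono) simp
    then show "k t * ennreal (p * m powr (p - 1) * h t)
        \<le> k t * ennreal (h t powr p) + ennreal ((p - 1) * m powr p) * k t"
      by (simp add: distrib_left mult.commute)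
  qed
  also have "\<dots> = ?J + ennreal ((p - 1) * m powr p) * (\<integral>\<^sup>+t. k t \<partial>lborel)"
    by (simp add: nn_integral_add nn_integral_cmult)
  also have "\<dots> \<le> ?J + ennreal ((p - 1) * m powr p) * ennreal A"
    by (intro add_left_mono mult_left_mono A) simp
  also have "ennreal ((p - 1) * m powr p) * ennreal A = ennreal ((p - 1) * Z)"
    using A(1) by (simp add: Z2[symmetric] mult.assoc flip: ennreal_mult'')
  finally have "ennreal (p * Z) \<le> ?J + ennreal ((p - 1) * Z)" .
  moreover have "ennreal (p * Z) = ennreal Z + ennreal ((p - 1) * Z)"
  proof -
    have "0 \<le> (p - 1) * Z" using p Z by simp
    then have "ennreal Z + ennreal ((p - 1) * Z) = ennreal (Z + (p - 1) * Z)" using Z by simp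
    then show ?thesis by (simp add: algebra_simps)
  qed
  ultimately have "ennreal Z \<le> ?J" by (simp add: add.commute ennreal_add_left_cancel_le)
  have "y powr p = A powr (p - 1) * Z"
  proof -
    have "y powr p = (m * A) powr p" using A by (simp add: m_def)
    also have "\<dots> = m powr p * (A powr (p - 1) * A)"
      using m A by (simp only: powr_minus_1_mult powr_mult less_imp_le)
    also have "\<dots> = A powr (p - 1) * (m powr p * A)" by (simp only: mult_ac)
    finally show ?thesis by (simp only: Z2)
  qed
  then have "ennreal (y powr p) = ennreal (A powr (p - 1)) * ennreal Z" by (simp add: ennreal_mult')
  also have "\<dots> \<le> ennreal (A powr (p - 1)) * ?J" by (intro mult_left_mono) (fact, simp)
  finally show ?thesis .
qed simp

text \<open>
  Schur's test: Jensen's inequality in every row, followed by an exchange of the integrations.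
\<close>

lemma schur_test:
  fixes K :: "real \<Rightarrow> real \<Rightarrow> ennreal" and h f :: "real \<Rightarrow> real" and w :: "real \<Rightarrow> ennreal"
  assumes p: "1 < p" and K[measurable]: "case_prod K \<in> borel_measurable (lborel \<Otimes>\<^sub>M lborel)"
    and [measurable]: "h \<in> borel_measurable borel" "w \<in> borel_measurable borel"
    and h: "\<And>t. 0 \<le> h t" and f: "\<And>y. 0 \<le> f y" and A: "0 < A"
    and row: "\<And>y. 0 < y \<Longrightarrow> (\<integral>\<^sup>+t. K y t \<partial>lborel) \<le> ennreal A"
    and col: "\<And>t. (\<integral>\<^sup>+y\<in>{0<..}. K y t * w y \<partial>lborel) \<le> ennreal A * (w t * indicator {0<..} t)"
    and fh: "AE y in lborel. 0 < y \<longrightarrow> ennreal (f y) \<le> (\<integral>\<^sup>+t. K y t * ennreal (h t) \<partial>lborel)"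
  shows "(\<integral>\<^sup>+y\<in>{0<..}. ennreal (f y powr p) * w y \<partial>lborel)
      \<le> ennreal (A powr p) * (\<integral>\<^sup>+t\<in>{0<..}. ennreal (h t powr p) * w t \<partial>lborel)"
proof -
  have Ky[measurable]: "K y \<in> borel_measurable borel" for y
    using measurable_Pair2[OF K, of y] by simp
  have "(\<integral>\<^sup>+y\<in>{0<..}. ennreal (f y powr p) * w y \<partial>lborel)
     \<le> (\<integral>\<^sup>+y. (\<integral>\<^sup>+t. ennreal (A powr (p - 1)) * (ennreal (h t powr p) * (K y t * w y * indicator {0<..} y)) \<partial>lborel) \<partial>lborel)"
  proof (rule nn_integral_mono_AE)
    show "AE y in lborel. ennreal (f y powr p) * w y * indicator {0<..} y
      \<le> (\<integral>\<^sup>+t. ennreal (A powr (p - 1)) * (ennreal (h t powr p) * (K y t * w y * indicator {0<..} y)) \<partial>lborel)"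
      using fh
    proof eventually_elim
      case (elim y)
      show ?case
      proof (cases "0 < y")
        case True
        have "ennreal (f y powr p) \<le> ennreal (A powr (p - 1)) * (\<integral>\<^sup>+t. K y t * ennreal (h t powr p) \<partial>lborel)"
          using elim True by (intro kernel_integral_power_bound p Ky h A row f) auto
        then have "ennreal (f y powr p) * w y
            \<le> ennreal (A powr (p - 1)) * (\<integral>\<^sup>+t. K y t * ennreal (h t powr p) \<partial>lborel) * w y"
          by (rule mult_right_mono) simp
        also have "\<dots> = (\<integral>\<^sup>+t. ennreal (A powr (p - 1)) * (K y t * ennreal (h t powr p)) * w y \<partial>lborel)"
          by (subst nn_integral_multc[symmetric] nn_integral_cmult[symmetric]; measurable)+ 
        finally show ?thesis using True by (simp add: mult_ac)
      qed simp
    qed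
  qed
  also have "\<dots> = (\<integral>\<^sup>+t. (\<integral>\<^sup>+y. ennreal (A powr (p - 1)) * (ennreal (h t powr p) * (K y t * w y * indicator {0<..} y)) \<partial>lborel) \<partial>lborel)"
    by (rule lborel_pair.Fubini') measurable
  also have "\<dots> = (\<integral>\<^sup>+t. ennreal (A powr (p - 1)) * (ennreal (h t powr p) * (\<integral>\<^sup>+y\<in>{0<..}. K y t * w y \<partial>lborel)) \<partial>lborel)"
    by (simp add: nn_integral_cmult)
  also have "\<dots> \<le> (\<integral>\<^sup>+t. ennreal (A powr (p - 1)) * (ennreal (h t powr p) * (ennreal A * (w t * indicator {0<..} t))) \<partial>lborel)"
    by (intro nn_integral_mono mult_left_mono col) auto
  also have "\<dots> = (\<integral>\<^sup>+t. ennreal (A powr p) * (ennreal (h t powr p) * w t * indicator {0<..} t) \<partial>lborel)"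
  proof -
    have "ennreal (A powr p) = ennreal (A powr (p - 1)) * ennreal A"
      using A powr_minus_1_mult[OF A] by (simp flip: ennreal_mult'')
    then show ?thesis by (simp add: mult_ac)
  qed
  also have "\<dots> = ennreal (A powr p) * (\<integral>\<^sup>+t\<in>{0<..}. ennreal (h t powr p) * w t \<partial>lborel)"
    by (simp add: nn_integral_cmult)
  finally show ?thesis .
qed

text \<open>
  The \<open>p\<close>-th power of the norm in \<open>L\<^sup>p(dr/r)\<close>; after the substitution \<open>r = e\<^sup>s\<close> this is an unweighted
  norm on the line and \<open>r d/dr\<close> becomes \<open>d/ds\<close>.
\<close>

definition log_energy :: "real \<Rightarrow> real set \<Rightarrow> (real \<Rightarrow> real) \<Rightarrow> ennreal" where
  "log_energy p S f = (\<integral>\<^sup>+r\<in>S. ennreal (\<bar>f r\<bar> powr p / r) \<partial>lborel)"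

lemma nn_integral_powr_initial:
  assumes "0 < a" "0 < y"
  shows "(\<integral>\<^sup>+t\<in>{0<..y}. ennreal (t powr (a - 1)) \<partial>lborel) = ennreal (y powr a / a)"
proof -
  have "(\<integral>\<^sup>+t\<in>{0..y}. ennreal (t powr (a - 1)) \<partial>lborel) = ennreal (y powr (a - 1 + 1) / (a - 1 + 1))"
    using assms by (intro nn_integral_has_integral_lebesgue' has_integral_powr_from_0) auto
  moreover have "(\<integral>\<^sup>+t\<in>{0..y}. ennreal (t powr (a - 1)) \<partial>lborel) = (\<integral>\<^sup>+t\<in>{0<..y}. ennreal (t powr (a - 1)) \<partial>lborel)"
    by (intro nn_integral_cong) (auto simp: indicator_def)
  ultimately show ?thesis by simp
qed

lemma nn_integral_powr_tail:
  assumes "0 < a" "0 < y"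
  shows "(\<integral>\<^sup>+t\<in>{y..}. ennreal (t powr (- a - 1)) \<partial>lborel) = ennreal (y powr (- a) / a)"
proof -
  have "(\<integral>\<^sup>+t\<in>{y..}. ennreal (t powr (- a - 1)) \<partial>lborel) = ennreal (- (y powr (- a - 1 + 1)) / (- a - 1 + 1))"
    using assms by (intro nn_integral_has_integral_lebesgue' has_integral_powr_to_inf) auto
  then show ?thesis by simp
qed

lemma nn_integral_inverse:
  assumes "0 < c" "c \<le> d"
  shows "(\<integral>\<^sup>+t\<in>{c..d}. ennreal (1 / t) \<partial>lborel) = ennreal (ln (d / c))"
proof -
  have "((\<lambda>t. 1 / t) has_integral (ln d - ln c)) {c..d}"
    using assms by (intro fundamental_theorem_of_calculus)
      (auto intro!: derivative_eq_intros simp flip: has_real_derivative_iff_has_vector_derivative)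
  then have "(\<integral>\<^sup>+t\<in>{c..d}. ennreal (1 / t) \<partial>lborel) = ennreal (ln d - ln c)"
    using assms by (intro nn_integral_has_integral_lebesgue') auto
  then show ?thesis using assms by (simp add: ln_div)
qed

text \<open>
  The hypotheses on \<open>K\<close> say that it has total mass \<open>1 / a\<close> as a convolution kernel on \<open>(0,\<infinity>)\<close> with the
  measure \<open>dr/r\<close>; \<open>col\<close> is the mass of its reflection.
\<close>

lemma log_energy_kernel_bound:
  assumes p: "1 < p" and a: "0 < a" and K: "case_prod K \<in> borel_measurable (lborel \<Otimes>\<^sub>M lborel)"
    and h: "h \<in> borel_measurable borel"
    and row: "\<And>y. 0 < y \<Longrightarrow> (\<integral>\<^sup>+t. K y t \<partial>lborel) = ennreal (1 / a)"
    and col: "\<And>t. (\<integral>\<^sup>+y\<in>{0<..}. K y t * ennreal (1 / y) \<partial>lborel) = ennreal (1 / a) * (ennreal (1 / t) * indicator {0<..} t)"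
    and fh: "AE y in lborel. 0 < y \<longrightarrow> ennreal \<bar>f y\<bar> \<le> (\<integral>\<^sup>+t. K y t * ennreal \<bar>h t\<bar> \<partial>lborel)"
  shows "ennreal (a powr p) * log_energy p {0<..} f \<le> log_energy p {0<..} h"
proof -
  have "(\<integral>\<^sup>+y\<in>{0<..}. ennreal (\<bar>f y\<bar> powr p) * ennreal (1 / y) \<partial>lborel)
      \<le> ennreal ((1 / a) powr p) * (\<integral>\<^sup>+t\<in>{0<..}. ennreal (\<bar>h t\<bar> powr p) * ennreal (1 / t) \<partial>lborel)"
    by (rule schur_test[OF p K]) (use a h row col fh in auto)
  moreover have e: "(\<integral>\<^sup>+y\<in>{0<..}. ennreal (\<bar>f y\<bar> powr p) * ennreal (1 / y) \<partial>lborel) = log_energy p {0<..} f" for f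
    unfolding log_energy_def by (intro nn_integral_cong) (auto simp: indicator_def simp flip: ennreal_mult')
  ultimately have "log_energy p {0<..} f \<le> ennreal ((1 / a) powr p) * log_energy p {0<..} h" by simp
  then have "ennreal (a powr p) * log_energy p {0<..} f
      \<le> ennreal (a powr p) * (ennreal ((1 / a) powr p) * log_energy p {0<..} h)" by (rule mult_left_mono) simp
  also have "\<dots> = ennreal (a powr p * (1 / a) powr p) * log_energy p {0<..} h" by (simp add: ennreal_mult' mult.assoc)
  also have "a powr p * (1 / a) powr p = 1" using a by (simp add: powr_divide)
  finally show ?thesis by simp
qed

text \<open>
  The hypothesis is what remains of \<open>(y\<^sup>a f)' = y\<^sup>a\<^sup>-\<^sup>1 h\<close> after integration from \<open>0\<close>.
\<close>

lemma hardy_kernel_pos: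
  assumes p: "1 < p" and a: "0 < a" and [measurable]: "h \<in> borel_measurable borel"
    and fh: "AE y in lborel. 0 < y \<longrightarrow>
      ennreal \<bar>y powr a * f y\<bar> \<le> (\<integral>\<^sup>+t\<in>{0<..y}. ennreal \<bar>t powr (a - 1) * h t\<bar> \<partial>lborel)"
  shows "ennreal (a powr p) * log_energy p {0<..} f \<le> log_energy p {0<..} h"
proof -
  define K where "K y t = (if 0 < t \<and> t \<le> y then ennreal (y powr (- a) * t powr (a - 1)) else 0)" for y t :: real
  show ?thesis
  proof (rule log_energy_kernel_bound[OF p a, where K = K])
    show "case_prod K \<in> borel_measurable (lborel \<Otimes>\<^sub>M lborel)" unfolding K_def by measurable
    show "(\<integral>\<^sup>+t. K y t \<partial>lborel) = ennreal (1 / a)" if "0 < y" for y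
    proof -
      have "(\<integral>\<^sup>+t. K y t \<partial>lborel) = (\<integral>\<^sup>+t. ennreal (y powr (- a)) * (ennreal (t powr (a - 1)) * indicator {0<..y} t) \<partial>lborel)"
        by (intro nn_integral_cong) (auto simp: K_def indicator_def ennreal_mult')
      also have "\<dots> = ennreal (y powr (- a)) * ennreal (y powr a / a)"
        by (subst nn_integral_cmult) (auto simp: nn_integral_powr_initial[OF a that])
      also have "\<dots> = ennreal (1 / a)" using that a by (simp add: powr_minus field_simps flip: ennreal_mult')
      finally show ?thesis by simp
    qed
    show "(\<integral>\<^sup>+y\<in>{0<..}. K y t * ennreal (1 / y) \<partial>lborel) = ennreal (1 / a) * (ennreal (1 / t) * indicator {0<..} t)" for t
    proof (cases "0 < t")
      case True
      have "(\<integral>\<^sup>+y\<in>{0<..}. K y t * ennreal (1 / y) \<partial>lborel)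
          = (\<integral>\<^sup>+y. ennreal (t powr (a - 1)) * (ennreal (y powr (- a - 1)) * indicator {t..} y) \<partial>lborel)"
        using True by (intro nn_integral_cong)
          (auto simp: K_def indicator_def powr_diff mult.commute field_simps simp flip: ennreal_mult')
      also have "\<dots> = ennreal (t powr (a - 1)) * ennreal (t powr (- a) / a)"
        by (subst nn_integral_cmult) (auto simp: nn_integral_powr_tail[OF a True])
      also have "\<dots> = ennreal (1 / a) * ennreal (1 / t)"
        using True a by (simp add: powr_minus powr_diff field_simps flip: ennreal_mult')
      finally show ?thesis using True by simp
    qed (simp add: K_def)
    show "AE y in lborel. 0 < y \<longrightarrow> ennreal \<bar>f y\<bar> \<le> (\<integral>\<^sup>+t. K y t * ennreal \<bar>h t\<bar> \<partial>lborel)"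
      using fh
    proof (eventually_elim, intro impI)
      fix y :: real assume y: "0 < y" and "0 < y \<longrightarrow>
        ennreal \<bar>y powr a * f y\<bar> \<le> (\<integral>\<^sup>+t\<in>{0<..y}. ennreal \<bar>t powr (a - 1) * h t\<bar> \<partial>lborel)"
      then have *: "ennreal \<bar>y powr a * f y\<bar> \<le> (\<integral>\<^sup>+t\<in>{0<..y}. ennreal \<bar>t powr (a - 1) * h t\<bar> \<partial>lborel)" by simp
      have "ennreal \<bar>f y\<bar> = ennreal (y powr (- a)) * ennreal \<bar>y powr a * f y\<bar>"
        using y by (simp add: abs_mult powr_minus field_simps flip: ennreal_mult')
      also have "\<dots> \<le> ennreal (y powr (- a)) * (\<integral>\<^sup>+t\<in>{0<..y}. ennreal \<bar>t powr (a - 1) * h t\<bar> \<partial>lborel)"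
        by (intro mult_left_mono *) simp
      also have "\<dots> = (\<integral>\<^sup>+t. ennreal (y powr (- a)) * (ennreal \<bar>t powr (a - 1) * h t\<bar> * indicator {0<..y} t) \<partial>lborel)"
        by (rule nn_integral_cmult[symmetric]) measurable
      also have "\<dots> = (\<integral>\<^sup>+t. K y t * ennreal \<bar>h t\<bar> \<partial>lborel)"
        by (intro nn_integral_cong) (auto simp: K_def indicator_def abs_mult ennreal_mult' mult_ac)
      finally show "ennreal \<bar>f y\<bar> \<le> (\<integral>\<^sup>+t. K y t * ennreal \<bar>h t\<bar> \<partial>lborel)" .
    qed
  qed fact
qed

text \<open>
  The counterpart for a negative exponent, where the integration starts at infinity.
\<close>

lemma hardy_kernel_neg:
  assumes p: "1 < p" and a: "0 < a" and [measurable]: "h \<in> borel_measurable borel"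
    and fh: "AE y in lborel. 0 < y \<longrightarrow>
      ennreal \<bar>y powr (- a) * f y\<bar> \<le> (\<integral>\<^sup>+t\<in>{y..}. ennreal \<bar>t powr (- a - 1) * h t\<bar> \<partial>lborel)"
  shows "ennreal (a powr p) * log_energy p {0<..} f \<le> log_energy p {0<..} h"
proof -
  define K where "K y t = (if 0 < y \<and> y \<le> t then ennreal (y powr a * t powr (- a - 1)) else 0)" for y t :: real
  show ?thesis
  proof (rule log_energy_kernel_bound[OF p a, where K = K])
    show "case_prod K \<in> borel_measurable (lborel \<Otimes>\<^sub>M lborel)" unfolding K_def by measurable
    show "(\<integral>\<^sup>+t. K y t \<partial>lborel) = ennreal (1 / a)" if "0 < y" for y
    proof -
      have "(\<integral>\<^sup>+t. K y t \<partial>lborel) = (\<integral>\<^sup>+t. ennreal (y powr a) * (ennreal (t powr (- a - 1)) * indicator {y..} t) \<partial>lborel)"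
        using that by (intro nn_integral_cong) (auto simp: K_def indicator_def ennreal_mult')
      also have "\<dots> = ennreal (y powr a) * ennreal (y powr (- a) / a)"
        by (subst nn_integral_cmult) (auto simp: nn_integral_powr_tail[OF a that])
      also have "\<dots> = ennreal (1 / a)" using that a by (simp add: powr_minus field_simps flip: ennreal_mult')
      finally show ?thesis by simp
    qed
    show "(\<integral>\<^sup>+y\<in>{0<..}. K y t * ennreal (1 / y) \<partial>lborel) = ennreal (1 / a) * (ennreal (1 / t) * indicator {0<..} t)" for t
    proof (cases "0 < t")
      case True
      have "(\<integral>\<^sup>+y\<in>{0<..}. K y t * ennreal (1 / y) \<partial>lborel)
          = (\<integral>\<^sup>+y. ennreal (t powr (- a - 1)) * (ennreal (y powr (a - 1)) * indicator {0<..t} y) \<partial>lborel)"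
        using True by (intro nn_integral_cong)
          (auto simp: K_def indicator_def powr_diff mult.commute field_simps simp flip: ennreal_mult')
      also have "\<dots> = ennreal (t powr (- a - 1)) * ennreal (t powr a / a)"
        by (subst nn_integral_cmult) (auto simp: nn_integral_powr_initial[OF a True])
      also have "\<dots> = ennreal (1 / a) * ennreal (1 / t)"
        using True a by (simp add: powr_minus powr_diff field_simps flip: ennreal_mult')
      finally show ?thesis using True by simp
    next
      case False
      then have "(\<integral>\<^sup>+y\<in>{0<..}. K y t * ennreal (1 / y) \<partial>lborel) = (\<integral>\<^sup>+y. 0 \<partial>(lborel :: real measure))"
        by (intro nn_integral_cong) (auto simp: K_def)
      then show ?thesis using False by simp
    qed
    show "AE y in lborel. 0 < y \<longrightarrow> ennreal \<bar>f y\<bar> \<le> (\<integral>\<^sup>+t. K y t * ennreal \<bar>h t\<bar> \<partial>lborel)"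
      using fh
    proof (eventually_elim, intro impI)
      fix y :: real assume y: "0 < y" and "0 < y \<longrightarrow>
        ennreal \<bar>y powr (- a) * f y\<bar> \<le> (\<integral>\<^sup>+t\<in>{y..}. ennreal \<bar>t powr (- a - 1) * h t\<bar> \<partial>lborel)"
      then have *: "ennreal \<bar>y powr (- a) * f y\<bar> \<le> (\<integral>\<^sup>+t\<in>{y..}. ennreal \<bar>t powr (- a - 1) * h t\<bar> \<partial>lborel)" by simp
      have "ennreal \<bar>f y\<bar> = ennreal (y powr a) * ennreal \<bar>y powr (- a) * f y\<bar>"
        using y by (simp add: abs_mult powr_minus field_simps flip: ennreal_mult')
      also have "\<dots> \<le> ennreal (y powr a) * (\<integral>\<^sup>+t\<in>{y..}. ennreal \<bar>t powr (- a - 1) * h t\<bar> \<partial>lborel)"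
        by (intro mult_left_mono *) simp
      also have "\<dots> = (\<integral>\<^sup>+t. ennreal (y powr a) * (ennreal \<bar>t powr (- a - 1) * h t\<bar> * indicator {y..} t) \<partial>lborel)"
        by (rule nn_integral_cmult[symmetric]) measurable
      also have "\<dots> = (\<integral>\<^sup>+t. K y t * ennreal \<bar>h t\<bar> \<partial>lborel)"
        using y by (intro nn_integral_cong) (auto simp: K_def indicator_def abs_mult ennreal_mult' mult_ac)
      finally show "ennreal \<bar>f y\<bar> \<le> (\<integral>\<^sup>+t. K y t * ennreal \<bar>h t\<bar> \<partial>lborel)" .
    qed
  qed fact
qed

section \<open>Hardy's inequality for weak derivatives\<close>

text \<open>
  Versions on an exhausting sequence of compact intervals are glued by a pointwise limit, which is eventually constant
  at almost every point.
\<close>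

lemma locally_integrable_borel_version:
  assumes "locally_integrable u"
  shows "\<exists>u0\<in>borel_measurable borel. AE r in lborel. 0 < r \<longrightarrow> u r = u0 r"
proof -
  define I where "I n = {1 / real (n + 2)..real (n + 2)}" for n :: nat
  have "\<forall>n. \<exists>u0. integrable lborel u0 \<and> (AE x in lborel. x \<in> I n \<longrightarrow> u x = u0 x)"
  proof
    fix n
    have "0 < 1 / real (n + 2)" "1 / real (n + 2) < real (n + 2)"
      by (auto intro: less_trans[of _ 1])
    from locally_integrable_representative[OF assms this]
    show "\<exists>u0. integrable lborel u0 \<and> (AE x in lborel. x \<in> I n \<longrightarrow> u x = u0 x)"
      unfolding I_def by blast
  qed
  then obtain w where w: "\<And>n. integrable lborel (w n)" "\<And>n. AE x in lborel. x \<in> I n \<longrightarrow> u x = w n x"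
    by metis
  have [measurable]: "w n \<in> borel_measurable borel" for n using w(1)[of n] by auto
  have "AE x in lborel. \<forall>n. x \<in> I n \<longrightarrow> u x = w n x"
    unfolding AE_all_countable using w(2) by blast
  then have "AE x in lborel. 0 < x \<longrightarrow> u x = lim (\<lambda>n. w n x)"
  proof (eventually_elim, intro impI)
    fix x assume *: "\<forall>n. x \<in> I n \<longrightarrow> u x = w n x" and x: "0 < x"
    obtain m :: nat where m: "max x (1 / x) < real m" using reals_Archimedean2 by blast
    have "eventually (\<lambda>n. w n x = u x) sequentially"
      unfolding eventually_sequentially
    proof (intro exI[of _ m] allI impI)
      fix n assume "m \<le> n"
      then have n: "max x (1 / x) < real n" using m by linarith
      then have "x \<in> I n" using x by (auto simp: I_def field_simps)
      then show "w n x = u x" using * by simp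
    qed
    then have "(\<lambda>n. w n x) \<longlonglongrightarrow> u x" by (rule tendsto_eventually)
    then show "u x = lim (\<lambda>n. w n x)" by (simp add: limI)
  qed
  then show ?thesis by (intro bexI[of _ "\<lambda>x. lim (\<lambda>n. w n x)"]) auto
qed

lemma log_energy_lower_bound:
  assumes N: "N \<in> null_sets lborel" and cd: "0 < c" "c \<le> d" "{c..d} \<subseteq> S" and p: "0 < p" and \<epsilon>: "0 \<le> \<epsilon>"
    and f: "\<And>x. x \<in> {c..d} - N \<Longrightarrow> \<epsilon> \<le> \<bar>f x\<bar>"
  shows "ennreal (\<epsilon> powr p * ln (d / c)) \<le> log_energy p S f"
proof -
  have "ennreal (\<epsilon> powr p * ln (d / c)) = ennreal (\<epsilon> powr p) * (\<integral>\<^sup>+t\<in>{c..d}. ennreal (1 / t) \<partial>lborel)"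
    using cd by (simp add: nn_integral_inverse ennreal_mult')
  also have "\<dots> = (\<integral>\<^sup>+t. ennreal (\<epsilon> powr p) * (ennreal (1 / t) * indicator {c..d} t) \<partial>lborel)"
    by (rule nn_integral_cmult[symmetric]) measurable
  also have "\<dots> \<le> log_energy p S f"
    unfolding log_energy_def
  proof (rule nn_integral_mono_AE)
    show "AE t in lborel. ennreal (\<epsilon> powr p) * (ennreal (1 / t) * indicator {c..d} t)
        \<le> ennreal (\<bar>f t\<bar> powr p / t) * indicator S t"
      using AE_not_in[OF N]
    proof eventually_elim
      case (elim t)
      show ?case
      proof (cases "t \<in> {c..d}")
        case True
        then have "\<epsilon> powr p / t \<le> \<bar>f t\<bar> powr p / t"
          using f[of t] elim cd p \<epsilon> by (intro divide_right_mono powr_mono2) auto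
        then show ?thesis using True cd by (auto simp: indicator_def simp flip: ennreal_mult' intro!: ennreal_leI)
      qed simp
    qed
  qed
  finally show ?thesis .
qed

text \<open>
  Otherwise \<open>\<bar>f\<bar>\<close> is bounded below near \<open>0\<close>, while \<open>dr/r\<close> has infinite mass there.
\<close>

lemma small_value_near_0:
  assumes fin: "log_energy p {0<..<1} f < \<infinity>" and N: "N \<in> null_sets lborel"
    and p: "0 < p" and \<epsilon>: "0 < \<epsilon>" and z: "0 < z"
  shows "\<exists>x. 0 < x \<and> x < z \<and> x \<notin> N \<and> \<bar>f x\<bar> < \<epsilon>"
proof (rule ccontr)
  assume no: "\<not> ?thesis"
  define C where "C = enn2real (log_energy p {0<..<1} f)"
  have C: "log_energy p {0<..<1} f = ennreal C" "0 \<le> C" using fin by (auto simp: C_def)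
  define d where "d = min z 1 / 2"
  \<comment> \<open>On \<open>[c, d]\<close> alone the energy would be at least \<open>C + 1\<close>.\<close>
  define c where "c = d * exp (- ((C + 1) / \<epsilon> powr p))"
  have d: "0 < d" "d < z" "d < 1" using z by (auto simp: d_def)
  have c: "0 < c" "c \<le> d" using d C \<epsilon> by (auto simp: c_def)
  have "ennreal (\<epsilon> powr p * ln (d / c)) \<le> log_energy p {0<..<1} f"
  proof (rule log_energy_lower_bound[OF N])
    show "\<epsilon> \<le> \<bar>f x\<bar>" if "x \<in> {c..d} - N" for x
    proof -
      have "0 < x" "x < z" using that c d by auto
      then show ?thesis using no that linorder_not_le[of \<epsilon> "\<bar>f x\<bar>"] by blast
    qed
  qed (use c d p \<epsilon> in auto)
  moreover have "d / c = exp ((C + 1) / \<epsilon> powr p)"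
    using d by (simp add: c_def exp_minus field_simps)
  then have "\<epsilon> powr p * ln (d / c) = C + 1" using \<epsilon> by simp
  ultimately show False using C by simp
qed

lemma small_value_near_infinity:
  assumes fin: "log_energy p {1..} f < \<infinity>" and N: "N \<in> null_sets lborel"
    and p: "0 < p" and \<epsilon>: "0 < \<epsilon>"
  shows "\<exists>x. z < x \<and> x \<notin> N \<and> \<bar>f x\<bar> < \<epsilon>"
proof (rule ccontr)
  assume no: "\<not> ?thesis"
  define C where "C = enn2real (log_energy p {1..} f)"
  have C: "log_energy p {1..} f = ennreal C" "0 \<le> C" using fin by (auto simp: C_def)
  define c where "c = max z 1 + 1"
  define d where "d = c * exp ((C + 1) / \<epsilon> powr p)"
  have c: "z < c" "1 < c" by (auto simp: c_def)
  have d: "c \<le> d" using c C \<epsilon> by (auto simp: d_def)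
  have "ennreal (\<epsilon> powr p * ln (d / c)) \<le> log_energy p {1..} f"
  proof (rule log_energy_lower_bound[OF N])
    show "\<epsilon> \<le> \<bar>f x\<bar>" if "x \<in> {c..d} - N" for x
    proof -
      have "z < x" using that c by auto
      then show ?thesis using no that linorder_not_le[of \<epsilon> "\<bar>f x\<bar>"] by blast
    qed
  qed (use c d p \<epsilon> in auto)
  moreover have "\<epsilon> powr p * ln (d / c) = C + 1"
    using c \<epsilon> by (simp add: d_def)
  ultimately show False using C by simp
qed

text \<open>
  In terms of \<open>D = r d/dr\<close> this reads \<open>D (r\<^sup>a f) = r\<^sup>a (D f + a f)\<close>. Here and below, \<open>D f = g\<close> is expressed
  as \<open>has_weak_deriv 1 f (\<lambda>r. g r / r)\<close>.
\<close>

lemma has_weak_deriv_powr_mult: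
  assumes "has_weak_deriv 1 f (\<lambda>r. g r / r)"
  shows "has_weak_deriv 1 (\<lambda>r. r powr a * f r) (\<lambda>r. r powr (a - 1) * (g r + a * f r))"
proof (rule has_weak_deriv_cong[OF has_weak_deriv_mult_smooth[OF assms smooth_on_powr[of a]]])
  show "AE r in lborel. 0 < r \<longrightarrow> deriv (\<lambda>x. x powr a) r * f r + r powr a * (g r / r)
     = r powr (a - 1) * (g r + a * f r)"
  proof (intro AE_I2 impI)
    fix r :: real assume r: "0 < r"
    have "deriv (\<lambda>x. x powr a) r = a * r powr (a - 1)"
      using r by (intro DERIV_imp_deriv) (auto intro!: has_real_derivative_powr)
    then show "deriv (\<lambda>x. x powr a) r * f r + r powr a * (g r / r) = r powr (a - 1) * (g r + a * f r)"
      using r by (simp add: powr_diff field_simps)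
  qed
qed auto

lemma abs_le_if_close_to_small:
  fixes I :: ennreal
  assumes "\<And>\<epsilon>. 0 < \<epsilon> \<Longrightarrow> \<exists>Fx. \<bar>Fx\<bar> < \<epsilon> \<and> ennreal \<bar>Fy - Fx\<bar> \<le> I"
  shows "ennreal \<bar>Fy\<bar> \<le> I"
proof (rule ennreal_le_epsilon)
  fix e :: real assume "0 < e"
  then obtain Fx where Fx: "\<bar>Fx\<bar> < e" "ennreal \<bar>Fy - Fx\<bar> \<le> I" using assms by blast
  have "ennreal \<bar>Fy\<bar> \<le> ennreal (\<bar>Fy - Fx\<bar> + e)" using Fx(1) by (intro ennreal_leI) linarith
  also have "\<dots> = ennreal \<bar>Fy - Fx\<bar> + ennreal e" using \<open>0 < e\<close> by simp
  also have "\<dots> \<le> I + ennreal e" using Fx(2) by (rule add_right_mono)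
  finally show "ennreal \<bar>Fy\<bar> \<le> I + ennreal e" .
qed

lemma log_energy_cong_AE:
  assumes "AE r in lborel. r \<in> S \<longrightarrow> \<bar>f r\<bar> = \<bar>g r\<bar>"
  shows "log_energy p S f = log_energy p S g"
  unfolding log_energy_def
proof (rule nn_integral_cong_AE)
  show "AE r in lborel. ennreal (\<bar>f r\<bar> powr p / r) * indicator S r = ennreal (\<bar>g r\<bar> powr p / r) * indicator S r"
    using assms by eventually_elim (auto simp: indicator_def)
qed

text \<open>
  For \<open>a > 0\<close> the function \<open>r\<^sup>a f\<close> is integrated from \<open>0\<close>, for \<open>a < 0\<close> from infinity. Finite energy near
  that end yields points arbitrarily close to it at which \<open>r\<^sup>a f\<close> is arbitrarily small, so there is no
  boundary term. Energy at the other end may be infinite a priori; this is what makes the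
  inequality a source of integrability in \<open>log_sobolev_scaled_weak_deriv\<close>.
\<close>

lemma hardy_inequality:
  assumes p: "1 < p" and fg: "has_weak_deriv 1 f (\<lambda>r. g r / r)" and a: "a \<noteq> 0"
    and fin: "if 0 < a then log_energy p {0<..<1} f < \<infinity> else log_energy p {1..} f < \<infinity>"
  shows "ennreal (\<bar>a\<bar> powr p) * log_energy p {0<..} f \<le> log_energy p {0<..} (\<lambda>r. g r + a * f r)"
proof -
  let ?F = "\<lambda>r. r powr a * f r"
  let ?h = "\<lambda>r. g r + a * f r"
  let ?J = "\<lambda>w S. \<integral>\<^sup>+t\<in>S. ennreal \<bar>t powr (a - 1) * w t\<bar> \<partial>lborel"
  note W = has_weak_deriv_powr_mult[OF fg, of a]
  obtain N where N: "N \<in> null_sets lborel" and inc: "\<And>x y. x \<notin> N \<Longrightarrow> y \<notin> N \<Longrightarrow> 0 < x \<Longrightarrow> x \<le> y \<Longrightarrow>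
      ennreal \<bar>?F y - ?F x\<bar> \<le> ?J ?h {x..y}"
    using weak_deriv_increment[OF W] by blast
  have "locally_integrable (\<lambda>r. r powr (a - 1) * ?h r)" using W by (simp add: has_weak_deriv_def)
  then have "locally_integrable (\<lambda>r. r powr (1 - a) * (r powr (a - 1) * ?h r))"
    by (rule locally_integrable_mult) (auto intro!: continuous_intros)
  then have "locally_integrable ?h"
    by (rule locally_integrable_cong) (auto simp flip: powr_add mult.assoc)
  then obtain h0 where h0: "h0 \<in> borel_measurable borel" "AE r in lborel. 0 < r \<longrightarrow> ?h r = h0 r"
    using locally_integrable_borel_version by blast
  have e: "log_energy p {0<..} ?h = log_energy p {0<..} h0"
    using h0(2) by (intro log_energy_cong_AE) (auto elim: eventually_mono)
  have c: "?J ?h S = ?J h0 S"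
    if "S \<subseteq> {0<..}" for S
  proof (rule nn_integral_cong_AE)
    show "AE t in lborel. ennreal \<bar>t powr (a - 1) * ?h t\<bar> * indicator S t
       = ennreal \<bar>t powr (a - 1) * h0 t\<bar> * indicator S t"
      using h0(2) by eventually_elim (use that in \<open>auto simp: indicator_def\<close>)
  qed
  show ?thesis
  proof (cases "0 < a")
    case True
    have "ennreal \<bar>?F y\<bar> \<le> ?J h0 {0<..y}"
      if y: "0 < y" "y \<notin> N" for y
    proof (rule abs_le_if_close_to_small)
      fix \<epsilon> :: real assume "0 < \<epsilon>"
      then obtain x where x: "0 < x" "x < y" "x \<notin> N" "\<bar>f x\<bar> < \<epsilon> / y powr a"
        using small_value_near_0[of p f N "\<epsilon> / y powr a" y] fin True N p y by auto
      have "\<bar>?F x\<bar> \<le> y powr a * \<bar>f x\<bar>"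
        using x True by (auto simp: abs_mult intro!: mult_right_mono powr_mono2)
      also have "\<dots> < \<epsilon>" using x(4) y by (simp add: field_simps)
      finally have "\<bar>?F x\<bar> < \<epsilon>" .
      moreover have "ennreal \<bar>?F y - ?F x\<bar> \<le> ?J h0 {0<..y}"
      proof -
        have "ennreal \<bar>?F y - ?F x\<bar> \<le> ?J ?h {x..y}"
          using inc x y by simp
        also have "\<dots> \<le> ?J ?h {0<..y}"
          using x by (intro nn_integral_mono mult_left_mono) (auto simp: indicator_def)
        also have "\<dots> = ?J h0 {0<..y}" by (rule c) auto
        finally show ?thesis .
      qed
      ultimately show "\<exists>Fx. \<bar>Fx\<bar> < \<epsilon> \<and> ennreal \<bar>?F y - Fx\<bar> \<le> ?J h0 {0<..y}"
        by blast
    qed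
    then have "AE y in lborel. 0 < y \<longrightarrow> ennreal \<bar>?F y\<bar> \<le> ?J h0 {0<..y}"
      using AE_not_in[OF N] by (auto elim: eventually_mono)
    from hardy_kernel_pos[OF p True h0(1) this] show ?thesis using True e by simp
  next
    case False
    define b where "b = - a"
    have b: "0 < b" "a = - b" using a False by (auto simp: b_def)
    have "ennreal \<bar>?F y\<bar> \<le> ?J h0 {y..}"
      if y: "0 < y" "y \<notin> N" for y
    proof (rule abs_le_if_close_to_small)
      fix \<epsilon> :: real assume "0 < \<epsilon>"
      then obtain x where x: "y < x" "x \<notin> N" "\<bar>f x\<bar> < \<epsilon> / y powr a"
        using small_value_near_infinity[of p f N "\<epsilon> / y powr a" y] fin False N p y by auto
      have "\<bar>?F x\<bar> \<le> y powr a * \<bar>f x\<bar>"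
        using x b y by (auto simp: abs_mult intro!: mult_right_mono powr_mono2')
      also have "\<dots> < \<epsilon>" using x(3) y by (simp add: field_simps)
      finally have "\<bar>?F x\<bar> < \<epsilon>" .
      moreover have "ennreal \<bar>?F y - ?F x\<bar> \<le> ?J h0 {y..}"
      proof -
        have "ennreal \<bar>?F x - ?F y\<bar> \<le> ?J ?h {y..x}"
          using inc[of y x] x y by simp
        also have "\<dots> \<le> ?J ?h {y..}"
          using x by (intro nn_integral_mono mult_left_mono) (auto simp: indicator_def)
        also have "\<dots> = ?J h0 {y..}" by (rule c) (use y in auto)
        finally show ?thesis by (simp only: abs_minus_commute)
      qed
      ultimately show "\<exists>Fx. \<bar>Fx\<bar> < \<epsilon> \<and> ennreal \<bar>?F y - Fx\<bar> \<le> ?J h0 {y..}"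
        by blast
    qed
    then have "AE y in lborel. 0 < y \<longrightarrow> ennreal \<bar>?F y\<bar> \<le> ?J h0 {y..}"
      using AE_not_in[OF N] by (auto elim: eventually_mono)
    then have "AE y in lborel. 0 < y \<longrightarrow> ennreal \<bar>y powr (- b) * f y\<bar> \<le> (\<integral>\<^sup>+t\<in>{y..}. ennreal \<bar>t powr (- b - 1) * h0 t\<bar> \<partial>lborel)"
      by (simp only: b(2))
    from hardy_kernel_neg[OF p b(1) h0(1) this] show ?thesis using b e by simp
  qed
qed

section \<open>The operator \<open>L\<close> in terms of the Euler operator\<close>

lemma locally_integrable_borel_versionE:
  assumes "locally_integrable f"
  obtains f0 where "f0 \<in> borel_measurable borel" "AE r in lborel. 0 < r \<longrightarrow> f r = f0 r"
  using locally_integrable_borel_version[OF assms] by blast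

lemma log_energy_lincomb_finite:
  assumes p: "0 < p" and fg: "locally_integrable f" "locally_integrable g"
    and fin: "log_energy p {0<..} f < \<infinity>" "log_energy p {0<..} g < \<infinity>"
  shows "log_energy p {0<..} (\<lambda>r. c * f r + d * g r) < \<infinity>"
proof -
  obtain f0 where f0[measurable]: "f0 \<in> borel_measurable borel" and f: "AE r in lborel. 0 < r \<longrightarrow> f r = f0 r"
    using locally_integrable_borel_versionE[OF fg(1)] .
  obtain g0 where g0[measurable]: "g0 \<in> borel_measurable borel" and g: "AE r in lborel. 0 < r \<longrightarrow> g r = g0 r"
    using locally_integrable_borel_versionE[OF fg(2)] .
  have fin0: "log_energy p {0<..} f0 < \<infinity>" "log_energy p {0<..} g0 < \<infinity>"
  proof -
    have "log_energy p {0<..} f = log_energy p {0<..} f0"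
      by (rule log_energy_cong_AE) (use f in \<open>auto elim: eventually_mono\<close>)
    moreover have "log_energy p {0<..} g = log_energy p {0<..} g0"
      by (rule log_energy_cong_AE) (use g in \<open>auto elim: eventually_mono\<close>)
    ultimately show "log_energy p {0<..} f0 < \<infinity>" "log_energy p {0<..} g0 < \<infinity>" using fin by simp_all
  qed
  define C where "C = (2 * \<bar>c\<bar>) powr p"
  define D where "D = (2 * \<bar>d\<bar>) powr p"
  have bound: "\<bar>c * x + d * y\<bar> powr p \<le> C * \<bar>x\<bar> powr p + D * \<bar>y\<bar> powr p" for x y
  proof -
    have "\<bar>c * x + d * y\<bar> \<le> \<bar>c\<bar> * \<bar>x\<bar> + \<bar>d\<bar> * \<bar>y\<bar>"
      using abs_triangle_ineq[of "c * x" "d * y"] by (simp add: abs_mult)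
    also have "\<dots> \<le> max (2 * \<bar>c\<bar> * \<bar>x\<bar>) (2 * \<bar>d\<bar> * \<bar>y\<bar>)" by linarith
    finally have "\<bar>c * x + d * y\<bar> powr p \<le> (max (2 * \<bar>c\<bar> * \<bar>x\<bar>) (2 * \<bar>d\<bar> * \<bar>y\<bar>)) powr p"
      using p by (intro powr_mono2) auto
    also have "\<dots> \<le> (2 * \<bar>c\<bar> * \<bar>x\<bar>) powr p + (2 * \<bar>d\<bar> * \<bar>y\<bar>) powr p"
      by (simp add: max_def)
    also have "\<dots> = C * \<bar>x\<bar> powr p + D * \<bar>y\<bar> powr p" by (simp add: C_def D_def powr_mult)
    finally show ?thesis .
  qed
  have "log_energy p {0<..} (\<lambda>r. c * f r + d * g r)
      \<le> (\<integral>\<^sup>+r. ennreal C * (ennreal (\<bar>f0 r\<bar> powr p / r) * indicator {0<..} r)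
             + ennreal D * (ennreal (\<bar>g0 r\<bar> powr p / r) * indicator {0<..} r) \<partial>lborel)"
    unfolding log_energy_def
  proof (rule nn_integral_mono_AE)
    show "AE r in lborel. ennreal (\<bar>c * f r + d * g r\<bar> powr p / r) * indicator {0<..} r
       \<le> ennreal C * (ennreal (\<bar>f0 r\<bar> powr p / r) * indicator {0<..} r)
             + ennreal D * (ennreal (\<bar>g0 r\<bar> powr p / r) * indicator {0<..} r)"
      using f g
    proof eventually_elim
      case (elim r)
      show ?case
      proof (cases "0 < r")
        case True
        have "\<bar>c * f r + d * g r\<bar> powr p / r \<le> (C * \<bar>f0 r\<bar> powr p + D * \<bar>g0 r\<bar> powr p) / r"
          using bound[of "f r" "g r"] True elim by (intro divide_right_mono) auto
        also have "\<dots> = C * (\<bar>f0 r\<bar> powr p / r) + D * (\<bar>g0 r\<bar> powr p / r)" by (simp add: add_divide_distrib)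
        finally have "ennreal (\<bar>c * f r + d * g r\<bar> powr p / r)
            \<le> ennreal (C * (\<bar>f0 r\<bar> powr p / r) + D * (\<bar>g0 r\<bar> powr p / r))" by (rule ennreal_leI)
        also have "\<dots> = ennreal C * ennreal (\<bar>f0 r\<bar> powr p / r) + ennreal D * ennreal (\<bar>g0 r\<bar> powr p / r)"
        proof -
          have "0 \<le> C" "0 \<le> D" "0 \<le> \<bar>f0 r\<bar> powr p / r" "0 \<le> \<bar>g0 r\<bar> powr p / r"
            using True by (auto simp: C_def D_def)
          then show ?thesis by (simp only: ennreal_plus ennreal_mult mult_nonneg_nonneg)
        qed
        finally show ?thesis using True by simp
      qed simp
    qed
  qed
  also have "\<dots> = ennreal C * log_energy p {0<..} f0 + ennreal D * log_energy p {0<..} g0"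
    unfolding log_energy_def by (simp add: nn_integral_add nn_integral_cmult)
  also have "\<dots> < \<infinity>" using fin0 by (simp add: ennreal_mult_less_top)
  finally show ?thesis .
qed

lemma locally_integrable_cmult: "locally_integrable u \<Longrightarrow> locally_integrable (\<lambda>r. c * u r)"
  by (auto simp: locally_integrable_def)

lemma has_weak_deriv_lincomb:
  assumes "has_weak_deriv 1 u v" "has_weak_deriv 1 u' v'"
  shows "has_weak_deriv 1 (\<lambda>r. c * u r + d * u' r) (\<lambda>r. c * v r + d * v' r)"
proof -
  have li: "locally_integrable u" "locally_integrable v" "locally_integrable u'" "locally_integrable v'"
    using assms by (auto simp: has_weak_deriv_def)
  have lin: "(LINT r:{0<..}|lebesgue. (c * x r + d * y r) * \<phi> r)
      = c * (LINT r:{0<..}|lebesgue. x r * \<phi> r) + d * (LINT r:{0<..}|lebesgue. y r * \<phi> r)"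
    if "locally_integrable x" "locally_integrable y" "test_function \<phi>" for x y \<phi>
  proof -
    have "(LINT r:{0<..}|lebesgue. (c * x r + d * y r) * \<phi> r)
       = (LINT r:{0<..}|lebesgue. c * (x r * \<phi> r) + d * (y r * \<phi> r))"
      by (simp add: algebra_simps)
    also have "\<dots> = (LINT r:{0<..}|lebesgue. c * (x r * \<phi> r)) + (LINT r:{0<..}|lebesgue. d * (y r * \<phi> r))"
      using test_integrable[OF that(1,3)] test_integrable[OF that(2,3)]
      by (intro set_integral_add) auto
    finally show ?thesis by simp
  qed
  show ?thesis
    using assms li by (auto simp: has_weak_deriv_def lin test_function_deriv
        intro!: locally_integrable_add locally_integrable_cmult)
qed

text \<open>
  Membership in the Sobolev space of order \<open>n\<close> of \<open>D = r d/dr\<close> on \<open>L\<^sup>p(dr/r)\<close>. The case \<open>0\<close> includes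
  local integrability, which in the other cases is part of the existence of a weak derivative.
\<close>

primrec log_sobolev :: "real \<Rightarrow> nat \<Rightarrow> (real \<Rightarrow> real) \<Rightarrow> bool" where
  "log_sobolev p 0 f \<longleftrightarrow> locally_integrable f \<and> log_energy p {0<..} f < \<infinity>"
| "log_sobolev p (Suc n) f \<longleftrightarrow> log_energy p {0<..} f < \<infinity> \<and>
     (\<exists>g. has_weak_deriv 1 f (\<lambda>r. g r / r) \<and> log_sobolev p n g)"

lemma log_sobolev_energy: "log_sobolev p n f \<Longrightarrow> log_energy p {0<..} f < \<infinity>"
  by (cases n) auto

lemma log_sobolev_locally_integrable: "log_sobolev p n f \<Longrightarrow> locally_integrable f"
  by (cases n) (auto simp: has_weak_deriv_def)

lemma log_sobolev_lincomb:
  assumes "0 < p"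
  shows "log_sobolev p n f \<Longrightarrow> log_sobolev p n g \<Longrightarrow> log_sobolev p n (\<lambda>r. c * f r + d * g r)"
proof (induction n arbitrary: f g)
  case 0
  then show ?case using assms unfolding log_sobolev.simps
    by (intro conjI locally_integrable_add locally_integrable_cmult log_energy_lincomb_finite) blast+
next
  case (Suc n)
  obtain f' where f': "has_weak_deriv 1 f (\<lambda>r. f' r / r)" "log_sobolev p n f'" using Suc by auto
  obtain g' where g': "has_weak_deriv 1 g (\<lambda>r. g' r / r)" "log_sobolev p n g'" using Suc by auto
  have "has_weak_deriv 1 (\<lambda>r. c * f r + d * g r) (\<lambda>r. (c * f' r + d * g' r) / r)"
    using has_weak_deriv_lincomb[OF f'(1) g'(1), of c d] by (simp add: add_divide_distrib)
  moreover have "log_sobolev p n (\<lambda>r. c * f' r + d * g' r)" using Suc.IH f' g' by blast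
  moreover have "log_energy p {0<..} (\<lambda>r. c * f r + d * g r) < \<infinity>"
    by (intro log_energy_lincomb_finite assms log_sobolev_locally_integrable[OF Suc.prems(1)]
        log_sobolev_locally_integrable[OF Suc.prems(2)] log_sobolev_energy[OF Suc.prems(1)]
        log_sobolev_energy[OF Suc.prems(2)])
  ultimately show ?case unfolding log_sobolev.simps
    by (intro conjI exI[of _ "\<lambda>r. c * f' r + d * g' r"])
qed

lemma log_sobolev_Suc_imp: "log_sobolev p (Suc n) f \<Longrightarrow> log_sobolev p n f"
  by (induction n arbitrary: f) (auto simp: has_weak_deriv_def)

text \<open>
  If \<open>D f = c f + h\<close>, then \<open>f\<close> has one derivative more than \<open>h\<close>, by bootstrapping from \<open>f\<close> in \<open>L\<^sup>p(dr/r)\<close>.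
\<close>

lemma log_sobolev_if_euler_equation:
  assumes p: "0 < p" and f: "has_weak_deriv 1 f (\<lambda>r. (c * f r + h r) / r)" "log_energy p {0<..} f < \<infinity>"
  shows "log_sobolev p n h \<Longrightarrow> log_sobolev p (Suc n) f"
proof (induction n)
  case 0
  have "log_sobolev p 0 f" using f by (auto simp: has_weak_deriv_def)
  from log_sobolev_lincomb[OF p this 0, of c 1] show ?case using f by auto
next
  case (Suc n)
  have "log_sobolev p (Suc n) f" using Suc log_sobolev_Suc_imp by blast
  from log_sobolev_lincomb[OF p this Suc.prems, of c 1] have "log_sobolev p (Suc n) (\<lambda>r. c * f r + h r)" by simp
  then show ?case using f unfolding log_sobolev.simps(2)[of p "Suc n"]
    by (intro conjI exI[of _ "\<lambda>r. c * f r + h r"])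
qed

lemma hardy_log_sobolev:
  assumes p: "1 < p" and a: "a \<noteq> 0" and fg: "has_weak_deriv 1 f (\<lambda>r. g r / r)" and f: "log_sobolev p n f"
  shows "ennreal (\<bar>a\<bar> powr p) * log_energy p {0<..} f \<le> log_energy p {0<..} (\<lambda>r. g r + a * f r)"
proof (rule hardy_inequality[OF p fg a])
  have "log_energy p S f < \<infinity>" if "S \<subseteq> {0<..}" for S
  proof -
    have "log_energy p S f \<le> log_energy p {0<..} f"
      unfolding log_energy_def using that by (intro nn_integral_mono) (auto simp: indicator_def)
    then show ?thesis using log_sobolev_energy[OF f] by simp
  qed
  from this[of "{0<..<1}"] this[of "{1..}"]
  show "if 0 < a then log_energy p {0<..<1} f < \<infinity> else log_energy p {1..} f < \<infinity>" by (auto simp: subset_eq)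
qed

text \<open>
  The two halves of the factorisation \<open>L (r\<^sup>-\<^sup>b q) = - r\<^sup>-\<^sup>b\<^sup>-\<^sup>\<delta> (D + \<gamma> - 1 - b) (D - b) q\<close>, with
  \<open>e = (D - b) q\<close>. The sign \<open>\<sigma>\<close> is carried along because \<open>L\<close> changes it.
\<close>

lemma op_L_step:
  assumes w: "AE r in lborel. 0 < r \<longrightarrow> w r = \<sigma> * r powr (- b) * q r"
    and q: "has_weak_deriv 1 q (\<lambda>r. (e r + b * q r) / r)"
  shows "AE r in lborel. 0 < r \<longrightarrow> weak_deriv w r = \<sigma> * r powr (- b - 1) * e r"
    and "has_weak_deriv 1 e (\<lambda>r. e' r / r) \<Longrightarrow>
      AE r in lborel. 0 < r \<longrightarrow> op_L \<theta> \<gamma> w r = (- \<sigma>) * r powr (- (b + (\<theta> + 2 - \<gamma>))) * (e' r + (\<gamma> - 1 - b) * e r)"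
proof -
  have "has_weak_deriv 1 (\<lambda>r. \<sigma> * (r powr (- b) * q r) + 0 * (r powr (- b) * q r))
      (\<lambda>r. \<sigma> * (r powr (- b - 1) * (e r + b * q r + (- b) * q r)) + 0 * (r powr (- b - 1) * (e r + b * q r + (- b) * q r)))"
    by (intro has_weak_deriv_lincomb has_weak_deriv_powr_mult q)
  then have "has_weak_deriv 1 w (\<lambda>r. \<sigma> * r powr (- b - 1) * e r)"
    by (rule has_weak_deriv_cong) (use w in \<open>auto elim: eventually_mono simp: mult.assoc\<close>)
  then show *: "AE r in lborel. 0 < r \<longrightarrow> weak_deriv w r = \<sigma> * r powr (- b - 1) * e r"
    by (rule weak_deriv_AE)
  assume e: "has_weak_deriv 1 e (\<lambda>r. e' r / r)"
  let ?c = "\<gamma> - 1 - b"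
  let ?d = "\<lambda>r. r powr (?c - 1) * (e' r + ?c * e r)"
  have "has_weak_deriv 1 (\<lambda>r. \<sigma> * (r powr ?c * e r) + 0 * (r powr ?c * e r)) (\<lambda>r. \<sigma> * ?d r + 0 * ?d r)"
    by (intro has_weak_deriv_lincomb has_weak_deriv_powr_mult e)
  then have "has_weak_deriv 1 (\<lambda>s. s powr \<gamma> * weak_deriv w s) (\<lambda>r. \<sigma> * ?d r)"
  proof (rule has_weak_deriv_cong)
    show "AE r in lborel. 0 < r \<longrightarrow> \<sigma> * (r powr ?c * e r) + 0 * (r powr ?c * e r) = r powr \<gamma> * weak_deriv w r"
      using *
    proof (eventually_elim, intro impI)
      fix r :: real assume "0 < r \<longrightarrow> weak_deriv w r = \<sigma> * r powr (- b - 1) * e r" "0 < r"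
      then have "r powr \<gamma> * weak_deriv w r = \<sigma> * ((r powr \<gamma> * r powr (- b - 1)) * e r)" by simp
      also have "r powr \<gamma> * r powr (- b - 1) = r powr ?c" by (simp flip: powr_add add: algebra_simps)
      finally show "\<sigma> * (r powr ?c * e r) + 0 * (r powr ?c * e r) = r powr \<gamma> * weak_deriv w r" by simp
    qed
  qed auto
  from weak_deriv_AE[OF this]
  show "AE r in lborel. 0 < r \<longrightarrow> op_L \<theta> \<gamma> w r = (- \<sigma>) * r powr (- (b + (\<theta> + 2 - \<gamma>))) * (e' r + ?c * e r)"
  proof (eventually_elim, intro impI)
    fix r :: real assume *: "0 < r \<longrightarrow> weak_deriv (\<lambda>s. s powr \<gamma> * weak_deriv w s) r = \<sigma> * ?d r" "0 < r"
    have "op_L \<theta> \<gamma> w r = (- \<sigma>) * ((r powr (- \<theta>) * r powr (?c - 1)) * (e' r + ?c * e r))"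
      using * by (simp add: op_L_def)
    also have "r powr (- \<theta>) * r powr (?c - 1) = r powr (- (b + (\<theta> + 2 - \<gamma>)))"
      by (simp flip: powr_add add: algebra_simps)
    finally show "op_L \<theta> \<gamma> w r = (- \<sigma>) * r powr (- (b + (\<theta> + 2 - \<gamma>))) * (e' r + ?c * e r)" by simp
  qed
qed

text \<open>
  In this invariant, \<open>L\<^sup>j u\<close> is \<open>r\<^sup>-\<^sup>j\<^sup>\<delta> q\<close> up to sign and \<open>e = (D - j \<delta>) q\<close>. The energy is tracked for \<open>e\<close> and not
  for \<open>q\<close>, since for \<open>j = 0\<close> the function \<open>q = u\<close> need not have finite energy whereas \<open>e = D u\<close> has.
  Each application of \<open>L\<close> costs two orders of differentiability and contributes two Hardy factors.
\<close>

lemma nabla_L_chain: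
  fixes u v :: "real \<Rightarrow> real" and \<theta> \<gamma> :: real
  defines "\<delta> \<equiv> \<theta> + 2 - \<gamma>"
  assumes p: "1 < p" and \<delta>: "0 < \<delta>"
    and uv: "has_weak_deriv 1 u v" and v: "log_sobolev p (n + 2 * j) (\<lambda>r. r * v r)"
    and pos: "\<And>i. i < j \<Longrightarrow> real i * \<delta> < \<gamma> - 1"
  shows "\<exists>q e \<sigma>. \<bar>\<sigma>\<bar> = 1 \<and> (AE r in lborel. 0 < r \<longrightarrow> (op_L \<theta> \<gamma> ^^ j) u r = \<sigma> * r powr (- (real j * \<delta>)) * q r)
    \<and> has_weak_deriv 1 q (\<lambda>r. (e r + real j * \<delta> * q r) / r) \<and> log_sobolev p n e
    \<and> ennreal ((\<Prod>i<j. (\<gamma> - 1 - real i * \<delta>) * (real (Suc i) * \<delta>)) powr p) * log_energy p {0<..} (\<lambda>r. r * v r)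
      \<le> log_energy p {0<..} e"
  using v pos
proof (induction j arbitrary: n)
  case 0
  have "has_weak_deriv 1 u (\<lambda>r. r * v r / r)"
    by (rule has_weak_deriv_cong[OF uv]) auto
  then show ?case using 0 by (intro exI[of _ u] exI[of _ "\<lambda>r. r * v r"] exI[of _ 1]) auto
next
  case (Suc j)
  let ?c = "\<Prod>i<j. (\<gamma> - 1 - real i * \<delta>) * (real (Suc i) * \<delta>)"
  let ?a = "\<gamma> - 1 - real j * \<delta>"
  let ?b = "real (Suc j) * \<delta>"
  have p0: "0 < p" using p by simp
  have a: "0 < ?a" using Suc.prems(2)[of j] by simp
  have b: "0 < ?b" using \<delta> by simp
  have c: "0 \<le> ?c" using Suc.prems(2) \<delta> by (intro prod_nonneg mult_nonneg_nonneg) (auto simp: less_imp_le)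
  have "log_sobolev p (Suc (Suc n) + 2 * j) (\<lambda>r. r * v r)" using Suc.prems(1) by (simp del: log_sobolev.simps)
  from Suc.IH[OF this] Suc.prems(2) obtain q e \<sigma> where \<sigma>: "\<bar>\<sigma>\<bar> = 1"
    and w: "AE r in lborel. 0 < r \<longrightarrow> (op_L \<theta> \<gamma> ^^ j) u r = \<sigma> * r powr (- (real j * \<delta>)) * q r"
    and q: "has_weak_deriv 1 q (\<lambda>r. (e r + real j * \<delta> * q r) / r)" and e: "log_sobolev p (Suc (Suc n)) e"
    and N: "ennreal (?c powr p) * log_energy p {0<..} (\<lambda>r. r * v r) \<le> log_energy p {0<..} e"
    by (auto simp del: log_sobolev.simps)
  obtain e' where e': "has_weak_deriv 1 e (\<lambda>r. e' r / r)" "log_sobolev p (Suc n) e'"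
    using e unfolding log_sobolev.simps(2)[of p "Suc n"] by blast
  define q2 where "q2 r = e' r + ?a * e r" for r
  have q2: "log_sobolev p (Suc n) q2"
    using log_sobolev_lincomb[OF p0 e'(2) log_sobolev_Suc_imp[OF e], of 1 ?a] by (simp add: q2_def[abs_def] del: log_sobolev.simps)
  obtain q2' where q2': "has_weak_deriv 1 q2 (\<lambda>r. q2' r / r)" "log_sobolev p n q2'"
    using q2 unfolding log_sobolev.simps(2)[of p n] by blast
  define e2 where "e2 r = q2' r + (- ?b) * q2 r" for r
  have e2: "log_sobolev p n e2"
    using log_sobolev_lincomb[OF p0 q2'(2) log_sobolev_Suc_imp[OF q2], of 1 "- ?b"] by (simp add: e2_def[abs_def])
  have 1: "AE r in lborel. 0 < r \<longrightarrow> (op_L \<theta> \<gamma> ^^ Suc j) u r = (- \<sigma>) * r powr (- (real (Suc j) * \<delta>)) * q2 r"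
  proof -
    have "real j * \<delta> + (\<theta> + 2 - \<gamma>) = real (Suc j) * \<delta>" by (simp add: \<delta>_def algebra_simps)
    then show ?thesis using op_L_step(2)[OF w q e'(1), of \<theta> \<gamma>] by (simp add: q2_def)
  qed
  have 2: "has_weak_deriv 1 q2 (\<lambda>r. (e2 r + real (Suc j) * \<delta> * q2 r) / r)"
    using q2'(1) by (simp add: e2_def)
  have N1: "ennreal (\<bar>?a\<bar> powr p) * log_energy p {0<..} e \<le> log_energy p {0<..} q2"
    unfolding q2_def[abs_def] by (rule hardy_log_sobolev[OF p _ e'(1) e]) (use a in simp)
  have N2: "ennreal (\<bar>- ?b\<bar> powr p) * log_energy p {0<..} q2 \<le> log_energy p {0<..} e2"
    unfolding e2_def[abs_def] by (rule hardy_log_sobolev[OF p _ q2'(1) q2]) (use \<delta> in simp)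
  have "(\<Prod>i<Suc j. (\<gamma> - 1 - real i * \<delta>) * (real (Suc i) * \<delta>)) = \<bar>- ?b\<bar> * (\<bar>?a\<bar> * ?c)"
    using a b by simp
  then have "ennreal ((\<Prod>i<Suc j. (\<gamma> - 1 - real i * \<delta>) * (real (Suc i) * \<delta>)) powr p)
      = ennreal (\<bar>- ?b\<bar> powr p) * (ennreal (\<bar>?a\<bar> powr p) * ennreal (?c powr p))"
    using c by (simp only: powr_mult abs_ge_zero mult_nonneg_nonneg ennreal_mult' powr_ge_zero)
  then have "ennreal ((\<Prod>i<Suc j. (\<gamma> - 1 - real i * \<delta>) * (real (Suc i) * \<delta>)) powr p) * log_energy p {0<..} (\<lambda>r. r * v r)
      = ennreal (\<bar>- ?b\<bar> powr p) * (ennreal (\<bar>?a\<bar> powr p) * (ennreal (?c powr p) * log_energy p {0<..} (\<lambda>r. r * v r)))"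
    by (simp only: mult.assoc)
  also have "\<dots> \<le> ennreal (\<bar>- ?b\<bar> powr p) * (ennreal (\<bar>?a\<bar> powr p) * log_energy p {0<..} e)"
    by (intro mult_left_mono N) auto
  also have "\<dots> \<le> ennreal (\<bar>- ?b\<bar> powr p) * log_energy p {0<..} q2"
    by (intro mult_left_mono N1) auto
  also have "\<dots> \<le> log_energy p {0<..} e2" by (rule N2)
  finally have 3: "ennreal ((\<Prod>i<Suc j. (\<gamma> - 1 - real i * \<delta>) * (real (Suc i) * \<delta>)) powr p) * log_energy p {0<..} (\<lambda>r. r * v r)
      \<le> log_energy p {0<..} e2" .
  show ?case
    by (intro exI[of _ q2] exI[of _ e2] exI[of _ "- \<sigma>"] conjI 1 2 3 e2) (use \<sigma> in simp)
qed

section \<open>The constant \<open>\<beta>\<^sub>0\<close> and the gradient bound\<close>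

lemma Gamma_plus1_pos: "0 < x \<Longrightarrow> Gamma (x + 1) = x * Gamma x" for x :: real
  using nonpos_Ints_nonpos[of x] by (intro Gamma_plus1) auto

text \<open>
  With \<open>x = G / \<delta>\<close> the factors are \<open>\<delta> (x - i)\<close> and \<open>\<delta> (i + 1)\<close>, and both products telescope by the
  functional equation of the Gamma function. The factor \<open>G \<delta>\<^sup>-\<^sup>1 = x\<close> makes the empty product come out as \<open>1\<close>.
\<close>

lemma hardy_product_eq_Gamma:
  fixes G \<delta> :: real
  assumes \<delta>: "0 < \<delta>" and G: "0 < G" and pos: "\<And>i. i < j \<Longrightarrow> real i * \<delta> < G"
  shows "(\<Prod>i<j. (G - real i * \<delta>) * (real (Suc i) * \<delta>))
    = G * \<delta> powi (2 * int j - 1) * (Gamma (real j + 1) * Gamma (G / \<delta>) / Gamma (G / \<delta> - real j + 1))"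
  using pos
proof (induction j)
  case 0
  have "Gamma (G / \<delta> + 1) = G / \<delta> * Gamma (G / \<delta>)"
    using \<delta> G by (intro Gamma_plus1_pos) auto
  moreover have "Gamma (G / \<delta>) \<noteq> 0" using \<delta> G by (intro less_imp_neq[symmetric] Gamma_real_pos) auto
  ultimately show ?case using \<delta> G by (simp add: power_int_minus)
next
  case (Suc j)
  have x: "0 < G / \<delta> - real j" using Suc.prems[of j] \<delta> by (simp add: field_simps)
  have 1: "Gamma (G / \<delta> - real j + 1) = (G / \<delta> - real j) * Gamma (G / \<delta> - real j)"
    using x by (rule Gamma_plus1_pos)
  have 2: "Gamma (real (Suc j) + 1) = (real j + 1) * Gamma (real j + 1)"
    using Gamma_plus1_pos[of "real j + 1"] by (simp add: add_ac)
  have 3: "\<delta> powi (2 * int (Suc j) - 1) = \<delta> powi (2 * int j - 1) * \<delta> * \<delta>"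
    using \<delta> power_int_add[of \<delta> "2 * int j - 1" 2] by (simp add: algebra_simps power2_eq_square)
  have g: "Gamma (G / \<delta> - real j) > 0" using x by (rule Gamma_real_pos)
  have 4: "G - real j * \<delta> = \<delta> * (G / \<delta> - real j)" using \<delta> by (simp add: field_simps)
  have "(\<Prod>i<Suc j. (G - real i * \<delta>) * (real (Suc i) * \<delta>))
     = G * \<delta> powi (2 * int j - 1) * (Gamma (real j + 1) * Gamma (G / \<delta>) / Gamma (G / \<delta> - real j + 1))
       * (\<delta> * (G / \<delta> - real j) * ((real j + 1) * \<delta>))"
    using Suc by (simp add: 4 add_ac)
  also have "\<dots> = G * (\<delta> powi (2 * int j - 1) * \<delta> * \<delta>) * ((real j + 1) * Gamma (real j + 1) * Gamma (G / \<delta>)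
      * ((G / \<delta> - real j) / ((G / \<delta> - real j) * Gamma (G / \<delta> - real j))))"
    unfolding 1 by (simp only: times_divide_eq_left times_divide_eq_right mult_ac)
  also have "(G / \<delta> - real j) / ((G / \<delta> - real j) * Gamma (G / \<delta> - real j)) = 1 / Gamma (G / \<delta> - real j)"
    using x by simp
  finally show ?case unfolding 2 3 by simp
qed

lemma log_sobolev_cong:
  assumes f: "log_sobolev p n f" and eq: "\<And>r. 0 < r \<Longrightarrow> f r = g r"
  shows "log_sobolev p n g"
proof -
  have e: "log_energy p {0<..} g = log_energy p {0<..} f"
    by (rule log_energy_cong_AE) (use eq in auto)
  have AE: "AE r in lborel. 0 < r \<longrightarrow> f r = g r" using eq by auto
  show ?thesis
  proof (cases n)
    case 0
    then show ?thesis using f e locally_integrable_cong[OF _ AE] by simp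
  next
    case (Suc m)
    then obtain f' where f': "has_weak_deriv 1 f (\<lambda>r. f' r / r)" "log_sobolev p m f'" using f by auto
    have "has_weak_deriv 1 g (\<lambda>r. f' r / r)" by (rule has_weak_deriv_cong[OF f'(1) AE]) auto
    then show ?thesis using f' e f Suc by auto
  qed
qed

text \<open>
  The product of the absolute values of the constants \<open>a\<close> of the factors \<open>D + a\<close> that lead from \<open>D u\<close>
  to \<open>\<nabla>\<^sub>L\<^sup>k u\<close>: for odd \<open>k\<close> those of \<open>k div 2\<close> full steps of \<open>nabla_L_chain\<close>, for even \<open>k\<close> those of
  \<open>k div 2 - 1\<close> full steps and of the first half of another.
\<close>

definition hardy_product :: "nat \<Rightarrow> real \<Rightarrow> real \<Rightarrow> real" where
  "hardy_product k G \<delta> = (if even k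
     then (\<Prod>i<k div 2 - 1. (G - real i * \<delta>) * (real (Suc i) * \<delta>)) * (G - real (k div 2 - 1) * \<delta>)
     else (\<Prod>i<k div 2. (G - real i * \<delta>) * (real (Suc i) * \<delta>)))"

lemma beta0_eq_hardy_product:
  assumes k: "0 < k" and \<delta>: "0 < \<theta> + 2 - \<gamma>" and \<gamma>: "0 < \<gamma> - 1"
    and pos: "\<And>i. i < k div 2 \<Longrightarrow> real i * (\<theta> + 2 - \<gamma>) < \<gamma> - 1"
  shows "beta0 k p \<eta> \<gamma> \<theta> = (\<eta> + 1) * hardy_product k (\<gamma> - 1) (\<theta> + 2 - \<gamma>) powr (p / (p - 1))"
proof (cases "even k")
  case True
  define j where "j = k div 2 - 1"
  define G where "G = \<gamma> - 1"
  define d where "d = \<theta> + 2 - \<gamma>"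
  have kj: "k = 2 * (j + 1)" "k div 2 = Suc j" using True k by (auto simp: j_def elim!: evenE)
  have d0: "0 < d" and G0: "0 < G" using \<delta> \<gamma> by (auto simp: d_def G_def)
  have P: "(\<Prod>i<j. (G - real i * d) * (real (Suc i) * d))
    = G * d powi (2 * int j - 1) * (Gamma (real j + 1) * Gamma (G / d) / Gamma (G / d - real j + 1))"
    using pos kj by (intro hardy_product_eq_Gamma d0 G0) (auto simp: G_def d_def)
  have x: "0 < G / d - real j" using pos[of j] kj d0 by (simp add: field_simps G_def d_def)
  have 1: "Gamma (G / d - real j + 1) = (G / d - real j) * Gamma (G / d - real j)"
    using x by (rule Gamma_plus1_pos)
  have 3: "d powi (2 * int j) = d powi (2 * int j - 1) * d"
    using d0 power_int_add[of d "2 * int j - 1" 1] by simp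
  have 4: "G - real j * d = d * (G / d - real j)" using d0 by (simp add: field_simps)
  have "hardy_product k G d = G * d powi (2 * int j - 1) * (Gamma (real j + 1) * Gamma (G / d) / Gamma (G / d - real j + 1))
      * (d * (G / d - real j))"
    using True kj P 4 by (simp add: hardy_product_def)
  also have "\<dots> = G * (d powi (2 * int j - 1) * d) * (Gamma (real j + 1) * Gamma (G / d)
      * ((G / d - real j) / ((G / d - real j) * Gamma (G / d - real j))))"
    unfolding 1 by (simp only: times_divide_eq_left times_divide_eq_right mult_ac)
  also have "(G / d - real j) / ((G / d - real j) * Gamma (G / d - real j)) = 1 / Gamma (G / d - real j)"
    using x by simp
  finally have "hardy_product k G d = G * d powi (2 * int j) * (Gamma (real j + 1) * Gamma (G / d) / Gamma (G / d - real j))"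
    unfolding 3 by simp
  moreover have e: "int k - 2 = 2 * int j" "real k / 2 = real j + 1" "(real k - 2) / 2 = real j"
    using kj by auto
  ultimately show ?thesis using True unfolding beta0_def Let_def e G_def d_def by simp
next
  case False
  define j where "j = k div 2"
  have kj: "k = 2 * j + 1" using False by (auto simp: j_def elim!: oddE)
  have "hardy_product k (\<gamma> - 1) (\<theta> + 2 - \<gamma>) = (\<gamma> - 1) * (\<theta> + 2 - \<gamma>) powi (2 * int j - 1) *
    (Gamma (real j + 1) * Gamma ((\<gamma> - 1) / (\<theta> + 2 - \<gamma>)) / Gamma ((\<gamma> - 1) / (\<theta> + 2 - \<gamma>) - real j + 1))"
    using False hardy_product_eq_Gamma[OF \<delta> \<gamma> pos[folded j_def], of j]
    unfolding hardy_product_def j_def[symmetric] by simp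
  moreover have e: "int k - 2 = 2 * int j - 1" "(real k + 1) / 2 = real j + 1" "(real k - 3) / 2 = real j - 1"
    using kj by auto
  ultimately show ?thesis using False unfolding beta0_def Let_def e by (simp add: algebra_simps)
qed

abbreviation weighted_energy :: "real \<Rightarrow> real \<Rightarrow> (real \<Rightarrow> real) \<Rightarrow> ennreal" where
  "weighted_energy p a u \<equiv> \<integral>\<^sup>+r\<in>{0<..}. ennreal (\<bar>u r\<bar> powr p * r powr a) \<partial>lborel"

lemma wLp_norm_le_1_imp:
  assumes "wLp_norm p a f \<le> 1" "0 < p"
  shows "weighted_energy p a f \<le> 1"
proof -
  define I where "I = weighted_energy p a f"
  have n: "ennpowr I (1 / p) \<le> 1"
    using assms(1) by (simp add: wLp_norm_def I_def nn_integral_completion)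
  then have fin: "I \<noteq> top" by (auto simp: ennpowr_def top_unique)
  then have "ennreal (enn2real I powr (1 / p)) \<le> ennreal 1" using n by (simp add: ennpowr_def)
  then have "enn2real I powr (1 / p) \<le> 1" by (simp only: ennreal_le_iff zero_le_one)
  then have "enn2real I \<le> 1"
    using assms(2) powr_less_mono2[of "1 / p" 1 "enn2real I"] by (auto simp: not_less[symmetric])
  then show ?thesis using fin unfolding I_def[symmetric] by (metis ennreal_1 ennreal_enn2real ennreal_leI less_top)
qed

lemma wLp_imp_finite:
  assumes "f \<in> wLp p a"
  shows "weighted_energy p a f < \<infinity>"
  using assms by (auto simp: wLp_def wLp_norm_def ennpowr_def nn_integral_completion less_top split: if_splits)

text \<open>
  This is how the weights \<open>\<alpha>\<^sub>k\<close>, \<open>\<nu>\<close> and \<open>\<eta>\<close> are all reduced to the measure \<open>dr/r\<close>.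
\<close>

lemma log_energy_weight:
  assumes "AE r in lborel. 0 < r \<longrightarrow> \<bar>f r\<bar> = r powr (- c) * \<bar>e r\<bar>" "0 < p" "a = c * p - 1"
  shows "weighted_energy p a f = log_energy p {0<..} e"
  unfolding log_energy_def
proof (rule nn_integral_cong_AE)
  show "AE r in lborel. ennreal (\<bar>f r\<bar> powr p * r powr a) * indicator {0<..} r
     = ennreal (\<bar>e r\<bar> powr p / r) * indicator {0<..} r"
    using assms(1)
  proof eventually_elim
    case (elim r)
    show ?case
    proof (cases "0 < r")
      case True
      have "\<bar>f r\<bar> powr p * r powr a = \<bar>e r\<bar> powr p * (r powr (- c * p) * r powr (c * p - 1))"
        using elim True by (simp add: powr_mult powr_powr assms(3))
      also have "r powr (- c * p) * r powr (c * p - 1) = 1 / r"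
      proof -
        have "- c * p + (c * p - 1) = - 1" by simp
        then have "r powr (- c * p) * r powr (c * p - 1) = r powr (- 1)"
          by (simp only: powr_add[symmetric])
        then show ?thesis using True by (simp add: powr_minus_divide)
      qed
      finally show ?thesis by simp
    qed simp
  qed
qed

text \<open>
  The functions \<open>f\<^sub>i = r\<^sup>i u\<^sup>(\<^sup>i\<^sup>)\<close> satisfy \<open>D f\<^sub>i - i f\<^sub>i = f\<^sub>i\<^sub>+\<^sub>1\<close>. The weight \<open>\<alpha>\<^sub>k\<close> gives \<open>f\<^sub>k\<close> finite energy, and the
  lower bounds on the other weights give \<open>f\<^sub>i\<close> finite energy near infinity. Hardy's inequality with the
  negative exponent \<open>- i\<close> then yields finite energy of \<open>f\<^sub>i\<close> everywhere, by descent from \<open>i = k\<close> to \<open>i = 1\<close>.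
\<close>

lemma log_sobolev_scaled_weak_deriv:
  assumes p: "1 < p" and v: "\<And>i. i \<in> {1..k} \<Longrightarrow> has_weak_deriv i u (v i)" "\<And>i. i \<in> {1..k} \<Longrightarrow> v i \<in> wLp p (\<alpha> i)"
    and \<alpha>: "\<alpha> k - real k * p + 1 = 0" "\<And>i. i \<in> {1..k} \<Longrightarrow> \<alpha> k - (real k - real i) * p \<le> \<alpha> i"
  shows "n < k \<Longrightarrow> log_sobolev p n (\<lambda>r. r powr real (k - n) * v (k - n) r)"
proof (induction n)
  case 0
  have "weighted_energy p (\<alpha> k) (v k)
      = log_energy p {0<..} (\<lambda>r. r powr real k * v k r)"
    by (rule log_energy_weight[where c = "real k"])
       (use p \<alpha>(1) in \<open>auto simp: abs_mult simp flip: powr_add mult.assoc\<close>)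
  moreover have "weighted_energy p (\<alpha> k) (v k) < \<infinity>"
    using 0 by (intro wLp_imp_finite v) auto
  moreover have "locally_integrable (v k)" using v(1)[of k] 0 by (auto simp: has_weak_deriv_def)
  then have "locally_integrable (\<lambda>r. r powr real k * v k r)"
    by (rule locally_integrable_mult) (auto intro!: continuous_intros)
  ultimately show ?case by simp
next
  case (Suc n)
  define i where "i = k - Suc n"
  have i: "1 \<le> i" "k - n = Suc i" "Suc i \<le> k" using Suc.prems by (auto simp: i_def)
  let ?f = "\<lambda>r. r powr real i * v i r"
  let ?h = "\<lambda>r. r powr real (Suc i) * v (Suc i) r"
  have h: "log_sobolev p n ?h" using Suc i by simp
  have "has_weak_deriv 1 (v i) (v (Suc i))"
    using i by (intro has_weak_deriv_next[OF v(1)[of i] v(1)[of "Suc i"]]) auto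
  then have "has_weak_deriv 1 (v i) (\<lambda>r. r * v (Suc i) r / r)"
    by (rule has_weak_deriv_cong) auto
  from has_weak_deriv_powr_mult[OF this, of "real i"]
  have W: "has_weak_deriv 1 ?f (\<lambda>r. (real i * ?f r + ?h r) / r)"
  proof (rule has_weak_deriv_cong)
    show "AE r in lborel. 0 < r \<longrightarrow> r powr (real i - 1) * (r * v (Suc i) r + real i * v i r) = (real i * ?f r + ?h r) / r"
      by (intro AE_I2 impI) (auto simp: powr_diff powr_add field_simps)
  qed auto
  have fin: "log_energy p {1..} ?f < \<infinity>"
  proof -
    have "log_energy p {1..} ?f \<le> weighted_energy p (\<alpha> i) (v i)"
      unfolding log_energy_def
    proof (rule nn_integral_mono)
      fix r :: real
      show "ennreal (\<bar>r powr real i * v i r\<bar> powr p / r) * indicator {1..} r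
         \<le> ennreal (\<bar>v i r\<bar> powr p * r powr \<alpha> i) * indicator {0<..} r"
      proof (cases "1 \<le> r")
        case True
        have "\<alpha> k - (real k - real i) * p \<le> \<alpha> i" using \<alpha>(2)[of i] i by simp
        then have le: "real i * p - 1 \<le> \<alpha> i" using \<alpha>(1) by (simp add: algebra_simps)
        have "\<bar>r powr real i * v i r\<bar> powr p / r = \<bar>v i r\<bar> powr p * r powr (real i * p - 1)"
          using True by (simp add: abs_mult powr_mult powr_powr powr_diff)
        also have "\<dots> \<le> \<bar>v i r\<bar> powr p * r powr \<alpha> i"
          using True le by (intro mult_left_mono powr_mono) auto
        finally show ?thesis using True by (auto intro: ennreal_leI)
      qed simp
    qed
    also have "\<dots> < \<infinity>" using i by (intro wLp_imp_finite v) auto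
    finally show ?thesis .
  qed
  have "ennreal (\<bar>- real i\<bar> powr p) * log_energy p {0<..} ?f
      \<le> log_energy p {0<..} (\<lambda>r. real i * ?f r + ?h r + (- real i) * ?f r)"
    by (rule hardy_inequality[OF p W]) (use i fin in auto)
  also have "\<dots> = log_energy p {0<..} ?h" by simp
  also have "\<dots> < \<infinity>" using log_sobolev_energy[OF h] .
  finally have "ennreal (real i powr p) * log_energy p {0<..} ?f < \<infinity>" by simp
  then have "log_energy p {0<..} ?f < \<infinity>"
    using i p by (auto simp: ennreal_mult_less_top)
  from log_sobolev_if_euler_equation[OF _ W this h] p show ?case
    unfolding i_def[symmetric] by (simp del: log_sobolev.simps)
qed

text \<open>
  The Hardy-Rellich inequality behind the theorem: one Hardy factor for each first order operator
  in the factorisation of \<open>\<nabla>\<^sub>L\<^sup>k\<close>. For even \<open>k\<close> the last Hardy factor comes from the first half of a step of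
  the chain; for odd \<open>k\<close> the chain ends with a full step.
\<close>

lemma log_energy_gradient_le:
  assumes p: "1 < p" and k: "0 < k" and \<alpha>: "\<alpha> k - real k * p + 1 = 0"
    "\<And>i. i \<in> {1..k} \<Longrightarrow> \<alpha> k - (real k - real i) * p \<le> \<alpha> i"
    and \<delta>: "0 < \<theta> + 2 - \<gamma>" and pos: "\<And>i. i < k div 2 \<Longrightarrow> real i * (\<theta> + 2 - \<gamma>) < \<gamma> - 1"
    and \<nu>: "\<nu> = \<alpha> k + real (k div 2) * (\<theta> - \<gamma>) * p"
    and u: "u \<in> X_infty k p \<alpha>" and norm: "wLp_norm p \<nu> (nabla_L \<theta> \<gamma> k u) \<le> 1"
  shows "\<exists>v. has_weak_deriv 1 u v \<and>
    ennreal (hardy_product k (\<gamma> - 1) (\<theta> + 2 - \<gamma>) powr p) * log_energy p {0<..} (\<lambda>r. r * v r) \<le> 1"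
proof -
  let ?\<delta> = "\<theta> + 2 - \<gamma>"
  have p0: "0 < p" using p by simp
  obtain v where v: "\<And>i. i \<le> k \<Longrightarrow> v i \<in> wLp p (\<alpha> i)" "\<And>i. i \<le> k \<Longrightarrow> has_weak_deriv i u (v i)"
    using u unfolding X_infty_def by (auto simp: Bex_def) metis
  have v1: "has_weak_deriv 1 u (v 1)" using v(2)[of 1] k by simp
  have "log_sobolev p (k - 1) (\<lambda>r. r powr real (k - (k - 1)) * v (k - (k - 1)) r)"
    by (rule log_sobolev_scaled_weak_deriv[OF p _ _ \<alpha>]) (use v k in auto)
  moreover have "k - (k - 1) = 1" using k by simp
  ultimately have "log_sobolev p (k - 1) (\<lambda>r. r powr 1 * v 1 r)" by simp
  then have s: "log_sobolev p (k - 1) (\<lambda>r. r * v 1 r)"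
    by (rule log_sobolev_cong) auto
  note int1 = wLp_norm_le_1_imp[OF norm p0]
  show ?thesis
  proof (cases "even k")
    case True
    define j where "j = k div 2 - 1"
    have kj: "k - 1 = 1 + 2 * j" "k div 2 = Suc j" using True k by (auto simp: j_def elim!: evenE)
    let ?c = "\<Prod>i<j. (\<gamma> - 1 - real i * ?\<delta>) * (real (Suc i) * ?\<delta>)"
    let ?a = "\<gamma> - 1 - real j * ?\<delta>"
    have a: "0 < ?a" using pos[of j] kj by simp
    have c: "0 \<le> ?c" using pos kj \<delta> by (intro prod_nonneg mult_nonneg_nonneg) (auto simp: less_imp_le)
    from nabla_L_chain[OF p \<delta> v1, of 1 j] s kj pos
    obtain q e \<sigma> where \<sigma>: "\<bar>\<sigma>\<bar> = 1"
      and w: "AE r in lborel. 0 < r \<longrightarrow> (op_L \<theta> \<gamma> ^^ j) u r = \<sigma> * r powr (- (real j * ?\<delta>)) * q r"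
      and q: "has_weak_deriv 1 q (\<lambda>r. (e r + real j * ?\<delta> * q r) / r)" and e: "log_sobolev p 1 e"
      and N: "ennreal (?c powr p) * log_energy p {0<..} (\<lambda>r. r * v 1 r) \<le> log_energy p {0<..} e"
      by (auto simp del: log_sobolev.simps)
    obtain e' where e': "has_weak_deriv 1 e (\<lambda>r. e' r / r)"
      using e unfolding One_nat_def log_sobolev.simps(2)[of p 0] by blast
    have n: "nabla_L \<theta> \<gamma> k u = op_L \<theta> \<gamma> ((op_L \<theta> \<gamma> ^^ j) u)"
      using True kj by (simp add: nabla_L_def)
    have "AE r in lborel. 0 < r \<longrightarrow> \<bar>nabla_L \<theta> \<gamma> k u r\<bar> = r powr (- (real j * ?\<delta> + ?\<delta>)) * \<bar>e' r + ?a * e r\<bar>"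
      using op_L_step(2)[OF w q e', of \<theta> \<gamma>] unfolding n
      by eventually_elim (use \<sigma> in \<open>auto simp: abs_mult\<close>)
    then have "weighted_energy p \<nu> (nabla_L \<theta> \<gamma> k u)
        = log_energy p {0<..} (\<lambda>r. e' r + ?a * e r)"
    proof (rule log_energy_weight[OF _ p0])
      have "real k = 2 * (real j + 1)" "real (k div 2) = real j + 1" using True kj by (auto elim!: evenE)
      then show "\<nu> = (real j * ?\<delta> + ?\<delta>) * p - 1" using \<alpha>(1) \<nu> by (simp add: algebra_simps)
    qed
    then have le1: "log_energy p {0<..} (\<lambda>r. e' r + ?a * e r) \<le> 1" using int1 by simp
    have "ennreal (\<bar>?a\<bar> powr p) * log_energy p {0<..} e \<le> log_energy p {0<..} (\<lambda>r. e' r + ?a * e r)"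
      by (rule hardy_log_sobolev[OF p _ e' e]) (use a in simp)
    then have N2: "ennreal (\<bar>?a\<bar> powr p) * log_energy p {0<..} e \<le> 1" using le1 by (rule order_trans)
    have "hardy_product k (\<gamma> - 1) ?\<delta> = \<bar>?a\<bar> * ?c" using True kj a by (simp add: hardy_product_def)
    then have "ennreal (hardy_product k (\<gamma> - 1) ?\<delta> powr p) * log_energy p {0<..} (\<lambda>r. r * v 1 r)
       = ennreal (\<bar>?a\<bar> powr p) * (ennreal (?c powr p) * log_energy p {0<..} (\<lambda>r. r * v 1 r))"
      using c by (simp only: powr_mult abs_ge_zero ennreal_mult' powr_ge_zero mult.assoc)
    also have "\<dots> \<le> ennreal (\<bar>?a\<bar> powr p) * log_energy p {0<..} e" by (intro mult_left_mono N) auto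
    also have "\<dots> \<le> 1" by (rule N2)
    finally show ?thesis using v1 by blast
  next
    case False
    define j where "j = k div 2"
    have kj: "k - 1 = 0 + 2 * j" using False by (auto simp: j_def elim!: oddE)
    let ?c = "\<Prod>i<j. (\<gamma> - 1 - real i * ?\<delta>) * (real (Suc i) * ?\<delta>)"
    from nabla_L_chain[OF p \<delta> v1, of 0 j] s kj pos j_def
    obtain q e \<sigma> where \<sigma>: "\<bar>\<sigma>\<bar> = 1"
      and w: "AE r in lborel. 0 < r \<longrightarrow> (op_L \<theta> \<gamma> ^^ j) u r = \<sigma> * r powr (- (real j * ?\<delta>)) * q r"
      and q: "has_weak_deriv 1 q (\<lambda>r. (e r + real j * ?\<delta> * q r) / r)"
      and N: "ennreal (?c powr p) * log_energy p {0<..} (\<lambda>r. r * v 1 r) \<le> log_energy p {0<..} e"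
      by (auto simp del: log_sobolev.simps)
    have n: "nabla_L \<theta> \<gamma> k u = weak_deriv ((op_L \<theta> \<gamma> ^^ j) u)"
      using False kj by (simp add: nabla_L_def)
    have "AE r in lborel. 0 < r \<longrightarrow> \<bar>nabla_L \<theta> \<gamma> k u r\<bar> = r powr (- (real j * ?\<delta> + 1)) * \<bar>e r\<bar>"
      using op_L_step(1)[OF w q] unfolding n
      by eventually_elim (use \<sigma> in \<open>auto simp: abs_mult\<close>)
    then have "weighted_energy p \<nu> (nabla_L \<theta> \<gamma> k u) = log_energy p {0<..} e"
    proof (rule log_energy_weight[OF _ p0])
      have "real k = 2 * real j + 1" "real (k div 2) = real j" using False by (auto simp: j_def elim!: oddE)
      then show "\<nu> = (real j * ?\<delta> + 1) * p - 1" using \<alpha>(1) \<nu> by (simp add: algebra_simps)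
    qed
    then have "log_energy p {0<..} e \<le> 1" using int1 by simp
    moreover have "hardy_product k (\<gamma> - 1) ?\<delta> = ?c" using False by (simp add: hardy_product_def j_def)
    ultimately show ?thesis using N v1 by (auto intro: order_trans)
  qed
qed

section \<open>The subcritical inequality of order one\<close>

lemma Gamma_add_nat_ge: "1 \<le> p \<Longrightarrow> Gamma p * fact n \<le> Gamma (p + real n)" for p :: real
proof (induction n)
  case (Suc n)
  have g: "0 < Gamma p" using Suc.prems by (intro Gamma_real_pos) auto
  have "Gamma p * fact (Suc n) = real (Suc n) * (Gamma p * fact n)" by simp
  also have "\<dots> \<le> (p + real n) * Gamma (p + real n)"
    using Suc g by (intro mult_mono) auto
  also have "\<dots> = Gamma (p + real n + 1)" using Suc.prems by (intro Gamma_plus1_pos[symmetric]) simp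
  finally show ?case by (simp add: add_ac)
qed simp

text \<open>
  Since \<open>\<Gamma>(p + j) \<ge> \<Gamma>(p) j!\<close> for \<open>p \<ge> 1\<close>, the series is dominated term by term by that of the
  exponential function.
\<close>

lemma exp_p_le:
  assumes p: "1 < p" and t: "0 \<le> t"
  shows "exp_p p t \<le> t powr (p - 1) * exp t / Gamma p"
proof -
  have g: "0 < Gamma p" using p by (intro Gamma_real_pos) auto
  have s: "(\<lambda>j. t powr (p - 1) / Gamma p * (t ^ j /\<^sub>R fact j)) sums (t powr (p - 1) / Gamma p * exp t)"
    by (intro sums_mult exp_converges)
  have le: "t powr (p - 1 + real j) / Gamma (p + real j) \<le> t powr (p - 1) / Gamma p * (t ^ j /\<^sub>R fact j)" for j
  proof (cases "t = 0")
    case False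
    have "t powr (p - 1 + real j) / Gamma (p + real j) \<le> t powr (p - 1 + real j) / (Gamma p * fact j)"
      using Gamma_add_nat_ge[of p j] p g by (intro divide_left_mono) (auto intro!: mult_pos_pos Gamma_real_pos)
    also have "\<dots> = t powr (p - 1) / Gamma p * (t ^ j /\<^sub>R fact j)"
    proof -
      have "t powr (p - 1 + real j) = t powr (p - 1) * t ^ j"
        using False t by (simp only: powr_add powr_realpow)
      then show ?thesis using g by (simp add: field_simps)
    qed
    finally show ?thesis .
  qed simp
  have nn: "0 \<le> t powr (p - 1 + real j) / Gamma (p + real j)" for j
    using p by (intro divide_nonneg_pos Gamma_real_pos) auto
  have "summable (\<lambda>j. t powr (p - 1 + real j) / Gamma (p + real j))"
    by (rule summable_comparison_test'[OF sums_summable[OF s], of 0])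
       (simp only: real_norm_def abs_of_nonneg[OF nn] le)
  then have "exp_p p t \<le> t powr (p - 1) / Gamma p * exp t"
    unfolding exp_p_def by (rule sums_le[OF le summable_sums s])
  then show ?thesis by simp
qed

lemma powr_le_exp:
  fixes s d z :: real
  assumes "0 < s" "0 < d" "0 \<le> z"
  shows "z powr s \<le> (s / d) powr s * exp (d * z)"
proof -
  have "d / s * z \<le> exp (d / s * z)" using exp_ge_add_one_self[of "d / s * z"] by linarith
  then have "z \<le> s / d * exp (d / s * z)" using assms by (simp add: field_simps)
  then have "z powr s \<le> (s / d * exp (d / s * z)) powr s" using assms by (intro powr_mono2) auto
  also have "\<dots> = (s / d) powr s * exp (d * z)"
  proof -
    have "d / s * z * s = d * z" using assms by simp
    then show ?thesis using assms by (simp only: powr_mult exp_powr_real exp_ge_zero)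
  qed
  finally show ?thesis .
qed

text \<open>
  A slightly larger exponent absorbs both the shift by \<open>a\<close> and the power in front: for large \<open>y\<close> one has
  \<open>a + y \<le> l y\<close> with \<open>l\<close> close to \<open>1\<close>.
\<close>

lemma shifted_growth_bound:
  fixes a p q \<beta> \<beta>' :: real
  assumes a: "0 < a" and p: "0 < p" and q: "0 < q" and \<beta>: "0 \<le> \<beta>" "\<beta> < \<beta>'"
  shows "\<exists>C>0. \<forall>y\<ge>0. (a + y) powr p * exp (\<beta> * (a + y) powr q) \<le> C * exp (\<beta>' * y powr q)"
proof -
  \<comment> \<open>Enlarging \<open>\<beta>\<close> to \<open>b > 0\<close> allows the division in the choice of \<open>l\<close>, which makes \<open>b l\<^sup>q = c < \<beta>'\<close>.\<close>
  define b where "b = max \<beta> (\<beta>' / 2)"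
  define c where "c = (b + \<beta>') / 2"
  have b: "0 < b" "\<beta> \<le> b" "b < c" "c < \<beta>'" using \<beta> by (auto simp: b_def c_def)
  define l where "l = (c / b) powr (1 / q)"
  have "1 powr (1 / q) < l" unfolding l_def using b q by (intro powr_less_mono2) auto
  then have l: "1 < l" by simp
  have lq: "b * l powr q = c" using b q by (simp add: l_def powr_powr)
  define Y where "Y = a / (l - 1)"
  have Y: "0 < Y" using a l by (simp add: Y_def)
  define C1 where "C1 = (a + Y) powr p * exp (b * (a + Y) powr q)"
  define C2 where "C2 = l powr p * (p / q / (\<beta>' - c)) powr (p / q)"
  have C: "0 < C1" "0 < C2" using a Y l p q b by (auto simp: C1_def C2_def)
  show ?thesis
  proof (intro exI[of _ "C1 + C2"] conjI allI impI)
    fix y :: real assume y: "0 \<le> y"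
    have "(a + y) powr p * exp (\<beta> * (a + y) powr q) \<le> (a + y) powr p * exp (b * (a + y) powr q)"
      using b by (intro mult_left_mono) (auto intro: mult_right_mono)
    also have "\<dots> \<le> (C1 + C2) * exp (\<beta>' * y powr q)"
    proof (cases "y \<le> Y")
      case True
      have "(a + y) powr p * exp (b * (a + y) powr q) \<le> C1"
        unfolding C1_def using True y a p q b by (intro mult_mono powr_mono2 exp_mono mult_left_mono) auto
      also have "\<dots> \<le> C1 + C2" using C by simp
      also have "\<dots> \<le> (C1 + C2) * exp (\<beta>' * y powr q)"
        using C b \<beta> mult_left_mono[of 1 "exp (\<beta>' * y powr q)" "C1 + C2"] by simp
      finally show ?thesis .
    next
      case False
      then have ay: "a + y \<le> l * y" using l by (simp add: Y_def field_simps)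
      have "(a + y) powr p * exp (b * (a + y) powr q) \<le> (l * y) powr p * exp (b * (l * y) powr q)"
        using ay y a p q b by (intro mult_mono powr_mono2 exp_mono mult_left_mono) auto
      also have "\<dots> = l powr p * y powr p * exp (c * y powr q)"
        using l y by (simp add: powr_mult lq[symmetric])
      also have "y powr p = (y powr q) powr (p / q)" using q by (simp add: powr_powr)
      also have "l powr p * (y powr q) powr (p / q) * exp (c * y powr q)
          \<le> l powr p * ((p / q / (\<beta>' - c)) powr (p / q) * exp ((\<beta>' - c) * y powr q)) * exp (c * y powr q)"
        using b p q by (intro mult_right_mono mult_left_mono powr_le_exp) auto
      also have "\<dots> = C2 * (exp ((\<beta>' - c) * y powr q) * exp (c * y powr q))" by (simp add: C2_def)
      also have "exp ((\<beta>' - c) * y powr q) * exp (c * y powr q) = exp (\<beta>' * y powr q)"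
        by (simp add: algebra_simps flip: exp_add)
      also have "C2 * exp (\<beta>' * y powr q) \<le> (C1 + C2) * exp (\<beta>' * y powr q)"
        using C by (intro mult_right_mono) auto
      finally show ?thesis .
    qed
    finally show "(a + y) powr p * exp (\<beta> * (a + y) powr q) \<le> (C1 + C2) * exp (\<beta>' * y powr q)" .
  qed (use C in simp)
qed

text \<open>
  Hoelder's inequality for the measure \<open>dt/t\<close> on \<open>[x,y]\<close>, whose mass is \<open>ln (y/x)\<close>.
\<close>

lemma log_holder_estimate:
  assumes p: "1 < p" and M: "0 \<le> M" and uv: "has_weak_deriv 1 u v"
    and energy: "log_energy p {0<..} (\<lambda>r. r * v r) \<le> ennreal (M powr p)"
  shows "\<exists>N\<in>null_sets lborel. \<forall>x y. x \<notin> N \<longrightarrow> y \<notin> N \<longrightarrow> 0 < x \<longrightarrow> x < y \<longrightarrow>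
    \<bar>u y - u x\<bar> \<le> M * ln (y / x) powr ((p - 1) / p)"
proof -
  obtain N where N: "N \<in> null_sets lborel" and inc: "\<And>x y. x \<notin> N \<Longrightarrow> y \<notin> N \<Longrightarrow> 0 < x \<Longrightarrow> x \<le> y \<Longrightarrow>
      ennreal \<bar>u y - u x\<bar> \<le> (\<integral>\<^sup>+t\<in>{x..y}. ennreal \<bar>v t\<bar> \<partial>lborel)"
    using weak_deriv_increment[OF uv] by blast
  have "locally_integrable v" using uv by (simp add: has_weak_deriv_def)
  then obtain v0 where v0[measurable]: "v0 \<in> borel_measurable borel" "AE r in lborel. 0 < r \<longrightarrow> v r = v0 r"
    using locally_integrable_borel_version by blast
  have "\<bar>u y - u x\<bar> \<le> M * ln (y / x) powr ((p - 1) / p)"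
    if xy: "x \<notin> N" "y \<notin> N" "0 < x" "x < y" for x y
  proof -
    define A where "A = ln (y / x)"
    have A: "0 < A" using xy by (simp add: A_def)
    let ?k = "\<lambda>t. ennreal (1 / t) * indicator {x..y} t"
    have "ennreal \<bar>u y - u x\<bar> \<le> (\<integral>\<^sup>+t\<in>{x..y}. ennreal \<bar>v t\<bar> \<partial>lborel)" using inc xy by simp
    also have "\<dots> = (\<integral>\<^sup>+t. ?k t * ennreal \<bar>t * v0 t\<bar> \<partial>lborel)"
    proof (rule nn_integral_cong_AE)
      show "AE t in lborel. ennreal \<bar>v t\<bar> * indicator {x..y} t = ?k t * ennreal \<bar>t * v0 t\<bar>"
        using v0(2) by eventually_elim
          (use xy in \<open>auto simp: indicator_def abs_mult simp flip: ennreal_mult'\<close>)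
    qed
    finally have "ennreal (\<bar>u y - u x\<bar> powr p)
       \<le> ennreal (A powr (p - 1)) * (\<integral>\<^sup>+t. ?k t * ennreal (\<bar>t * v0 t\<bar> powr p) \<partial>lborel)"
      using A xy by (intro kernel_integral_power_bound p) (auto simp: nn_integral_inverse A_def)
    also have "(\<integral>\<^sup>+t. ?k t * ennreal (\<bar>t * v0 t\<bar> powr p) \<partial>lborel) \<le> log_energy p {0<..} (\<lambda>r. r * v r)"
      unfolding log_energy_def
    proof (rule nn_integral_mono_AE)
      show "AE t in lborel. ?k t * ennreal (\<bar>t * v0 t\<bar> powr p) \<le> ennreal (\<bar>t * v t\<bar> powr p / t) * indicator {0<..} t"
        using v0(2) by eventually_elim
          (use xy in \<open>auto simp: indicator_def simp flip: ennreal_mult'\<close>)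
    qed
    also note energy
    finally have "ennreal (\<bar>u y - u x\<bar> powr p) \<le> ennreal (A powr (p - 1)) * ennreal (M powr p)"
      by (simp add: mult_left_mono)
    then have "\<bar>u y - u x\<bar> powr p \<le> A powr (p - 1) * M powr p"
      by (simp flip: ennreal_mult')
    also have "\<dots> = (M * A powr ((p - 1) / p)) powr p"
      using p M by (simp add: powr_mult powr_powr)
    finally have "\<bar>u y - u x\<bar> powr p \<le> (M * A powr ((p - 1) / p)) powr p" .
    moreover have "0 \<le> M * A powr ((p - 1) / p)" using M by simp
    ultimately show ?thesis
      unfolding A_def[symmetric] using p M
        powr_less_mono2[of p "M * A powr ((p - 1) / p)" "\<bar>u y - u x\<bar>"] by (auto simp: not_less[symmetric])
  qed
  then show ?thesis using N by blast
qed


text \<open>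
  If \<open>\<bar>u\<bar> \<ge> 2\<close> almost everywhere on \<open>[m, e m]\<close>, an interval of mass \<open>1\<close> for \<open>dr/r\<close>, then the integral is at
  least \<open>2\<^sup>p m\<^sup>\<eta>\<^sup>+\<^sup>1\<close>.
\<close>

lemma small_point_beyond:
  assumes p: "1 < p" and N: "N \<in> null_sets lborel" and m: "0 < m"
    and E: "weighted_energy p \<eta> u \<le> ennreal (m powr (\<eta> + 1))"
    and \<eta>: "- 1 < \<eta>"
  shows "\<exists>x\<in>{m..exp 1 * m} - N. \<bar>u x\<bar> < 2"
proof (rule ccontr)
  assume no: "\<not> ?thesis"
  define f where "f r = r powr ((\<eta> + 1) / p) * u r" for r
  have e1: "weighted_energy p \<eta> u = log_energy p {0<..} f"
    by (rule log_energy_weight[where c = "(\<eta> + 1) / p"])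
       (use p in \<open>auto simp: f_def abs_mult simp flip: powr_add mult.assoc\<close>)
  have e2: "ennreal ((2 * m powr ((\<eta> + 1) / p)) powr p * ln (exp 1 * m / m)) \<le> log_energy p {0<..} f"
  proof (rule log_energy_lower_bound[OF N])
    fix x assume x: "x \<in> {m..exp 1 * m} - N"
    then have "2 \<le> \<bar>u x\<bar>" using no by (auto simp: not_less)
    then have "2 * m powr ((\<eta> + 1) / p) \<le> \<bar>u x\<bar> * x powr ((\<eta> + 1) / p)"
      using x m p \<eta> by (intro mult_mono powr_mono2) auto
    then show "2 * m powr ((\<eta> + 1) / p) \<le> \<bar>f x\<bar>" by (simp add: f_def abs_mult mult.commute)
  qed (use m p in auto)
  have "ennreal ((2 * m powr ((\<eta> + 1) / p)) powr p * ln (exp 1 * m / m)) \<le> ennreal (m powr (\<eta> + 1))"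
    by (rule order_trans[OF e2 E[unfolded e1]])
  moreover have "(2 * m powr ((\<eta> + 1) / p)) powr p * ln (exp 1 * m / m) = 2 powr p * m powr (\<eta> + 1)"
    using m p by (simp add: powr_mult powr_powr)
  ultimately have "ennreal (2 powr p * m powr (\<eta> + 1)) \<le> ennreal (m powr (\<eta> + 1))" by (simp only:)
  then have "2 powr p * m powr (\<eta> + 1) \<le> m powr (\<eta> + 1)" by simp
  then have "2 powr p \<le> 1" using m by simp
  moreover have "1 < 2 powr p" using p by (simp add: gr_one_powr)
  ultimately show False by simp
qed

text \<open>
  The constant is found before \<open>u\<close> and \<open>v\<close> are chosen, so it depends on \<open>p\<close>, \<open>\<eta>\<close>, \<open>\<beta>\<close> and \<open>M\<close> only.
\<close>

lemma subcritical_inequality: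
  assumes p: "1 < p" and \<eta>: "- 1 < \<eta>" and \<beta>: "0 \<le> \<beta>" and M: "0 < M"
    and sub: "\<beta> * M powr (p / (p - 1)) < \<eta> + 1"
  shows "\<exists>C>0. \<forall>u v. has_weak_deriv 1 u v \<longrightarrow> log_energy p {0<..} (\<lambda>r. r * v r) \<le> ennreal (M powr p) \<longrightarrow>
    (\<integral>\<^sup>+r\<in>{0<..}. ennreal (exp_p p (\<beta> * \<bar>u r\<bar> powr (p / (p - 1))) * r powr \<eta>) \<partial>lborel)
      \<le> ennreal C * weighted_energy p \<eta> u"
proof -
  define q where "q = p / (p - 1)"
  have q: "0 < q" "(p - 1) / p * q = 1" "q * (p - 1) = p" using p by (auto simp: q_def)
  define Q where "Q = (\<eta> + 1) / M powr q"
  \<comment> \<open>\<open>\<beta>'\<close> lies strictly between \<open>\<beta>\<close> and the critical value, which leaves room for the shift in \<open>2 + y\<close>.\<close>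
  define \<beta>' where "\<beta>' = (\<beta> + Q) / 2"
  have Mq: "0 < M powr q" using M by simp
  have "\<beta> < Q" using sub Mq by (simp add: pos_less_divide_eq q_def Q_def)
  then have \<beta>': "\<beta> < \<beta>'" "\<beta>' < (\<eta> + 1) / M powr q" by (auto simp: \<beta>'_def simp flip: Q_def)
  define \<mu> where "\<mu> = \<beta>' * M powr q"
  have \<mu>: "0 < \<mu>" "\<mu> < \<eta> + 1" using \<beta>' \<beta> Mq by (auto simp: \<mu>_def pos_less_divide_eq)
  obtain C3 where C3: "0 < C3"
    "\<And>y. 0 \<le> y \<Longrightarrow> (2 + y) powr p * exp (\<beta> * (2 + y) powr q) \<le> C3 * exp (\<beta>' * y powr q)"
    using shifted_growth_bound[of 2 p q \<beta> \<beta>'] p q \<beta> \<beta>' by auto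
  define K where "K = \<beta> powr (p - 1) / Gamma p"
  have K: "0 \<le> K" using p by (simp add: K_def Gamma_real_pos less_imp_le)
  define C1 where "C1 = K * exp (\<beta> * (2 + M) powr q)"
  define D where "D = K * C3 * exp \<mu>"
  define C2 where "C2 = D / (\<eta> + 1 - \<mu>)"
  have C12: "0 \<le> C1" "0 \<le> D" "0 \<le> C2" using K C3 \<mu> by (auto simp: C1_def C2_def D_def)
  have growth: "exp_p p (\<beta> * \<bar>x\<bar> powr q) \<le> K * (\<bar>x\<bar> powr p * exp (\<beta> * \<bar>x\<bar> powr q))" for x
  proof -
    have "exp_p p (\<beta> * \<bar>x\<bar> powr q) \<le> (\<beta> * \<bar>x\<bar> powr q) powr (p - 1) * exp (\<beta> * \<bar>x\<bar> powr q) / Gamma p"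
      using \<beta> by (intro exp_p_le p) auto
    also have "(\<beta> * \<bar>x\<bar> powr q) powr (p - 1) = \<beta> powr (p - 1) * \<bar>x\<bar> powr p"
      using \<beta> q by (simp add: powr_mult powr_powr)
    finally show ?thesis by (simp add: K_def)
  qed
  let ?X = "\<lambda>u. \<integral>\<^sup>+r\<in>{0<..}. ennreal (exp_p p (\<beta> * \<bar>u r\<bar> powr q) * r powr \<eta>) \<partial>lborel"
  have main: "?X u
      \<le> ennreal C1 * weighted_energy p \<eta> u + ennreal (C2 * R powr (\<eta> + 1))"
    if uv: "has_weak_deriv 1 u v" and en: "log_energy p {0<..} (\<lambda>r. r * v r) \<le> ennreal (M powr p)"
      and R: "0 < R" and E: "weighted_energy p \<eta> u \<le> ennreal (R powr (\<eta> + 1))"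
    for u v R
  proof -
    obtain N where N: "N \<in> null_sets lborel" and hoelder: "\<And>x y. x \<notin> N \<Longrightarrow> y \<notin> N \<Longrightarrow> 0 < x \<Longrightarrow> x < y \<Longrightarrow>
      \<bar>u y - u x\<bar> \<le> M * ln (y / x) powr ((p - 1) / p)"
      using log_holder_estimate[OF p _ uv en] M by auto
    have bound: "\<bar>u y\<bar> \<le> 2 + M * (1 + ln (max y R / y)) powr ((p - 1) / p)" if y: "0 < y" "y \<notin> N" for y
    proof -
      define m where "m = max y R"
      have m: "0 < m" "y \<le> m" "R \<le> m" using y by (auto simp: m_def)
      have "ennreal (R powr (\<eta> + 1)) \<le> ennreal (m powr (\<eta> + 1))"
        using R m \<eta> by (intro ennreal_leI powr_mono2) auto
      then obtain x where x: "x \<in> {m..exp 1 * m} - N" "\<bar>u x\<bar> < 2"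
        using small_point_beyond[OF p N m(1) order_trans[OF E] \<eta>] by blast
      have ly: "0 \<le> ln (m / y)" using m y by simp
      show ?thesis
      proof (cases "x = y")
        case True
        have "0 \<le> M * (1 + ln (max y R / y)) powr ((p - 1) / p)" using M by simp
        moreover have "\<bar>u y\<bar> \<le> 2" using x(2) True by simp
        ultimately show ?thesis by (rule add_increasing2)
      next
        case False
        then have xy: "y < x" using x m by auto
        have "x / y \<le> exp 1 * m / y" using x y by (intro divide_right_mono) auto
        then have "ln (x / y) \<le> ln (exp 1 * (m / y))" using xy y m by (subst ln_le_cancel_iff) auto
        also have "\<dots> = 1 + ln (m / y)" using m y by (subst ln_mult) auto
        finally have "ln (x / y) powr ((p - 1) / p) \<le> (1 + ln (m / y)) powr ((p - 1) / p)"
          using xy y p by (intro powr_mono2) auto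
        then have "\<bar>u x - u y\<bar> \<le> M * (1 + ln (m / y)) powr ((p - 1) / p)"
          using hoelder[OF y(2) _ y(1) xy] x M by (auto intro: order_trans mult_left_mono)
        moreover have "\<bar>u y\<bar> \<le> 2 + \<bar>u x - u y\<bar>" using x(2) by arith
        ultimately show ?thesis unfolding m_def by (simp only: order_trans add_left_mono)
      qed
    qed
    have "locally_integrable u" using uv by (simp add: has_weak_deriv_def)
    then obtain u0 where u0[measurable]: "u0 \<in> borel_measurable borel" "AE r in lborel. 0 < r \<longrightarrow> u r = u0 r"
      using locally_integrable_borel_version by blast
    have "?X u
      \<le> (\<integral>\<^sup>+r. ennreal C1 * (ennreal (\<bar>u0 r\<bar> powr p * r powr \<eta>) * indicator {0<..} r)
          + ennreal (D * R powr \<mu>) * (ennreal (r powr ((\<eta> + 1 - \<mu>) - 1)) * indicator {0<..R} r) \<partial>lborel)"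
    proof (rule nn_integral_mono_AE)
      show "AE r in lborel. ennreal (exp_p p (\<beta> * \<bar>u r\<bar> powr q) * r powr \<eta>) * indicator {0<..} r
        \<le> ennreal C1 * (ennreal (\<bar>u0 r\<bar> powr p * r powr \<eta>) * indicator {0<..} r)
          + ennreal (D * R powr \<mu>) * (ennreal (r powr ((\<eta> + 1 - \<mu>) - 1)) * indicator {0<..R} r)"
        using u0(2) AE_not_in[OF N]
      proof eventually_elim
        case (elim r)
        show ?case
        proof (cases "0 < r")
          case r: True
          note b = bound[OF r elim(2)]
          have u: "u r = u0 r" using elim(1) r by simp
          show ?thesis
          proof (cases "R \<le> r")
            case True
            then have "\<bar>u r\<bar> \<le> 2 + M" using b r by (simp add: max_def)
            then have "exp (\<beta> * \<bar>u r\<bar> powr q) \<le> exp (\<beta> * (2 + M) powr q)"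
              using \<beta> q by (intro exp_mono mult_left_mono powr_mono2) auto
            then have "K * (\<bar>u r\<bar> powr p * exp (\<beta> * \<bar>u r\<bar> powr q)) \<le> K * (\<bar>u r\<bar> powr p * exp (\<beta> * (2 + M) powr q))"
              using K by (intro mult_left_mono) auto
            then have "exp_p p (\<beta> * \<bar>u r\<bar> powr q) \<le> C1 * \<bar>u r\<bar> powr p"
              using growth[of "u r"] by (simp add: C1_def mult_ac)
            then have "exp_p p (\<beta> * \<bar>u r\<bar> powr q) * r powr \<eta> \<le> C1 * (\<bar>u r\<bar> powr p * r powr \<eta>)"
              by (metis mult.assoc mult_right_mono powr_ge_zero)
            then have "ennreal (exp_p p (\<beta> * \<bar>u r\<bar> powr q) * r powr \<eta>) \<le> ennreal C1 * ennreal (\<bar>u r\<bar> powr p * r powr \<eta>)"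
              using C12(1) by (simp add: ennreal_leI flip: ennreal_mult')
            then show ?thesis using r u by (simp add: add_increasing2)
          next
            case False
            define T where "T = 1 + ln (R / r)"
            have T: "0 \<le> T" using False r R by (simp add: T_def add_nonneg_nonneg)
            define y where "y = M * T powr ((p - 1) / p)"
            have y: "0 \<le> y" "\<bar>u r\<bar> \<le> 2 + y" using b False M by (auto simp: y_def T_def max_def)
            have yq: "\<beta>' * y powr q = \<mu> * T"
              using M q T by (simp add: y_def \<mu>_def powr_mult powr_powr)
            have "\<bar>u r\<bar> powr p \<le> (2 + y) powr p" by (rule powr_mono2[OF _ _ y(2)]) (use p in simp_all)
            moreover have "\<bar>u r\<bar> powr q \<le> (2 + y) powr q" by (rule powr_mono2[OF _ _ y(2)]) (use q(1) in simp_all)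
            then have "exp (\<beta> * \<bar>u r\<bar> powr q) \<le> exp (\<beta> * (2 + y) powr q)"
              unfolding exp_le_cancel_iff by (rule mult_left_mono[OF _ \<beta>])
            ultimately have "\<bar>u r\<bar> powr p * exp (\<beta> * \<bar>u r\<bar> powr q) \<le> (2 + y) powr p * exp (\<beta> * (2 + y) powr q)"
              by (rule mult_mono[OF _ _ powr_ge_zero exp_ge_zero])
            also have "\<dots> \<le> C3 * exp (\<mu> * T)" using C3(2)[OF y(1)] yq by simp
            also have "exp (\<mu> * T) = exp \<mu> * (R powr \<mu> * r powr (- \<mu>))"
            proof -
              have "exp (\<mu> * T) = exp \<mu> * exp (\<mu> * ln (R / r))"
                by (simp only: T_def distrib_left exp_add mult_1_right)
              also have "exp (\<mu> * ln (R / r)) = (R / r) powr \<mu>" using r R by (simp add: powr_def)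
              also have "\<dots> = R powr \<mu> * r powr (- \<mu>)"
                using r R by (simp add: powr_divide powr_minus_divide)
              finally show ?thesis .
            qed
            finally have "K * (\<bar>u r\<bar> powr p * exp (\<beta> * \<bar>u r\<bar> powr q))
                \<le> K * (C3 * (exp \<mu> * (R powr \<mu> * r powr (- \<mu>))))" by (rule mult_left_mono[OF _ K])
            then have "exp_p p (\<beta> * \<bar>u r\<bar> powr q) \<le> D * R powr \<mu> * r powr (- \<mu>)"
              using order_trans[OF growth[of "u r"]] by (simp add: D_def mult_ac)
            then have "exp_p p (\<beta> * \<bar>u r\<bar> powr q) * r powr \<eta> \<le> D * R powr \<mu> * r powr (- \<mu>) * r powr \<eta>"
              by (rule mult_right_mono) simp
            also have "\<dots> = D * R powr \<mu> * r powr ((\<eta> + 1 - \<mu>) - 1)"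
              by (simp add: mult.assoc algebra_simps flip: powr_add)
            finally have "ennreal (exp_p p (\<beta> * \<bar>u r\<bar> powr q) * r powr \<eta>)
                \<le> ennreal (D * R powr \<mu>) * ennreal (r powr ((\<eta> + 1 - \<mu>) - 1))"
              using C12(2) by (simp add: ennreal_leI flip: ennreal_mult'')
            then show ?thesis using r False by (simp add: add_increasing)
          qed
        qed simp
      qed
    qed
    also have "\<dots> = ennreal C1 * weighted_energy p \<eta> u0
        + ennreal (D * R powr \<mu>) * ennreal (R powr (\<eta> + 1 - \<mu>) / (\<eta> + 1 - \<mu>))"
      using nn_integral_powr_initial[of "\<eta> + 1 - \<mu>" R] \<mu> R
      by (simp add: nn_integral_add nn_integral_cmult)
    also have "weighted_energy p \<eta> u0
       = weighted_energy p \<eta> u"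
    proof (rule nn_integral_cong_AE)
      show "AE r in lborel. ennreal (\<bar>u0 r\<bar> powr p * r powr \<eta>) * indicator {0<..} r
          = ennreal (\<bar>u r\<bar> powr p * r powr \<eta>) * indicator {0<..} r"
        using u0(2) by eventually_elim (auto simp: indicator_def)
    qed
    also have "ennreal (D * R powr \<mu>) * ennreal (R powr (\<eta> + 1 - \<mu>) / (\<eta> + 1 - \<mu>)) = ennreal (C2 * R powr (\<eta> + 1))"
    proof -
      have "R powr \<mu> * R powr (\<eta> + 1 - \<mu>) = R powr (\<eta> + 1)" by (simp flip: powr_add)
      then have "D * R powr \<mu> * (R powr (\<eta> + 1 - \<mu>) / (\<eta> + 1 - \<mu>)) = C2 * R powr (\<eta> + 1)"
        by (simp add: C2_def)
      then show ?thesis using C12(2) by (simp flip: ennreal_mult')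
    qed
    finally show ?thesis .
  qed
  show ?thesis
  proof (intro exI[of _ "C1 + C2 + 1"] conjI allI impI)
    show "0 < C1 + C2 + 1" using C12 by simp
    fix u v assume uv: "has_weak_deriv 1 u v" "log_energy p {0<..} (\<lambda>r. r * v r) \<le> ennreal (M powr p)"
    define E where "E = weighted_energy p \<eta> u"
    show "(\<integral>\<^sup>+r\<in>{0<..}. ennreal (exp_p p (\<beta> * \<bar>u r\<bar> powr (p / (p - 1))) * r powr \<eta>) \<partial>lborel)
        \<le> ennreal (C1 + C2 + 1) * weighted_energy p \<eta> u"
      unfolding E_def[symmetric] q_def[symmetric]
    proof (cases E)
      case top
      then show "?X u \<le> ennreal (C1 + C2 + 1) * E"
        using C12 by (simp add: ennreal_mult_top)
    next
      case (real e)
      have "?X u \<le> ennreal ((C1 + C2) * e)"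
      proof (rule ennreal_le_epsilon)
        fix \<epsilon> :: real assume \<epsilon>: "0 < \<epsilon>"
        \<comment> \<open>The \<open>p\<close>-th power \<open>e\<close> of the norm may vanish, whereas \<open>R\<close> has to be positive.\<close>
        define \<epsilon>' where "\<epsilon>' = \<epsilon> / (C2 + 1)"
        have \<epsilon>': "0 < \<epsilon>'" "C2 * \<epsilon>' \<le> \<epsilon>" using \<epsilon> C12 by (auto simp: \<epsilon>'_def field_simps)
        define R where "R = (e + \<epsilon>') powr (1 / (\<eta> + 1))"
        have R: "0 < R" "R powr (\<eta> + 1) = e + \<epsilon>'" using \<epsilon>' real \<eta> by (auto simp: R_def powr_powr)
        have "E \<le> ennreal (R powr (\<eta> + 1))" using real \<epsilon>' R by (simp add: ennreal_leI)
        then have "?X u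
            \<le> ennreal C1 * E + ennreal (C2 * R powr (\<eta> + 1))"
          using main[OF uv R(1)] by (simp add: E_def)
        also have "\<dots> = ennreal (C1 * e + C2 * (e + \<epsilon>'))"
          using real C12 \<epsilon>' R by (simp flip: ennreal_mult')
        also have "\<dots> \<le> ennreal ((C1 + C2) * e + \<epsilon>)"
          using \<epsilon>' by (intro ennreal_leI) (simp add: algebra_simps)
        also have "\<dots> = ennreal ((C1 + C2) * e) + ennreal \<epsilon>" using C12 real \<epsilon> by simp
        finally show "?X u
          \<le> ennreal ((C1 + C2) * e) + ennreal \<epsilon>" .
      qed
      also have "\<dots> \<le> ennreal ((C1 + C2 + 1) * e)" using real by (intro ennreal_leI mult_right_mono) auto
      also have "\<dots> = ennreal (C1 + C2 + 1) * E" using real C12 by (simp add: ennreal_mult')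
      finally show "?X u \<le> ennreal (C1 + C2 + 1) * E" .
    qed
  qed
qed

lemma ennpowr_wLp_norm:
  assumes "0 < p"
  shows "ennpowr (wLp_norm p a u) p = weighted_energy p a u"
proof -
  define I where "I = weighted_energy p a u"
  have "wLp_norm p a u = ennpowr I (1 / p)" by (simp add: wLp_norm_def I_def nn_integral_completion)
  moreover have "ennpowr (ennpowr I (1 / p)) p = I"
    using assms by (cases I) (auto simp: ennpowr_def powr_powr)
  ultimately show ?thesis by (simp add: I_def)
qed

lemma hardy_product_pos:
  assumes k: "0 < k" and \<delta>: "0 < \<delta>" and pos: "\<And>i. i < k div 2 \<Longrightarrow> real i * \<delta> < G"
  shows "0 < hardy_product k G \<delta>"
proof (cases "even k")
  case True
  then have "0 < k div 2" using k by auto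
  then show ?thesis unfolding hardy_product_def using True pos[of "k div 2 - 1"]
    by (auto intro!: mult_pos_pos prod_pos \<delta> pos)
next
  case False
  then show ?thesis unfolding hardy_product_def by (auto intro!: prod_pos mult_pos_pos \<delta> pos)
qed

theorem corollary1p1:
  fixes k :: nat and p \<eta> \<gamma> \<beta> B :: real
  assumes "0 < k" and "1 < p" and "- 1 < \<eta>"
    and "\<gamma> = (2 * p - 1 + (p - 1) * \<eta>) / p"
    and "0 \<le> \<beta>" and "\<beta> < B"
  shows "\<exists>C>0. \<forall>(\<alpha> :: nat \<Rightarrow> real) (\<theta> :: real) (\<nu> :: real).
           \<alpha> k - real k * p + 1 = 0 \<longrightarrow>
           (\<forall>i\<in>{1..k}. \<alpha> i \<ge> \<alpha> k - (real k - real i) * p) \<longrightarrow>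
           \<theta> + 2 > \<gamma> \<longrightarrow>
           \<theta> > real (k div 2) * (\<theta> + 2 - \<gamma>) - 1 \<longrightarrow>
           \<nu> = \<alpha> k + real (k div 2) * (\<theta> - \<gamma>) * p \<longrightarrow>
           beta0 k p \<eta> \<gamma> \<theta> = B \<longrightarrow>
           (\<forall>u\<in>X_infty k p \<alpha>. wLp_norm p \<nu> (nabla_L \<theta> \<gamma> k u) \<le> 1 \<longrightarrow>
              (\<integral>\<^sup>+r\<in>{0<..}. ennreal (exp_p p (\<beta> * \<bar>u r\<bar> powr (p / (p - 1))) * r powr \<eta>) \<partial>lebesgue)
                \<le> ennreal C * ennpowr (wLp_norm p \<eta> u) p)"
proof -
  note k = assms(1) and p = assms(2) and \<eta> = assms(3)
  have B: "0 < B" using assms(5,6) by simp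
  \<comment> \<open>This is \<open>1 / H\<close> for the product \<open>H\<close> of Hardy factors, expressed by \<open>B\<close> so as to be independent of \<open>\<theta>\<close>.\<close>
  define M where "M = ((\<eta> + 1) / B) powr ((p - 1) / p)"
  have M: "0 < M" using B \<eta> by (simp add: M_def)
  have "M powr (p / (p - 1)) = (\<eta> + 1) / B"
    using B \<eta> p by (simp add: M_def powr_powr)
  moreover have "\<beta> * (\<eta> + 1) < (\<eta> + 1) * B"
    using mult_strict_right_mono[OF assms(6), of "\<eta> + 1"] \<eta> by (simp add: mult.commute)
  ultimately have "\<beta> * M powr (p / (p - 1)) < \<eta> + 1" using B by (simp add: pos_divide_less_eq)
  from subcritical_inequality[OF p \<eta> assms(5) M this] obtain C where C: "0 < C"
    and main: "\<And>u v. has_weak_deriv 1 u v \<Longrightarrow> log_energy p {0<..} (\<lambda>r. r * v r) \<le> ennreal (M powr p) \<Longrightarrow>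
      (\<integral>\<^sup>+r\<in>{0<..}. ennreal (exp_p p (\<beta> * \<bar>u r\<bar> powr (p / (p - 1))) * r powr \<eta>) \<partial>lborel)
      \<le> ennreal C * weighted_energy p \<eta> u" by blast
  have G: "\<gamma> - 1 = (p - 1) * (\<eta> + 1) / p" using assms(4) p by (simp add: field_simps)
  then have G0: "0 < \<gamma> - 1" using p \<eta> by simp
  show ?thesis
  proof (intro exI[of _ C] conjI C allI impI ballI)
    fix \<alpha> :: "nat \<Rightarrow> real" and \<theta> \<nu> :: real and u
    assume \<alpha>: "\<alpha> k - real k * p + 1 = 0" "\<forall>i\<in>{1..k}. \<alpha> i \<ge> \<alpha> k - (real k - real i) * p"
      and \<theta>: "\<gamma> < \<theta> + 2" "\<theta> > real (k div 2) * (\<theta> + 2 - \<gamma>) - 1"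
      and \<nu>: "\<nu> = \<alpha> k + real (k div 2) * (\<theta> - \<gamma>) * p"
      and b: "beta0 k p \<eta> \<gamma> \<theta> = B" and u: "u \<in> X_infty k p \<alpha>" "wLp_norm p \<nu> (nabla_L \<theta> \<gamma> k u) \<le> 1"
    define \<delta> where "\<delta> = \<theta> + 2 - \<gamma>"
    have \<delta>: "0 < \<delta>" using \<theta> by (simp add: \<delta>_def)
    have pos: "real i * \<delta> < \<gamma> - 1" if "i < k div 2" for i
    proof -
      have "(real i + 1) * \<delta> \<le> real (k div 2) * \<delta>" using that \<delta> by (intro mult_right_mono) auto
      also have "\<dots> < \<theta> + 1" using \<theta>(2) by (simp add: \<delta>_def)
      finally show ?thesis by (simp add: \<delta>_def algebra_simps)
    qed
    define H where "H = hardy_product k (\<gamma> - 1) \<delta>"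
    have H: "0 < H" unfolding H_def by (rule hardy_product_pos[OF k \<delta> pos])
    have BH: "B = (\<eta> + 1) * H powr (p / (p - 1))"
      using beta0_eq_hardy_product[OF k _ G0, of \<theta> p \<eta>] pos \<delta> b by (simp add: H_def \<delta>_def)
    have "(\<eta> + 1) / B = H powr (- (p / (p - 1)))"
      unfolding BH using \<eta> H by (simp add: powr_minus_divide)
    then have MH: "M powr p = H powr (- p)"
      using p H by (simp add: M_def powr_powr powr_divide powr_minus_divide)
    obtain v where v: "has_weak_deriv 1 u v" "ennreal (H powr p) * log_energy p {0<..} (\<lambda>r. r * v r) \<le> 1"
      using log_energy_gradient_le[OF p k \<alpha>(1) _ _ _ \<nu> u] \<alpha>(2) pos \<delta> by (auto simp: H_def \<delta>_def)
    have "log_energy p {0<..} (\<lambda>r. r * v r) = ennreal (H powr (- p)) * (ennreal (H powr p) * log_energy p {0<..} (\<lambda>r. r * v r))"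
      using H by (simp flip: mult.assoc ennreal_mult' powr_add)
    also have "\<dots> \<le> ennreal (H powr (- p)) * 1" by (intro mult_left_mono v) simp
    finally have "log_energy p {0<..} (\<lambda>r. r * v r) \<le> ennreal (M powr p)" using MH by simp
    from main[OF v(1) this] p
    show "(\<integral>\<^sup>+r\<in>{0<..}. ennreal (exp_p p (\<beta> * \<bar>u r\<bar> powr (p / (p - 1))) * r powr \<eta>) \<partial>lebesgue)
        \<le> ennreal C * ennpowr (wLp_norm p \<eta> u) p"
      by (simp add: nn_integral_completion ennpowr_wLp_norm)
  qed
qed

end
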